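(* Assume $\Bbbk$ has characteristic zero. Let $n\ge1$ and $\lambda\vdash n$. If $\lambda$ is not a hook, i.e. $\lambda\neq(s,1^{n-s})$ for all $1\le s\le n$, then $$S_\lambda(P^{\mathbf{FA}})\cong\bigoplus_{\nu\preceq\lambda,\ \lambda/\nu\ \text{horizontal strip}}S_\nu(\overline P).$$ If $\lambda=(s,1^{n-s})$ with $1\le s\le n$, then $$S_\lambda(P^{\mathbf{FA}})\cong\bigoplus_{\substack{\nu\preceq\lambda,\ \lambda/\nu\ \text{horizontal strip}\\ \nu\notin\{(1^{n-s+1}),(1^{n-s})\}}}S_\nu(\overline P)\ \oplus\ \Lambda^{n-s+1}(P^{\mathbf{FA}}).$$
   Context: Let $\Bbbk$ be a field. $\mathbf{FA}$ denotes the category of finite sets and all maps, and $\mathbf{FI}$, $\mathbf{FS}$, $\mathbf{FB}$ its wide subcategories of injections, surjections and bijections respectively; $\mathbf n=\{1,\dots,n\}$ for $n\in\mathbb N$ ($\mathbf 0=\emptyset$), and $\mathfrak S_n$ is the symmetric group. For a category $\mathcal C$, $\Bbbk\mathcal C(X,Y)$ is the $\Bbbk$-vector space with basis $\mathcal C(X,Y)$. A $\Bbbk\mathbf{FA}$-module is a functor from $\mathbf{FA}$ to $\Bbbk$-vector spaces (these form the abelian category $\mathcal F(\mathbf{FA})$); $\otimes$ denotes the pointwise tensor product over $\Bbbk$, and $\hom_{\Bbbk\mathbf{FA}}$ denotes natural transformations. $P^{\mathbf{FA}}_{\mathbf n}:=\Bbbk\mathbf{FA}(\mathbf n,-)$,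 so $P^{\mathbf{FA}}_{\mathbf n}(X)\cong\Bbbk[X]^{\otimes n}$ (where $\Bbbk[X]$ has basis $\{[x]:x\in X\}$), with the right $\mathfrak S_n$-action by precomposition, equivalently place permutation of tensor factors; write $P^{\mathbf{FA}}:=P^{\mathbf{FA}}_{\mathbf 1}$. Let $\overline{\Bbbk}$ be the functor with value $\Bbbk$ on non-empty sets (all maps acting by the identity) and $0$ on $\emptyset$, and $\Bbbk_{\mathbf 0}$ the functor with value $\Bbbk$ on $\emptyset$ and $0$ on non-empty sets. $\overline P$ is the kernel of the surjection $P^{\mathbf{FA}}\to\overline\Bbbk$, $[x]\mapsto 1$; thus $\overline P(X)=\{\sum_x a_x[x]:\sum_x a_x=0\}$. For $n\ge1$, $\overline P^{\otimes n}$ is the $n$-fold pointwise tensor power, a subfunctor of $P^{\mathbf{FA}}_{\mathbf n}$ stable under the place-permutation right action of $\mathfrak S_n$; by convention $\overline P^{\otimes 0}:=\overline\Bbbk$. For a partition $\lambda\vdash n$, $S_\lambda$ is the associated simple $\Bbbk\mathfrak S_n$-module, with $S_{(n)}$ trivial and $S_{(1^n)}=\mathsf{sgn}_n$ the sign representation. For a $\Bbbk\mathbf{FA}$-module $F$, $S_\lambda(F):=F^{\otimes n}\otimes_{\mathfrak S_n}S_\lambda$ (using the place-permutation right action on $F^{\otimes n}$), and $\Lambda^n(F):=S_{(1^n)}(F)$ is the $n$-th exterior power; conventions: $\Lambda^0(P^{\mathbf{FA}})=\Bbbk$ (the constant functor), $\Lambda^0(\overline P)=\overline\Bbbk$, $\Lambda^{-1}(\overline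 P)=\Bbbk_{\mathbf 0}$. For partitions $\nu,\lambda$, $\nu\preceq\lambda$ means $\nu_i\le\lambda_i$ for all $i$ (Young diagram containment), and $\lambda/\nu$ is a horizontal strip if the skew diagram has at most one box in each column; $(1^0)$ denotes the empty partition. *)

theory Defs
  imports "HOL-Combinatorics.Permutations"
begin

definition is_partition :: "nat list \<Rightarrow> nat \<Rightarrow> bool" where
  "is_partition lam n \<longleftrightarrow> sorted_wrt (\<ge>) lam \<and> (\<forall>x\<in>set lam. 0 < x) \<and> sum_list lam = n"

definition part_at :: "nat list \<Rightarrow> nat \<Rightarrow> nat" where
  "part_at lam i = (if i < length lam then lam ! i else 0)"

definition part_le :: "nat list \<Rightarrow> nat list \<Rightarrow> bool" where
  "part_le nu lam \<longleftrightarrow> (\<forall>i. part_at nu i \<le> part_at lam i)"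

definition young_diagram :: "nat list \<Rightarrow> (nat \<times> nat) set" where
  "young_diagram lam = {(i, j). i < length lam \<and> j < lam ! i}"

definition horizontal_strip :: "nat list \<Rightarrow> nat list \<Rightarrow> bool" where
  "horizontal_strip lam nu \<longleftrightarrow>
     (\<forall>j. card {i. (i, j) \<in> young_diagram lam - young_diagram nu} \<le> 1)"

definition is_hook :: "nat list \<Rightarrow> nat \<Rightarrow> bool" where
  "is_hook lam n \<longleftrightarrow> (\<exists>s. 1 \<le> s \<and> s \<le> n \<and> lam = s # replicate (n - s) 1)"

text \<open>An FA-module is given by its values on the sets {0..<m} (a skeleton of FA),
  realised as subsets of a space of 'k-valued functions, together with the action
  act f m m' : F(m) -> F(m') of a map f : {0..<m} -> {0..<m'}.\<close>
record ('v) famod =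
  obj :: "nat \<Rightarrow> 'v set"
  act :: "(nat \<Rightarrow> nat) \<Rightarrow> nat \<Rightarrow> nat \<Rightarrow> 'v \<Rightarrow> 'v"

definition fa_map :: "(nat \<Rightarrow> nat) \<Rightarrow> nat \<Rightarrow> nat \<Rightarrow> bool" where
  "fa_map f m m' \<longleftrightarrow> f ` {..<m} \<subseteq> {..<m'}"

definition fa_iso :: "('a \<Rightarrow> 'k::field) famod \<Rightarrow> ('b \<Rightarrow> 'k) famod \<Rightarrow> bool" where
  "fa_iso A B \<longleftrightarrow> (\<exists>\<phi> :: nat \<Rightarrow> ('a \<Rightarrow> 'k) \<Rightarrow> ('b \<Rightarrow> 'k).
     (\<forall>m. (\<forall>x\<in>obj A m. \<forall>y\<in>obj A m. \<phi> m (\<lambda>z. x z + y z) = (\<lambda>z. \<phi> m x z + \<phi> m y z))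
        \<and> (\<forall>x\<in>obj A m. \<forall>c. \<phi> m (\<lambda>z. c * x z) = (\<lambda>z. c * \<phi> m x z))
        \<and> bij_betw (\<phi> m) (obj A m) (obj B m))
   \<and> (\<forall>m m' f x. fa_map f m m' \<longrightarrow> x \<in> obj A m \<longrightarrow>
        \<phi> m' (act A f m m' x) = act B f m m' (\<phi> m x)))"

definition fa_dsum :: "'i set \<Rightarrow> ('i \<Rightarrow> ('a \<Rightarrow> 'k::field) famod) \<Rightarrow> ('i \<times> 'a \<Rightarrow> 'k) famod" where
  "fa_dsum I M = \<lparr> obj = (\<lambda>m. {u. (\<forall>i\<in>I. (\<lambda>a. u (i, a)) \<in> obj (M i) m)
                                   \<and> (\<forall>i a. i \<notin> I \<longrightarrow> u (i, a) = 0)}),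
                  act = (\<lambda>f m m' u (i, a). if i \<in> I then act (M i) f m m' (\<lambda>b. u (i, b)) a else 0) \<rparr>"

text \<open>A tensor of rank n on {0..<m}: a 'k-valued function on lists (words) of length n
  with letters in {0..<m}; v xs is the coefficient of [xs!0] (x) ... (x) [xs!(n-1)].\<close>
type_synonym 'k tensor = "nat list \<Rightarrow> 'k"

definition tens :: "nat \<Rightarrow> nat \<Rightarrow> 'k::field tensor set" where
  "tens n m = {v. \<forall>xs. v xs \<noteq> 0 \<longrightarrow> length xs = n \<and> set xs \<subseteq> {..<m}}"

definition push :: "(nat \<Rightarrow> nat) \<Rightarrow> nat \<Rightarrow> nat \<Rightarrow> 'k::field tensor \<Rightarrow> 'k tensor" where
  "push f m m' v = (\<lambda>ys. \<Sum>xs \<in> {xs. length xs = length ys \<and> set xs \<subseteq> {..<m} \<and> map f xs = ys}. v xs)"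

definition tmod :: "(nat \<Rightarrow> 'k::field tensor set) \<Rightarrow> 'k tensor famod" where
  "tmod F = \<lparr> obj = F, act = push \<rparr>"

definition fspan :: "'k::field tensor set \<Rightarrow> 'k tensor set" where
  "fspan S = {v. \<exists>A c. finite A \<and> A \<subseteq> S \<and> v = (\<lambda>xs. \<Sum>a\<in>A. c a * a xs)}"

definition ptensor :: "'k::field tensor list \<Rightarrow> 'k tensor" where
  "ptensor vs = (\<lambda>xs. if length xs = length vs then (\<Prod>i<length vs. (vs ! i) [xs ! i]) else 0)"

definition tpow :: "(nat \<Rightarrow> 'k::field tensor set) \<Rightarrow> nat \<Rightarrow> nat \<Rightarrow> 'k tensor set" where
  "tpow F n m = fspan {ptensor vs | vs. length vs = n \<and> set vs \<subseteq> F m}"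

definition PFA :: "nat \<Rightarrow> 'k::field tensor set" where
  "PFA m = tens 1 m"

definition Pbar :: "nat \<Rightarrow> 'k::field tensor set" where
  "Pbar m = {v \<in> tens 1 m. (\<Sum>x<m. v [x]) = 0}"

text \<open>Tensor powers of Pbar, with the convention Pbar^{(x)0} = kbar.\<close>
definition Pbar_pow :: "nat \<Rightarrow> nat \<Rightarrow> 'k::field tensor set" where
  "Pbar_pow n m = (if n = 0 then (if m = 0 then {\<lambda>_. 0} else tens 0 m) else tpow Pbar n m)"

text \<open>Place-permutation right action: (v.sigma)(ys) = v(ys o sigma^-1),
  i.e. the basis tensor for xs is sent to the one for xs o sigma.\<close>
definition rperm :: "'k::field tensor \<Rightarrow> (nat \<Rightarrow> nat) \<Rightarrow> 'k tensor" where
  "rperm v \<sigma> = (\<lambda>ys. v (permute_list (inv \<sigma>) ys))"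

text \<open>Canonical Young tableau of shape lam: boxes numbered 0..n-1 row by row.\<close>
definition rowof :: "nat list \<Rightarrow> nat \<Rightarrow> nat" where
  "rowof lam i = card {r. r < length lam \<and> sum_list (take (Suc r) lam) \<le> i}"

definition colof :: "nat list \<Rightarrow> nat \<Rightarrow> nat" where
  "colof lam i = i - sum_list (take (rowof lam i) lam)"

definition row_group :: "nat list \<Rightarrow> (nat \<Rightarrow> nat) set" where
  "row_group lam = {\<sigma>. \<sigma> permutes {..<sum_list lam} \<and> (\<forall>i<sum_list lam. rowof lam (\<sigma> i) = rowof lam i)}"

definition col_group :: "nat list \<Rightarrow> (nat \<Rightarrow> nat) set" where
  "col_group lam = {\<sigma>. \<sigma> permutes {..<sum_list lam} \<and> (\<forall>i<sum_list lam. colof lam (\<sigma> i) = colof lam i)}"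

definition young_sym :: "nat list \<Rightarrow> 'k::field tensor \<Rightarrow> 'k tensor" where
  "young_sym lam v =
     (let w = (\<lambda>ys. \<Sum>\<sigma>\<in>row_group lam. rperm v \<sigma> ys)
      in (\<lambda>ys. \<Sum>\<tau>\<in>col_group lam. of_int (sign \<tau>) * rperm w \<tau> ys))"

text \<open>S_lam(F) = F^{(x)n} (x)_{S_n} S_lam, realised (char 0) as F^{(x)n} . c_lam,
  where T n m is the value of F^{(x)n} on {0..<m}.\<close>
definition schur :: "nat list \<Rightarrow> (nat \<Rightarrow> nat \<Rightarrow> 'k::field tensor set) \<Rightarrow> 'k tensor famod" where
  "schur lam T = tmod (\<lambda>m. young_sym lam ` T (sum_list lam) m)"

definition S_P :: "nat list \<Rightarrow> 'k::field tensor famod" where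
  "S_P lam = schur lam (tpow PFA)"

definition S_Pbar :: "nat list \<Rightarrow> 'k::field tensor famod" where
  "S_Pbar nu = schur nu Pbar_pow"

definition Lambda_P :: "nat \<Rightarrow> 'k::field tensor famod" where
  "Lambda_P k = schur (replicate k 1) (tpow PFA)"

end

theory Submission
  imports Defs "HOL-Library.Function_Algebras" "HOL.Vector_Spaces"
begin

text \<open>
  Write \<open>P = V \<oplus> k[M]\<close> for a chosen letter \<open>M\<close>, where \<open>V\<close> is the reduced functor. Forgetting the boxes of
  \<open>\<lambda>/\<nu>\<close> gives natural maps \<open>S\<^sub>\<lambda>(P) \<rightarrow> P\<^sup>\<otimes>\<^sup>k\<close>. For a partition \<open>\<nu>\<close> that is not a column, composing with
  \<open>[x] \<mapsto> ([x\<^sub>0] - [x\<^sub>1]) \<otimes> ([x\<^sub>1] - [x\<^sub>0]) \<otimes> ([x\<^sub>2] - [x\<^sub>0]) \<otimes> \<dots>\<close>, which acts on \<open>V\<^sup>\<otimes>\<^sup>k\<close> as \<open>1 + (0 1)\<close>,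
  and with a suitable element of the group algebra gives a natural map \<open>S\<^sub>\<lambda>(P) \<rightarrow> S\<^sub>\<nu>(V)\<close>. With respect to the tensors
  that carry \<open>M\<close> exactly on \<open>\<lambda>/\<nu>\<close>, these maps are triangular for the dominance order, with nonzero diagonal.
  This gives surjectivity. Injectivity is the spanning statement that \<open>S\<^sub>\<lambda>\<close> is presented by the Garnir relations, which is
  proved by induction on the number of letters with the same triangularity. Columns \<open>\<nu>\<close> occur only
  when \<open>\<lambda>\<close> is a hook; then the two column components are replaced by the single natural map to an exterior power of \<open>P\<close>
  that forgets all boxes outside the first column.
\<close>

section \<open>Boxes and horizontal strips\<close>

text \<open>By the Yoneda lemma, natural maps from P to V are elements of V at a one-element set,
  and these are 0; so the splitting of P by a letter M is never natural. A base point to subtract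
  must come from the word itself. Slots 0 and 1 serve as base points of each other, and slot 0
  serves all other slots. The surviving 1 + (0 1) is 2 on tensors symmetric in these two slots but 0
  on alternating ones, so exactly the columns are out of reach. No other operator could help: the
  j-th exterior power of V vanishes at a set of j elements, so again by Yoneda the j-th exterior
  power of P has no nonzero natural map to it. Interlacing of \<nu> with \<lambda> shows that a
  column \<nu> forces a hook, and then two columns of consecutive lengths occur together, as the two
  layers of one exterior power of P. The letter M is the largest element of a non-empty set and
  serves only to verify, set by set, that natural maps are bijective; the empty set is treated
  apart.\<close>

definition psum :: "nat list \<Rightarrow> nat \<Rightarrow> nat" where
  "psum lam r = sum_list (take r lam)"

definition box :: "nat list \<Rightarrow> nat \<Rightarrow> nat \<Rightarrow> nat" where
  "box lam r c = psum lam r + c"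

lemma psum_Suc: "r < length lam \<Longrightarrow> psum lam (Suc r) = psum lam r + lam ! r"
  by (simp add: psum_def take_Suc_conv_app_nth)

lemma psum_mono: "r \<le> s \<Longrightarrow> psum lam r \<le> psum lam s"
  unfolding psum_def
proof (induction s)
  case (Suc s)
  have "sum_list (take s lam) \<le> sum_list (take (Suc s) lam)"
    by (cases "s < length lam") (simp_all add: take_Suc_conv_app_nth)
  with Suc show ?case by (cases "r = Suc s") auto
qed simp

lemma box_less: "r < length lam \<Longrightarrow> c < lam ! r \<Longrightarrow> box lam r c < sum_list lam"
proof -
  assume a: "r < length lam" "c < lam ! r"
  then have "box lam r c < psum lam (Suc r)" by (simp add: box_def psum_Suc)
  also have "\<dots> \<le> psum lam (length lam)" using a by (intro psum_mono) auto
  finally show ?thesis by (simp add: psum_def)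
qed

lemma rowof_box:
  assumes "r < length lam" "c < lam ! r"
  shows "rowof lam (box lam r c) = r"
proof -
  have "{s. s < length lam \<and> sum_list (take (Suc s) lam) \<le> box lam r c} = {..<r}"
  proof (intro set_eqI iffI)
    fix s assume s: "s \<in> {s. s < length lam \<and> sum_list (take (Suc s) lam) \<le> box lam r c}"
    show "s \<in> {..<r}"
    proof (rule ccontr)
      assume "s \<notin> {..<r}"
      then have "psum lam (Suc r) \<le> psum lam (Suc s)" by (intro psum_mono) auto
      with s assms show False by (auto simp: box_def psum_Suc psum_def[symmetric])
    qed
  next
    fix s assume "s \<in> {..<r}"
    then have "psum lam (Suc s) \<le> psum lam r" by (intro psum_mono) auto
    then show "s \<in> {s. s < length lam \<and> sum_list (take (Suc s) lam) \<le> box lam r c}"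
      using \<open>s \<in> {..<r}\<close> assms by (auto simp: box_def psum_def)
  qed
  then show ?thesis by (simp add: rowof_def)
qed

lemma colof_box: "r < length lam \<Longrightarrow> c < lam ! r \<Longrightarrow> colof lam (box lam r c) = c"
  using rowof_box[of r lam c] by (simp add: colof_def box_def psum_def)

lemma box_cases:
  assumes "i < sum_list lam"
  obtains r c where "r < length lam" "c < lam ! r" "i = box lam r c"
proof -
  define r where "r = (LEAST r. i < psum lam (Suc r))"
  have ex: "i < psum lam (Suc (length lam))" using assms by (simp add: psum_def)
  have r: "i < psum lam (Suc r)" unfolding r_def by (rule LeastI[of _ "length lam"]) (rule ex)
  have rl: "r < length lam"
  proof (rule ccontr)
    assume n: "\<not> r < length lam"
    have "i < psum lam (Suc (length lam - 1))" using assms by (cases lam) (auto simp: psum_def)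
    then have "r \<le> length lam - 1" unfolding r_def by (rule Least_le)
    with n have "length lam = 0" by linarith
    with assms show False by simp
  qed
  have "psum lam r \<le> i"
  proof (cases r)
    case (Suc s)
    then have "\<not> i < psum lam (Suc s)" using not_less_Least[of s "\<lambda>r. i < psum lam (Suc r)"]
      by (simp add: r_def)
    then show ?thesis using Suc by simp
  qed (simp add: psum_def)
  then show ?thesis using r rl
    by (intro that[of r "i - psum lam r"]) (auto simp: psum_Suc box_def)
qed

lemma rowof_less: "i < sum_list lam \<Longrightarrow> rowof lam i < length lam"
  by (erule box_cases) (simp add: rowof_box)

lemma colof_less: "i < sum_list lam \<Longrightarrow> colof lam i < lam ! rowof lam i"
  by (erule box_cases) (simp add: rowof_box colof_box)

lemma box_rowof_colof: "i < sum_list lam \<Longrightarrow> box lam (rowof lam i) (colof lam i) = i"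
  by (erule box_cases) (simp add: rowof_box colof_box)

lemma row_col_eq:
  "\<lbrakk>i < sum_list lam; j < sum_list lam; rowof lam i = rowof lam j; colof lam i = colof lam j\<rbrakk> \<Longrightarrow> i = j"
  by (metis box_rowof_colof)

lemma card_row:
  "card {j. j < sum_list lam \<and> rowof lam j = r \<and> a \<le> colof lam j} = part_at lam r - a"
proof (cases "r < length lam")
  case True
  have "bij_betw (box lam r) {a..<lam ! r} {j. j < sum_list lam \<and> rowof lam j = r \<and> a \<le> colof lam j}"
    unfolding bij_betw_def
  proof (intro conjI set_eqI iffI)
    show "inj_on (box lam r) {a..<lam ! r}" by (auto simp: inj_on_def box_def)
  qed (use True in \<open>auto simp: rowof_box colof_box box_less intro!: image_eqI box_rowof_colof[symmetric] dest: colof_less\<close>)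
  then show ?thesis using True bij_betw_same_card by (fastforce simp: part_at_def)
next
  case False
  then have "{j. j < sum_list lam \<and> rowof lam j = r \<and> a \<le> colof lam j} = {}"
    using rowof_less by fastforce
  then show ?thesis using False by (simp only: part_at_def card.empty) simp
qed

lemma partition_antimono: "is_partition lam n \<Longrightarrow> r \<le> s \<Longrightarrow> part_at lam s \<le> part_at lam r"
proof -
  assume p: "is_partition lam n" and rs: "r \<le> s"
  have "lam ! s \<le> lam ! r" if "s < length lam"
    using p that rs by (cases "r = s") (auto simp: is_partition_def sorted_wrt_iff_nth_less)
  then show ?thesis using rs by (auto simp: part_at_def)
qed

lemma partition_eqI:
  assumes "is_partition lam n" "is_partition mu k" "\<And>r. part_at lam r = part_at mu r"
  shows "lam = mu"
proof (rule nth_equalityI)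
  \<comment> \<open>Parts are positive, so the length is the first index at which
    \<open>part_at\<close> vanishes.\<close>
  have *: "length x = (LEAST r. part_at x r = 0)" if "is_partition x m" for x m
    by (rule Least_equality[symmetric])
      (use that in \<open>auto simp: part_at_def is_partition_def not_less[symmetric] Ball_def in_set_conv_nth split: if_splits\<close>)
  show l: "length lam = length mu" using *[OF assms(1)] *[OF assms(2)] assms(3) by simp
  fix i assume "i < length lam"
  then show "lam ! i = mu ! i" using assms(3)[of i] l by (simp add: part_at_def)
qed

definition hstrips :: "nat list \<Rightarrow> nat list set" where
  "hstrips lam = {nu. is_partition nu (sum_list nu) \<and> part_le nu lam \<and> horizontal_strip lam nu}"

lemma mem_young: "(i, j) \<in> young_diagram lam \<longleftrightarrow> j < part_at lam i"
  by (auto simp: young_diagram_def part_at_def)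

text \<open>The rows decrease, so two strip boxes in one column force two in consecutive rows, and
  column \<open>part_at nu r\<close> is the first where rows \<open>r\<close> and
  \<open>Suc r\<close> can both stick out. This interlacing form is the one used below.\<close>

lemma hstrips_iff:
  assumes "is_partition lam n"
  shows "nu \<in> hstrips lam \<longleftrightarrow> is_partition nu (sum_list nu) \<and>
    (\<forall>r. part_at lam (Suc r) \<le> part_at nu r \<and> part_at nu r \<le> part_at lam r)" (is "_ \<longleftrightarrow> ?R")
proof
  assume nu: "nu \<in> hstrips lam"
  then have p: "is_partition nu (sum_list nu)" "part_le nu lam" "horizontal_strip lam nu"
    by (auto simp: hstrips_def)
  have "part_at lam (Suc r) \<le> part_at nu r" for r
  proof (rule ccontr)
    assume n: "\<not> ?thesis"
    let ?S = "{i. (i, part_at nu r) \<in> young_diagram lam - young_diagram nu}"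
    have "{r, Suc r} \<subseteq> ?S"
      using n partition_antimono[OF assms, of r "Suc r"] partition_antimono[OF p(1), of r "Suc r"]
      by (auto simp: mem_young)
    moreover have "finite ?S"
      by (rule finite_subset[of _ "{..<length lam}"]) (auto simp: young_diagram_def)
    ultimately have "card {r, Suc r} \<le> card ?S" by (intro card_mono)
    moreover have "card ?S \<le> 1" using p(3) by (simp add: horizontal_strip_def)
    ultimately show False by simp
  qed
  then show ?R using p by (auto simp: part_le_def)
next
  assume R: ?R
  have "card {i. (i, j) \<in> young_diagram lam - young_diagram nu} \<le> 1" for j
  proof -
    have *: "i = i'" if "i \<le> i'" "(i, j) \<in> young_diagram lam - young_diagram nu"
      "(i', j) \<in> young_diagram lam - young_diagram nu" for i i'
    proof (rule ccontr)
      assume "i \<noteq> i'"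
      then have "part_at lam i' \<le> part_at lam (Suc i)"
        using that by (intro partition_antimono[OF assms]) auto
      moreover have "part_at lam (Suc i) \<le> part_at nu i" using R by auto
      ultimately show False using that by (auto simp: mem_young)
    qed
    then have eq: "i = i'" if "(i, j) \<in> young_diagram lam - young_diagram nu"
      "(i', j) \<in> young_diagram lam - young_diagram nu" for i i'
      using that *[of i i'] *[of i' i] by linarith
    have fin: "finite {i. (i, j) \<in> young_diagram lam - young_diagram nu}"
      by (rule finite_subset[of _ "{..<length lam}"]) (auto simp: young_diagram_def)
    show ?thesis
      unfolding One_nat_def card_le_Suc0_iff_eq[OF fin] using eq by (intro ballI) simp
  qed
  then show "nu \<in> hstrips lam" using R by (auto simp: hstrips_def part_le_def horizontal_strip_def)
qed

lemma part_le_length: "is_partition nu k \<Longrightarrow> \<forall>r. part_at nu r \<le> part_at lam r \<Longrightarrow> length nu \<le> length lam"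
proof (rule ccontr)
  assume a: "is_partition nu k" "\<forall>r. part_at nu r \<le> part_at lam r" "\<not> length nu \<le> length lam"
  then have "part_at nu (length lam) = 0" by (metis le_zero_eq part_at_def less_irrefl)
  moreover have "nu ! length lam \<in> set nu" using a by simp
  ultimately show False using a by (auto simp: part_at_def is_partition_def)
qed

lemma sum_list_part_at: "length nu \<le> l \<Longrightarrow> sum_list nu = (\<Sum>r<l. part_at nu r)"
proof -
  assume "length nu \<le> l"
  then have "(\<Sum>r<l. part_at nu r) = (\<Sum>r<length nu. part_at nu r)"
    by (intro sum.mono_neutral_right) (auto simp: part_at_def)
  then show ?thesis by (simp add: part_at_def sum_list_sum_nth atLeast0LessThan)
qed

lemma finite_hstrips: "is_partition lam n \<Longrightarrow> finite (hstrips lam)"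
proof (rule finite_subset)
  assume p: "is_partition lam n"
  show "hstrips lam \<subseteq> {xs. set xs \<subseteq> {..part_at lam 0} \<and> length xs \<le> length lam}"
  proof
    fix nu assume nu: "nu \<in> hstrips lam"
    then have le: "\<forall>r. part_at nu r \<le> part_at lam r" and q: "is_partition nu (sum_list nu)"
      unfolding hstrips_iff[OF p] by simp_all
    have "x \<le> part_at lam 0" if x: "x \<in> set nu" for x
    proof -
      obtain i where "i < length nu" "x = nu ! i" using x by (auto simp: in_set_conv_nth)
      then have "x = part_at nu i" by (simp add: part_at_def)
      then show ?thesis using le[rule_format, of i] partition_antimono[OF p, of 0 i] by simp
    qed
    then show "nu \<in> {xs. set xs \<subseteq> {..part_at lam 0} \<and> length xs \<le> length lam}"
      using part_le_length[OF q le] by simp blast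
  qed
qed (simp add: finite_lists_length_le)

section \<open>Row tabloids and Garnir relations\<close>

text \<open>A word modulo permutations inside the rows. With multisets of pairs (row, letter),
  filling disjoint sets of boxes becomes addition; this is how strips and Garnir relations are glued
  on later.\<close>

definition tab :: "nat list \<Rightarrow> 'a list \<Rightarrow> (nat \<times> 'a) multiset" where
  "tab lam w = image_mset (\<lambda>j. (rowof lam j, w ! j)) (mset_set {..<sum_list lam})"

definition tabloid :: "nat list \<Rightarrow> (nat \<times> 'a) multiset \<Rightarrow> bool" where
  "tabloid lam T \<longleftrightarrow> (\<forall>r. size (filter_mset (\<lambda>x. fst x = r) T) = part_at lam r)"

definition delta :: "nat list \<Rightarrow> 'k::field tensor" where
  "delta w = (\<lambda>ys. of_bool (ys = w))"

text \<open>The coefficient of the word \<open>z\<close> in the image of the word \<open>w\<close> under the Young symmetrizer.\<close>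

definition kern :: "nat list \<Rightarrow> nat list \<Rightarrow> nat list \<Rightarrow> 'k::field" where
  "kern lam w z = (\<Sum>\<tau>\<in>col_group lam. \<Sum>\<rho>\<in>row_group lam.
     of_int (sign \<tau>) * of_bool (permute_list \<tau> (permute_list \<rho> w) = z))"

section \<open>Row and column groups\<close>

lemma finite_row_group [simp]: "finite (row_group lam)"
  unfolding row_group_def by (rule finite_subset[OF _ finite_permutations[of "{..<sum_list lam}"]]) auto

lemma finite_col_group [simp]: "finite (col_group lam)"
  unfolding col_group_def by (rule finite_subset[OF _ finite_permutations[of "{..<sum_list lam}"]]) auto

lemma row_group_permutes: "\<sigma> \<in> row_group lam \<Longrightarrow> \<sigma> permutes {..<sum_list lam}"
  by (simp add: row_group_def)

lemma col_group_permutes: "\<sigma> \<in> col_group lam \<Longrightarrow> \<sigma> permutes {..<sum_list lam}"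
  by (simp add: col_group_def)

lemma row_groupD: "\<sigma> \<in> row_group lam \<Longrightarrow> i < sum_list lam \<Longrightarrow> rowof lam (\<sigma> i) = rowof lam i"
  by (simp add: row_group_def)

lemma col_groupD: "\<sigma> \<in> col_group lam \<Longrightarrow> i < sum_list lam \<Longrightarrow> colof lam (\<sigma> i) = colof lam i"
  by (simp add: col_group_def)

lemma id_row_group [simp]: "id \<in> row_group lam"
  by (simp add: row_group_def permutes_id)

lemma id_col_group [simp]: "id \<in> col_group lam"
  by (simp add: col_group_def permutes_id)

lemma permutes_lt: "\<sigma> permutes {..<n::nat} \<Longrightarrow> i < n \<Longrightarrow> \<sigma> i < n"
  using permutes_in_image by fastforce

lemma row_group_comp: "\<sigma> \<in> row_group lam \<Longrightarrow> \<tau> \<in> row_group lam \<Longrightarrow> \<sigma> \<circ> \<tau> \<in> row_group lam"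
  by (auto simp: row_group_def permutes_lt intro: permutes_compose)

lemma col_group_comp: "\<sigma> \<in> col_group lam \<Longrightarrow> \<tau> \<in> col_group lam \<Longrightarrow> \<sigma> \<circ> \<tau> \<in> col_group lam"
  by (auto simp: col_group_def permutes_lt intro: permutes_compose)

lemma row_group_inv:
  assumes "\<sigma> \<in> row_group lam"
  shows "inv \<sigma> \<in> row_group lam"
proof -
  note p = row_group_permutes[OF assms]
  have "rowof lam (inv \<sigma> i) = rowof lam i" if "i < sum_list lam" for i
    using row_groupD[OF assms permutes_lt[OF permutes_inv[OF p] that]] permutes_inverses(1)[OF p] by simp
  then show ?thesis using permutes_inv[OF p] by (simp add: row_group_def)
qed

lemma col_group_inv:
  assumes "\<sigma> \<in> col_group lam"
  shows "inv \<sigma> \<in> col_group lam"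
proof -
  note p = col_group_permutes[OF assms]
  have "colof lam (inv \<sigma> i) = colof lam i" if "i < sum_list lam" for i
    using col_groupD[OF assms permutes_lt[OF permutes_inv[OF p] that]] permutes_inverses(1)[OF p] by simp
  then show ?thesis using permutes_inv[OF p] by (simp add: col_group_def)
qed

lemma bij_betw_comp_left:
  assumes "\<sigma> \<in> G" "inv \<sigma> \<in> G" "bij \<sigma>" "\<And>\<tau> \<tau>'. \<tau> \<in> G \<Longrightarrow> \<tau>' \<in> G \<Longrightarrow> \<tau> \<circ> \<tau>' \<in> G"
  shows "bij_betw ((\<circ>) \<sigma>) G G"
  by (rule bij_betw_byWitness[of _ "(\<circ>) (inv \<sigma>)"])
    (use assms in \<open>auto simp: bij_is_inj bij_is_surj fun_eq_iff surj_f_inv_f\<close>)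

lemma permute_list_eq_iff:
  assumes "\<sigma> permutes {..<length w}"
  shows "permute_list (inv \<sigma>) w = v \<longleftrightarrow> w = permute_list \<sigma> v \<and> length v = length w"
proof
  assume "permute_list (inv \<sigma>) w = v"
  then show "w = permute_list \<sigma> v \<and> length v = length w"
    using assms permute_list_compose[of \<sigma> w "inv \<sigma>"] by (auto simp: permutes_inv_o)
next
  assume w: "w = permute_list \<sigma> v \<and> length v = length w"
  then have "permute_list (inv \<sigma>) w = permute_list (inv \<sigma>) (permute_list \<sigma> v)" by simp
  also have "\<dots> = permute_list (\<sigma> \<circ> inv \<sigma>) v"
    by (rule permute_list_compose[symmetric]) (metis w assms permutes_inv)
  finally show "permute_list (inv \<sigma>) w = v" using permutes_inv_o(1)[OF assms] by simp
qed

section \<open>Tabloids as orbits of the row group\<close>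

lemma tabloid_tab: "tabloid lam (tab lam w)"
proof -
  have "size (filter_mset (\<lambda>x. fst x = r) (tab lam w)) = part_at lam r" for r
    using card_row[of lam r 0]
    by (simp add: tab_def filter_mset_image_mset)
  then show ?thesis by (simp add: tabloid_def)
qed

lemma set_tab: "length w = sum_list lam \<Longrightarrow> snd ` set_mset (tab lam w) = set w"
  by (auto simp: tab_def set_conv_nth image_iff)

lemma count_image_fst: "count (image_mset fst S) r = size (filter_mset (\<lambda>x. fst x = r) S)"
  by (induction S) auto

lemma mset_map_fst_eqI:
  assumes "\<And>r. size (filter_mset (\<lambda>x. fst x = r) T) = size (filter_mset (\<lambda>x. fst x = r) T')"
  shows "image_mset fst T = image_mset fst T'"
  using assms by (intro multiset_eqI) (simp add: count_image_fst)

text \<open>The rows of \<open>T\<close> have the right sizes, so the list of its row labels is a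
  rearrangement of the row numbers of the boxes; rearranging the letters in the same way gives the
  word.\<close>

lemma tab_surj:
  fixes T :: "(nat \<times> 'a) multiset"
  assumes "tabloid lam T"
  obtains w where "length w = sum_list lam" "tab lam w = T"
proof -
  let ?n = "sum_list lam"
  obtain xs where xs: "mset xs = T" using ex_mset by blast
  let ?t = "tab lam (replicate ?n (undefined :: 'a))"
  have "image_mset fst T = image_mset fst ?t"
    using assms tabloid_tab[of lam "replicate ?n (undefined :: 'a)"]
    by (intro mset_map_fst_eqI) (simp add: tabloid_def)
  then have "mset (map fst xs) = mset (map (rowof lam) [0..<?n])"
    using xs by (simp add: tab_def image_mset.compositionality o_def mset_upt atLeast0LessThan)
  then obtain p where p: "p permutes {..<length (map fst xs)}"
    "permute_list p (map fst xs) = map (rowof lam) [0..<?n]"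
    using mset_eq_permutation[of "map (rowof lam) [0..<?n]" "map fst xs"] by metis
  define w where "w = map snd (permute_list p xs)"
  have len: "length xs = ?n" using p(2) by (metis length_map length_permute_list length_upt minus_nat.diff_0)
  then have lw: "length w = ?n" by (simp add: w_def)
  have fst: "fst (permute_list p xs ! j) = rowof lam j" if "j < ?n" for j
  proof -
    have "map fst (permute_list p xs) = map (rowof lam) [0..<?n]"
      using p by (simp add: permute_list_map)
    from arg_cong[OF this, of "\<lambda>l. l ! j"] show ?thesis using that len by simp
  qed
  have "tab lam w = mset (permute_list p xs)"
    unfolding tab_def
    by (subst (2) map_nth[symmetric], subst mset_map)
      (auto simp: len w_def fst mset_upt atLeast0LessThan prod_eq_iff intro!: image_mset_cong)
  also have "\<dots> = T" using p(1) xs by simp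
  finally show ?thesis using lw that by blast
qed

text \<open>A permutation that matches the two lists of pairs (row, letter) preserves the first
  coordinates, hence lies in the row group.\<close>

lemma tab_eq_imp_row_group:
  assumes "tab lam w = tab lam w'" "length w = sum_list lam" "length w' = sum_list lam"
  obtains \<rho> where "\<rho> \<in> row_group lam" "w' = permute_list \<rho> w"
proof -
  let ?n = "sum_list lam"
  let ?z = "\<lambda>w. map (\<lambda>j. (rowof lam j, w ! j)) [0..<?n]"
  have "mset (?z w') = mset (?z w)" using assms(1)
    by (simp add: tab_def mset_upt atLeast0LessThan)
  then obtain p where p: "p permutes {..<length (?z w)}" "permute_list p (?z w) = ?z w'"
    by (rule mset_eq_permutation)
  have p1: "p permutes {..<?n}" using p(1) by simp
  have nth: "rowof lam (p j) = rowof lam j \<and> w ! p j = w' ! j" if "j < ?n" for j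
    using arg_cong[OF p(2), of "\<lambda>l. l ! j"] that permutes_lt[OF p1 that] p(1)
    by (simp add: permute_list_nth)
  have "p \<in> row_group lam" using p1 nth by (simp add: row_group_def)
  moreover have "w' = permute_list p w"
    using nth assms p1 by (intro nth_equalityI) (auto simp: permute_list_nth)
  ultimately show ?thesis using that by blast
qed

text \<open>The row symmetrizer acts first, so translation by \<open>\<rho>0\<close> only permutes
  its terms.\<close>

lemma kern_row_invariant:
  assumes "tab lam w = tab lam w'" "length w = sum_list lam" "length w' = sum_list lam"
  shows "kern lam w z = kern lam w' z"
proof -
  obtain \<rho>0 where \<rho>0: "\<rho>0 \<in> row_group lam" "w' = permute_list \<rho>0 w"
    using tab_eq_imp_row_group[OF assms] .
  have *: "(\<Sum>\<rho>\<in>row_group lam. of_int (sign \<tau>) * of_bool (permute_list \<tau> (permute_list \<rho> w') = z))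
      = (\<Sum>\<rho>\<in>row_group lam. of_int (sign \<tau>) * (of_bool (permute_list \<tau> (permute_list \<rho> w) = z) :: 'a))" for \<tau>
  proof (rule sum.reindex_bij_betw[THEN trans[rotated], of "(\<circ>) \<rho>0" "row_group lam" "row_group lam"])
    show "bij_betw ((\<circ>) \<rho>0) (row_group lam) (row_group lam)"
      using \<rho>0 row_group_inv row_group_comp permutes_bij[OF row_group_permutes] by (intro bij_betw_comp_left) auto
  qed (use assms \<rho>0 row_group_permutes in \<open>auto intro!: sum.cong simp: permute_list_compose\<close>)
  show ?thesis unfolding kern_def by (rule sum.cong[OF refl *[symmetric]])
qed

lemma inj_comp_transpose: "inj f \<Longrightarrow> f \<circ> transpose a b = transpose (f a) (f b) \<circ> f"
  by (auto simp: fun_eq_iff transpose_def inj_eq)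

text \<open>Every row permutation moves \<open>X\<close> to more boxes than row \<open>i\<close> has, so two of them share a column, and the
  transposition of these two makes the column antisymmetrizer vanish.\<close>

lemma kern_garnir_perm:
  fixes z :: "nat list"
  assumes lam: "is_partition lam n" and w: "length w = sum_list lam"
    and X: "X \<subseteq> {..<sum_list lam}" "\<And>x. x \<in> X \<Longrightarrow> rowof lam x = i \<or> rowof lam x = Suc i"
    and card: "part_at lam i < card X"
  shows "(\<Sum>\<pi> | \<pi> permutes X. kern lam (permute_list \<pi> w) z :: 'k::field_char_0) = 0"
proof -
  have finX: "finite X" using X(1) finite_subset by blast
  \<comment> \<open>\<open>A \<sigma>\<close> is the sum over \<open>\<pi>\<close> once the product
    \<open>\<sigma>\<close> of a row and a column permutation is fixed. It suffices that its signed
    sum over the column group vanishes for each \<open>\<rho>\<close>.\<close>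
  define A :: "(nat \<Rightarrow> nat) \<Rightarrow> 'k" where
    "A \<sigma> = (\<Sum>\<pi> | \<pi> permutes X. of_bool (permute_list (\<pi> \<circ> \<sigma>) w = z))" for \<sigma>
  have sgn: "(\<Sum>\<tau>\<in>col_group lam. of_int (sign \<tau>) * A (\<rho> \<circ> \<tau>)) = 0" if \<rho>: "\<rho> \<in> row_group lam" for \<rho>
  proof -
    note rp = row_group_permutes[OF \<rho>]
    let ?Y = "\<rho> -` X"
    have Y: "?Y \<subseteq> {..<sum_list lam}" using X(1) permutes_in_image[OF rp] by auto
    have cY: "card ?Y = card X" using rp by (simp add: card_vimage_inj permutes_inj permutes_surj)
    have "colof lam ` ?Y \<subseteq> {..<part_at lam i}"
    proof
      fix c assume "c \<in> colof lam ` ?Y"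
      then obtain y where y: "\<rho> y \<in> X" "c = colof lam y" by auto
      have yn: "y < sum_list lam" using y Y by auto
      have "rowof lam y = i \<or> rowof lam y = Suc i" using X(2)[OF y(1)] row_groupD[OF \<rho> yn] by simp
      moreover have "c < part_at lam (rowof lam y)"
        using colof_less[OF yn] rowof_less[OF yn] y by (simp add: part_at_def)
      ultimately show "c \<in> {..<part_at lam i}"
        using partition_antimono[OF lam, of i "Suc i"] by auto
    qed
    then have "card (colof lam ` ?Y) \<le> part_at lam i" by (metis card_lessThan card_mono finite_lessThan)
    then have "\<not> inj_on (colof lam) ?Y" using card cY card_image by fastforce
    then obtain x y where xy: "\<rho> x \<in> X" "\<rho> y \<in> X" "colof lam x = colof lam y" "x \<noteq> y"
      by (auto simp: inj_on_def)
    have xyn: "x < sum_list lam" "y < sum_list lam" using xy Y by auto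
    let ?t = "transpose x y"
    have t: "?t \<in> col_group lam" using xyn xy by (auto simp: col_group_def permutes_swap_id transpose_def)
    \<comment> \<open>Moved past \<open>\<rho>\<close>, the transposition exchanges two elements of
      \<open>X\<close> and is absorbed by the sum over the permutations of \<open>X\<close>. Only
      the sign changes, so the signed sum equals its own negative.\<close>
    have At: "A (\<rho> \<circ> (?t \<circ> \<tau>)) = A (\<rho> \<circ> \<tau>)" for \<tau>
    proof -
      let ?t' = "transpose (\<rho> x) (\<rho> y)"
      have t': "?t' permutes X" using xy by (simp add: permutes_swap_id)
      have "bij_betw (\<lambda>\<pi>. \<pi> \<circ> ?t') {\<pi>. \<pi> permutes X} {\<pi>. \<pi> permutes X}"
        by (rule bij_betw_byWitness[of _ "\<lambda>\<pi>. \<pi> \<circ> ?t'"])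
          (auto simp: comp_assoc intro: permutes_compose[OF t'])
      then have "A (\<rho> \<circ> \<tau>) = (\<Sum>\<pi> | \<pi> permutes X. of_bool (permute_list (\<pi> \<circ> ?t' \<circ> (\<rho> \<circ> \<tau>)) w = z))"
        unfolding A_def by (rule sum.reindex_bij_betw[symmetric])
      also have "\<dots> = A (\<rho> \<circ> (?t \<circ> \<tau>))"
        unfolding A_def using inj_comp_transpose[OF permutes_inj[OF rp], of x y]
        by (metis (no_types, lifting) comp_assoc)
      finally show ?thesis by simp
    qed
    have "bij_betw ((\<circ>) ?t) (col_group lam) (col_group lam)"
      using t col_group_comp by (intro bij_betw_comp_left) auto
    then have "(\<Sum>\<tau>\<in>col_group lam. of_int (sign \<tau>) * A (\<rho> \<circ> \<tau>))
        = (\<Sum>\<tau>\<in>col_group lam. of_int (sign (?t \<circ> \<tau>)) * A (\<rho> \<circ> (?t \<circ> \<tau>)))"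
      by (rule sum.reindex_bij_betw[symmetric])
    also have "\<dots> = (\<Sum>\<tau>\<in>col_group lam. - (of_int (sign \<tau>) * A (\<rho> \<circ> \<tau>)))"
    proof (rule sum.cong[OF refl])
      fix \<tau> assume "\<tau> \<in> col_group lam"
      then have "permutation \<tau>" using col_group_permutes permutes_imp_permutation by blast
      then have "sign (?t \<circ> \<tau>) = - sign \<tau>"
        using xy(4) by (simp add: sign_compose permutation_swap_id sign_swap_id)
      then show "of_int (sign (?t \<circ> \<tau>)) * A (\<rho> \<circ> (?t \<circ> \<tau>)) = - (of_int (sign \<tau>) * A (\<rho> \<circ> \<tau>))"
        by (simp add: At)
    qed
    finally show ?thesis by (simp add: sum_negf)
  qed
  have "(\<Sum>\<pi> | \<pi> permutes X. kern lam (permute_list \<pi> w) z :: 'k)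
      = (\<Sum>\<pi> | \<pi> permutes X. \<Sum>\<rho>\<in>row_group lam. \<Sum>\<tau>\<in>col_group lam.
          of_int (sign \<tau>) * of_bool (permute_list (\<pi> \<circ> (\<rho> \<circ> \<tau>)) w = z))"
  proof (rule sum.cong[OF refl])
    fix \<pi> assume "\<pi> \<in> {\<pi>. \<pi> permutes X}"
    then have \<pi>: "\<pi> permutes {..<sum_list lam}" using X(1) permutes_subset by blast
    have "permute_list \<tau> (permute_list \<rho> (permute_list \<pi> w)) = permute_list (\<pi> \<circ> (\<rho> \<circ> \<tau>)) w"
      if "\<rho> \<in> row_group lam" "\<tau> \<in> col_group lam" for \<rho> \<tau>
      using that \<pi> w row_group_permutes col_group_permutes
      by (simp add: permute_list_compose permutes_compose)
    then show "(kern lam (permute_list \<pi> w) z :: 'k) = (\<Sum>\<rho>\<in>row_group lam. \<Sum>\<tau>\<in>col_group lam.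
          of_int (sign \<tau>) * of_bool (permute_list (\<pi> \<circ> (\<rho> \<circ> \<tau>)) w = z))"
      unfolding kern_def by (subst sum.swap) (auto intro!: sum.cong)
  qed
  also have "\<dots> = (\<Sum>\<rho>\<in>row_group lam. \<Sum>\<tau>\<in>col_group lam. of_int (sign \<tau>) * A (\<rho> \<circ> \<tau>))"
    unfolding A_def sum_distrib_left
    by (subst sum.swap, rule sum.cong[OF refl], subst sum.swap) simp
  also have "\<dots> = 0" using sgn by simp
  finally show ?thesis .
qed

lemma ex_permutes_image:
  assumes "finite X" "A \<subseteq> X" "B \<subseteq> X" "card A = card B"
  obtains \<sigma> where "\<sigma> permutes X" "\<sigma> ` A = B"
proof -
  have fin: "finite A" "finite B" using assms finite_subset by auto
  obtain f where f: "bij_betw f A B" using finite_same_card_bij[OF fin assms(4)] by blast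
  have "card (X - A) = card (X - B)" using assms fin by (simp add: card_Diff_subset)
  then obtain g where g: "bij_betw g (X - A) (X - B)"
    using finite_same_card_bij[of "X - A" "X - B"] assms(1) by blast
  define \<sigma> where "\<sigma> = (\<lambda>x. if x \<in> A then f x else if x \<in> X then g x else x)"
  have "bij_betw (\<lambda>x. if x \<in> A then f x else g x) (A \<union> (X - A)) (B \<union> (X - B))"
    by (rule bij_betw_disjoint_Un[OF f g]) auto
  then have "bij_betw \<sigma> X X"
    using assms by (subst (asm) bij_betw_cong[of _ _ \<sigma>]) (auto simp: \<sigma>_def Un_absorb1)
  then have "\<sigma> permutes X" by (rule bij_imp_permutes) (use assms in \<open>auto simp: \<sigma>_def\<close>)
  moreover have "\<sigma> ` A = B" using f by (auto simp: \<sigma>_def bij_betw_def)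
  ultimately show ?thesis using that by blast
qed

text \<open>The letters \<open>L\<close> distributed over rows \<open>i\<close> and \<open>i + 1\<close>, those with index in \<open>S\<close> going to row \<open>i\<close>.
  Summing over all \<open>S\<close> of fixed size gives a Garnir relation without the multiplicities of permutations.\<close>

definition dist :: "nat \<Rightarrow> 'a list \<Rightarrow> nat set \<Rightarrow> (nat \<times> 'a) multiset" where
  "dist i L S = image_mset (\<lambda>s. (if s \<in> S then i else Suc i, L ! s)) (mset_set {..<length L})"

text \<open>The sum over all permutations of the boxes of \<open>L\<close> is split by the set
  \<open>S\<close> of labels that land in row \<open>i\<close>. All fibres are translates of one
  stabilizer, whose order cancels in characteristic 0.\<close>

lemma kern_garnir:
  fixes f :: "(nat \<times> nat) multiset \<Rightarrow> 'k::field_char_0"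
  assumes lam: "is_partition lam n"
    and f: "\<And>w. length w = sum_list lam \<Longrightarrow> kern lam w z = f (tab lam w)"
    and L: "part_at lam i < length L" "p \<le> length L"
    and T: "tabloid lam (K + dist i L {..<p})"
  shows "(\<Sum>S | S \<subseteq> {..<length L} \<and> card S = p. f (K + dist i L S)) = 0"
proof -
  let ?n = "sum_list lam" and ?l = "length L"
  \<comment> \<open>Letters of \<open>L\<close> may repeat, so they are replaced by their positions,
    tagged \<open>Inl\<close>, while the letters of \<open>K\<close> are tagged \<open>Inr\<close>;
    \<open>dec\<close> removes the tags. In the tagged filling \<open>W\<close> the boxes
    \<open>X\<close> of \<open>L\<close> and their labels can be recognized.\<close>
  define T0 :: "(nat \<times> (nat + nat)) multiset" where
    "T0 = image_mset (\<lambda>(r, a). (r, Inr a)) K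
      + image_mset (\<lambda>s. (if s \<in> {..<p} then i else Suc i, Inl s)) (mset_set {..<?l})"
  have "tabloid lam T0"
    using T by (simp add: tabloid_def T0_def filter_mset_image_mset dist_def case_prod_beta)
  then obtain W where W: "length W = ?n" "tab lam W = T0" by (rule tab_surj)
  define dec where "dec = case_sum ((!) L) id"
  define w where "w = map dec W"
  define X where "X = {j. j < ?n \<and> isl (W ! j)}"
  define lab where "lab j = projl (W ! j)" for j
  have finX: "finite X" "X \<subseteq> {..<?n}" by (auto simp: X_def)
  have tabW: "image_mset (\<lambda>j. (rowof lam j, W ! j)) (mset_set {..<?n}) = T0"
    using W by (simp add: tab_def)
  have flt: "filter_mset (\<lambda>j. isl (W ! j)) (mset_set {..<?n}) = mset_set X"
    "filter_mset (\<lambda>j. \<not> isl (W ! j)) (mset_set {..<?n}) = mset_set ({..<?n} - X)"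
    by (auto simp: X_def intro!: arg_cong[of _ _ mset_set])
  have lenw: "length w = ?n" by (simp add: w_def W)
  have labX: "image_mset (\<lambda>j. (rowof lam j, W ! j)) (mset_set X)
      = image_mset (\<lambda>s. (if s \<in> {..<p} then i else Suc i, Inl s)) (mset_set {..<?l})"
    using arg_cong[OF tabW, of "filter_mset (\<lambda>x. isl (snd x))"] flt
    by (simp add: T0_def filter_mset_image_mset case_prod_beta)
  have labC: "image_mset (\<lambda>j. (rowof lam j, W ! j)) (mset_set ({..<?n} - X))
      = image_mset (\<lambda>(r, a). (r, Inr a)) K"
    using arg_cong[OF tabW, of "filter_mset (\<lambda>x. \<not> isl (snd x))"] flt
    by (simp add: T0_def filter_mset_image_mset case_prod_beta)
  have K: "image_mset (\<lambda>j. (rowof lam j, w ! j)) (mset_set ({..<?n} - X)) = K"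
  proof -
    have "image_mset (\<lambda>x. (fst x, dec (snd x))) (image_mset (\<lambda>j. (rowof lam j, W ! j)) (mset_set ({..<?n} - X))) = K"
      unfolding labC by (simp add: image_mset.compositionality o_def case_prod_beta dec_def)
    moreover have "image_mset (\<lambda>x. (fst x, dec (snd x))) (image_mset (\<lambda>j. (rowof lam j, W ! j)) (mset_set ({..<?n} - X)))
        = image_mset (\<lambda>j. (rowof lam j, w ! j)) (mset_set ({..<?n} - X))"
      unfolding image_mset.compositionality o_def
      by (rule image_mset_cong) (simp add: w_def W)
    ultimately show ?thesis by simp
  qed
  have "image_mset (\<lambda>x. projl (snd x)) (image_mset (\<lambda>j. (rowof lam j, W ! j)) (mset_set X)) = mset_set {..<?l}"
    unfolding labX by (simp add: image_mset.compositionality o_def)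
  then have lm: "image_mset lab (mset_set X) = mset_set {..<?l}"
    by (simp add: image_mset.compositionality o_def lab_def[abs_def])
  have bij: "bij_betw lab X {..<?l}"
  proof -
    have im: "lab ` X = {..<?l}" using arg_cong[OF lm, of set_mset] finX by simp
    moreover have "card X = ?l" using arg_cong[OF lm, of size] by simp
    ultimately show ?thesis using finX by (simp add: bij_betw_def eq_card_imp_inj_on)
  qed
  have row: "rowof lam j = (if lab j < p then i else Suc i)" "w ! j = L ! lab j" if "j \<in> X" for j
  proof -
    have "(rowof lam j, W ! j) \<in># image_mset (\<lambda>j. (rowof lam j, W ! j)) (mset_set X)"
      using that finX by auto
    then show "rowof lam j = (if lab j < p then i else Suc i)"
      unfolding labX by (auto simp: lab_def)
    show "w ! j = L ! lab j" using that by (auto simp: X_def w_def W dec_def lab_def split: sum.splits)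
  qed
  define A where "A S = {j \<in> X. lab j \<in> S}" for S
  have cardA: "card (A S) = card S" and labA: "lab ` A S = S" if "S \<subseteq> {..<?l}" for S
  proof -
    show "lab ` A S = S" using that bij by (auto simp: A_def bij_betw_def)
    moreover have "inj_on lab (A S)" using bij by (auto simp: A_def bij_betw_def inj_on_def)
    ultimately show "card (A S) = card S" using card_image by metis
  qed
  have tab\<pi>: "tab lam (permute_list \<pi> w) = K + dist i L (lab ` \<pi> ` A {..<p})" if \<pi>: "\<pi> permutes X" for \<pi>
  proof -
    let ?S = "lab ` \<pi> ` A {..<p}"
    have \<pi>n: "\<pi> permutes {..<length w}" using \<pi> finX lenw permutes_subset by metis
    have split: "mset_set {..<?n} = mset_set ({..<?n} - X) + mset_set X"
      using finX by (metis finite_lessThan mset_set_Diff subset_imp_msubset_mset_set subset_mset.diff_add)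
    have 1: "image_mset (\<lambda>j. (rowof lam j, permute_list \<pi> w ! j)) (mset_set ({..<?n} - X)) = K"
    proof -
      have "image_mset (\<lambda>j. (rowof lam j, permute_list \<pi> w ! j)) (mset_set ({..<?n} - X))
          = image_mset (\<lambda>j. (rowof lam j, w ! j)) (mset_set ({..<?n} - X))"
        using \<pi> \<pi>n lenw by (intro image_mset_cong) (auto simp: permute_list_nth permutes_not_in)
      then show ?thesis using K by simp
    qed
    have bij2: "bij_betw (lab \<circ> \<pi>) X {..<?l}" using bij permutes_imp_bij[OF \<pi>] bij_betw_trans by blast
    have "image_mset (\<lambda>j. (rowof lam j, permute_list \<pi> w ! j)) (mset_set X)
        = image_mset (\<lambda>s. (if s \<in> ?S then i else Suc i, L ! s)) (image_mset (lab \<circ> \<pi>) (mset_set X))"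
      unfolding image_mset.compositionality
    proof (rule image_mset_cong)
      fix j assume "j \<in># mset_set X"
      then have j: "j \<in> X" "\<pi> j \<in> X" "j < ?n" using finX \<pi> by (auto simp: permutes_in_image)
      have "lab (\<pi> j) \<in> ?S \<longleftrightarrow> j \<in> A {..<p}"
      proof
        assume "lab (\<pi> j) \<in> ?S"
        then obtain j' where "j' \<in> A {..<p}" "(lab \<circ> \<pi>) j' = (lab \<circ> \<pi>) j" by auto
        moreover have "j' \<in> X" using calculation by (simp add: A_def)
        ultimately show "j \<in> A {..<p}" using bij2 j by (metis bij_betw_inv_into_left)
      qed auto
      then show "(rowof lam j, permute_list \<pi> w ! j)
          = ((\<lambda>s. (if s \<in> ?S then i else Suc i, L ! s)) \<circ> (lab \<circ> \<pi>)) j"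
        using j row \<pi>n lenw by (auto simp: permute_list_nth A_def)
    qed
    also have "image_mset (lab \<circ> \<pi>) (mset_set X) = mset_set {..<?l}"
      using bij2 by (simp add: image_mset_mset_set bij_betw_def)
    finally show ?thesis unfolding tab_def dist_def split by (simp add: 1)
  qed
  define c where "c = card {\<pi>. \<pi> permutes X \<and> \<pi> ` A {..<p} = A {..<p}}"
  have finP: "finite {\<pi>. \<pi> permutes X}" using finX by (simp add: finite_permutations)
  have c0: "c \<noteq> 0" unfolding c_def
  proof -
    have "finite {\<pi>. \<pi> permutes X \<and> \<pi> ` A {..<p} = A {..<p}}" by (rule finite_subset[OF _ finP]) auto
    moreover have "id \<in> {\<pi>. \<pi> permutes X \<and> \<pi> ` A {..<p} = A {..<p}}" by (simp add: permutes_id)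
    ultimately show "card {\<pi>. \<pi> permutes X \<and> \<pi> ` A {..<p} = A {..<p}} \<noteq> 0" by (metis card_0_eq empty_iff)
  qed
  let ?P = "{S. S \<subseteq> {..<?l} \<and> card S = p}"
  \<comment> \<open>A permutation carrying \<open>A {..<p}\<close> to \<open>A S\<close> translates
    the stabilizer onto the fibre over \<open>S\<close>.\<close>
  have fib: "card {\<pi>. \<pi> permutes X \<and> lab ` \<pi> ` A {..<p} = S} = c" if S: "S \<in> ?P" for S
  proof -
    have "card (A {..<p}) = card (A S)" using S L by (simp add: cardA)
    moreover have "A {..<p} \<subseteq> X" "A S \<subseteq> X" by (auto simp: A_def)
    ultimately obtain \<sigma> where \<sigma>: "\<sigma> permutes X" "\<sigma> ` A {..<p} = A S"
      using ex_permutes_image finX by metis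
    have iff: "lab ` \<pi> ` A {..<p} = S \<longleftrightarrow> \<pi> ` A {..<p} = A S" if "\<pi> permutes X" for \<pi>
    proof -
      have "\<pi> ` A {..<p} \<subseteq> X" using permutes_in_image[OF that] by (auto simp: A_def)
      moreover have "A S \<subseteq> X" by (auto simp: A_def)
      moreover have "lab ` A S = S" using S labA by auto
      ultimately show ?thesis using bij by (metis bij_betw_def inj_on_image_eq_iff)
    qed
    have "bij_betw ((\<circ>) \<sigma>) {\<pi>. \<pi> permutes X \<and> \<pi> ` A {..<p} = A {..<p}}
        {\<pi>. \<pi> permutes X \<and> lab ` \<pi> ` A {..<p} = S}"
    proof (rule bij_betw_byWitness[of _ "(\<circ>) (inv \<sigma>)"])
      show "(\<circ>) \<sigma> ` {\<pi>. \<pi> permutes X \<and> \<pi> ` A {..<p} = A {..<p}} \<subseteq> {\<pi>. \<pi> permutes X \<and> lab ` \<pi> ` A {..<p} = S}"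
      proof clarify
        fix \<pi> assume \<pi>: "\<pi> permutes X" "\<pi> ` A {..<p} = A {..<p}"
        have "(\<sigma> \<circ> \<pi>) ` A {..<p} = A S" using \<pi> \<sigma> by (metis image_comp)
        then show "\<sigma> \<circ> \<pi> permutes X \<and> lab ` (\<sigma> \<circ> \<pi>) ` A {..<p} = S"
          using iff[OF permutes_compose[OF \<pi>(1) \<sigma>(1)]] permutes_compose[OF \<pi>(1) \<sigma>(1)] by simp
      qed
      have *: "inv \<sigma> ` A S = A {..<p}" using \<sigma> by (metis inv_o_cancel image_comp image_id permutes_inj id_apply)
      show "(\<circ>) (inv \<sigma>) ` {\<pi>. \<pi> permutes X \<and> lab ` \<pi> ` A {..<p} = S} \<subseteq> {\<pi>. \<pi> permutes X \<and> \<pi> ` A {..<p} = A {..<p}}"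
      proof clarify
        fix \<pi> assume \<pi>: "\<pi> permutes X" "S = lab ` \<pi> ` A {..<p}"
        then have "(inv \<sigma> \<circ> \<pi>) ` A {..<p} = A {..<p}" using iff[of \<pi>] * by (metis image_comp)
        then show "inv \<sigma> \<circ> \<pi> permutes X \<and> (inv \<sigma> \<circ> \<pi>) ` A {..<p} = A {..<p}"
          using permutes_compose[OF \<pi>(1) permutes_inv[OF \<sigma>(1)]] by simp
      qed
    qed (use \<sigma> in \<open>auto simp: comp_assoc[symmetric] permutes_inv_o\<close>)
    then show ?thesis unfolding c_def by (simp add: bij_betw_same_card)
  qed
  have "0 = (\<Sum>\<pi> | \<pi> permutes X. kern lam (permute_list \<pi> w) z :: 'k)"
  proof (rule kern_garnir_perm[OF lam lenw finX(2), symmetric])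
    show "rowof lam x = i \<or> rowof lam x = Suc i" if "x \<in> X" for x using row[OF that] by auto
    show "part_at lam i < card X" using bij_betw_same_card[OF bij] L by simp
  qed
  also have "\<dots> = (\<Sum>\<pi> | \<pi> permutes X. f (K + dist i L (lab ` \<pi> ` A {..<p})))"
    by (rule sum.cong) (auto simp: f lenw tab\<pi>)
  also have "\<dots> = (\<Sum>S\<in>?P. \<Sum>\<pi> | \<pi> \<in> {\<pi>. \<pi> permutes X} \<and> lab ` \<pi> ` A {..<p} = S. f (K + dist i L (lab ` \<pi> ` A {..<p})))"
  proof (rule sum.group[symmetric, OF finP])
    show "(\<lambda>\<pi>. lab ` \<pi> ` A {..<p}) ` {\<pi>. \<pi> permutes X} \<subseteq> ?P"
    proof clarsimp
      fix \<pi> assume \<pi>: "\<pi> permutes X"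
      have sub: "\<pi> ` A {..<p} \<subseteq> X" using permutes_in_image[OF \<pi>] by (auto simp: A_def)
      have "card (\<pi> ` A {..<p}) = card (A {..<p})" by (metis \<pi> card_image inj_on_subset permutes_inj subset_UNIV)
      moreover have "card (lab ` \<pi> ` A {..<p}) = card (\<pi> ` A {..<p})"
        using bij sub by (metis bij_betw_def card_image inj_on_subset)
      ultimately show "lab ` \<pi> ` A {..<p} \<subseteq> {..<?l} \<and> card (lab ` \<pi> ` A {..<p}) = p"
        using sub bij cardA[of "{..<p}"] L by (auto simp: bij_betw_def)
    qed
  qed simp
  also have "\<dots> = (\<Sum>S\<in>?P. of_nat c * f (K + dist i L S))"
    by (intro sum.cong refl) (simp add: fib)
  also have "\<dots> = of_nat c * (\<Sum>S\<in>?P. f (K + dist i L S))" by (simp add: sum_distrib_left)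
  finally show ?thesis using c0 by simp
qed

section \<open>Horizontal strips filled with one letter\<close>

lemma permute_list_inj_iff:
  assumes "\<sigma> permutes {..<n}" "length w = n" "length v = n"
  shows "permute_list \<sigma> w = permute_list \<sigma> v \<longleftrightarrow> w = v"
proof
  assume eq: "permute_list \<sigma> w = permute_list \<sigma> v"
  have "permute_list (inv \<sigma>) (permute_list \<sigma> w) = w" if "length w = n" for w
    using permute_list_compose[of "inv \<sigma>" w \<sigma>] assms(1) that permutes_inv[OF assms(1)]
    by (simp add: permutes_inv_o)
  then show "w = v" using assms eq by metis
qed simp

lemma colof_less_part_at: "i < sum_list nu \<Longrightarrow> colof nu i < part_at nu (rowof nu i)"
  using colof_less rowof_less by (simp add: part_at_def)

locale shape_pair =
  fixes lam nu :: "nat list"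
  assumes le: "part_at nu r \<le> part_at lam r"
begin

abbreviation "inn j \<equiv> colof lam j < part_at nu (rowof lam j)"

text \<open>Boxes are numbered row by row, so a box of \<open>nu\<close> has another number in
  \<open>lam\<close>; \<open>inc\<close> and \<open>bk\<close> translate between the two
  numberings.\<close>

definition "inc i = box lam (rowof nu i) (colof nu i)"

definition "bk j = box nu (rowof lam j) (colof lam j)"

definition "strip = {j. j < sum_list lam \<and> \<not> inn j}"

definition "emb e w = map (\<lambda>j. if inn j then w ! bk j else e) [0..<sum_list lam]"

text \<open>For strips of equal size this grows as the strip moves to lower rows. It varies
  monotonically with the dominance order of the inner partitions and replaces that order by a
  number.\<close>

definition "strip_weight = (\<Sum>j\<in>strip. rowof lam j)"

definition "strip_tab e = image_mset (\<lambda>j. (rowof lam j, e)) (mset_set strip)"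

lemma inc:
  assumes "i < sum_list nu"
  shows "inc i < sum_list lam" "rowof lam (inc i) = rowof nu i" "colof lam (inc i) = colof nu i"
    "inn (inc i)" "bk (inc i) = i"
proof -
  have c: "colof nu i < part_at nu (rowof nu i)" using assms colof_less rowof_less by (simp add: part_at_def)
  also have "\<dots> \<le> part_at lam (rowof nu i)" by (rule le)
  finally have "rowof nu i < length lam" "colof nu i < lam ! rowof nu i"
    by (auto simp: part_at_def split: if_splits)
  then show 1: "inc i < sum_list lam" "rowof lam (inc i) = rowof nu i" "colof lam (inc i) = colof nu i"
    by (simp_all add: inc_def box_less rowof_box colof_box)
  then show "inn (inc i)" "bk (inc i) = i" using c box_rowof_colof[OF assms] by (simp_all add: bk_def)
qed

lemma bk:
  assumes "j < sum_list lam" "inn j"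
  shows "bk j < sum_list nu" "rowof nu (bk j) = rowof lam j" "colof nu (bk j) = colof lam j"
    "inc (bk j) = j"
proof -
  have "rowof lam j < length nu" "colof lam j < nu ! rowof lam j"
    using assms by (auto simp: part_at_def split: if_splits)
  then show 1: "bk j < sum_list nu" "rowof nu (bk j) = rowof lam j" "colof nu (bk j) = colof lam j"
    by (simp_all add: bk_def box_less rowof_box colof_box)
  then show "inc (bk j) = j" using box_rowof_colof[OF assms(1)] by (simp add: inc_def)
qed

lemma inc_inj: "inj_on inc {..<sum_list nu}"
  by (rule inj_on_inverseI[of _ bk]) (simp add: inc)

lemma inc_image: "inc ` {..<sum_list nu} = {..<sum_list lam} - strip"
proof (intro set_eqI iffI)
  fix j assume "j \<in> {..<sum_list lam} - strip"
  then have "j < sum_list lam" "inn j" by (auto simp: strip_def)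
  then show "j \<in> inc ` {..<sum_list nu}" using bk by (metis imageI lessThan_iff)
qed (auto simp: strip_def inc colof_less_part_at)

lemma finite_strip [simp]: "finite strip" by (simp add: strip_def)

lemma card_strip: "sum_list nu + card strip = sum_list lam"
proof -
  have "card ({..<sum_list lam} - strip) = sum_list nu"
    using card_image[OF inc_inj] by (simp add: inc_image)
  moreover have "strip \<subseteq> {..<sum_list lam}" by (auto simp: strip_def)
  ultimately show ?thesis using card_mono[of "{..<sum_list lam}" strip] by (simp add: card_Diff_subset)
qed

lemma card_strip_row: "card {j \<in> strip. rowof lam j = r} = part_at lam r - part_at nu r"
proof -
  have "{j \<in> strip. rowof lam j = r} = {j. j < sum_list lam \<and> rowof lam j = r \<and> part_at nu r \<le> colof lam j}"
    by (auto simp: strip_def)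
  then show ?thesis by (simp add: card_row)
qed

lemma length_emb [simp]: "length (emb e w) = sum_list lam"
  by (simp add: emb_def)

lemma emb_nth: "j < sum_list lam \<Longrightarrow> emb e w ! j = (if inn j then w ! bk j else e)"
  by (simp add: emb_def)

lemma emb_inc: "i < sum_list nu \<Longrightarrow> emb e w ! inc i = w ! i"
  by (simp add: emb_nth inc colof_less_part_at)

lemma emb_strip: "j \<in> strip \<Longrightarrow> emb e w ! j = e"
  by (simp add: emb_nth strip_def)

lemma emb_eq_e_iff:
  assumes "e \<notin> set w" "length w = sum_list nu" "j < sum_list lam"
  shows "emb e w ! j = e \<longleftrightarrow> j \<in> strip"
  using assms bk[of j] nth_mem[of "bk j" w] by (auto simp: emb_nth strip_def)

lemma emb_inject:
  assumes "emb e w = emb e v" "length w = sum_list nu" "length v = sum_list nu"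
  shows "w = v"
proof (rule nth_equalityI)
  fix i assume "i < length w"
  then show "w ! i = v ! i" using assms emb_inc[of i e w] emb_inc[of i e v] by simp
qed (simp add: assms)

lemma set_emb: "length w = sum_list nu \<Longrightarrow> set (emb e w) \<subseteq> insert e (set w)"
  by (auto simp: emb_def bk)

lemma tab_emb:
  assumes "length w = sum_list nu"
  shows "tab lam (emb e w) = tab nu w + strip_tab e"
proof -
  have "mset_set {..<sum_list lam} = mset_set ({..<sum_list lam} - strip) + mset_set strip"
    by (subst mset_set_Union[symmetric]) (auto simp: strip_def intro!: arg_cong[of _ _ mset_set])
  also have "mset_set ({..<sum_list lam} - strip) = image_mset inc (mset_set {..<sum_list nu})"
    by (simp add: image_mset_mset_set[OF inc_inj] inc_image)
  finally show ?thesis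
    unfolding tab_def strip_tab_def
    by (auto simp: image_mset.compositionality o_def inc emb_inc emb_strip intro!: arg_cong2[of _ _ _ _ "(+)"] image_mset_cong)
qed

section \<open>Permutations of the inner diagram inside the outer one\<close>

definition "ext \<sigma> = map_permutation {..<sum_list nu} inc \<sigma>"

definition "res \<sigma> i = (if i < sum_list nu then bk (\<sigma> (inc i)) else i)"

lemma ext_inc: "i < sum_list nu \<Longrightarrow> ext \<sigma> (inc i) = inc (\<sigma> i)"
  using inc_inj by (simp add: ext_def map_permutation_apply)

lemma ext_strip: "j \<notin> inc ` {..<sum_list nu} \<Longrightarrow> ext \<sigma> j = j"
  by (simp add: ext_def map_permutation_def restrict_id_def)

lemma ext_permutes: "\<sigma> permutes {..<sum_list nu} \<Longrightarrow> ext \<sigma> permutes {..<sum_list lam}"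
  unfolding ext_def using inc_inj inc_image
  by (intro permutes_subset[OF map_permutation_permutes, of inc _ "inc ` {..<sum_list nu}"])
    (auto simp: bij_betw_def)

lemma sign_ext: "\<sigma> permutes {..<sum_list nu} \<Longrightarrow> sign (ext \<sigma>) = sign \<sigma>"
  unfolding ext_def using inc_inj by (intro sign_map_permutation) auto

lemma inc_cases:
  assumes "j < sum_list lam"
  obtains i where "i < sum_list nu" "j = inc i" | "j \<in> strip" "j \<notin> inc ` {..<sum_list nu}"
  using assms inc_image by blast

lemma ext_row_group: "\<sigma> \<in> row_group nu \<Longrightarrow> ext \<sigma> \<in> row_group lam"
proof -
  assume \<sigma>: "\<sigma> \<in> row_group nu"
  have "rowof lam (ext \<sigma> j) = rowof lam j" if "j < sum_list lam" for j
    using that by (cases rule: inc_cases)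
      (use \<sigma> in \<open>auto simp: ext_inc ext_strip inc row_groupD permutes_lt[OF row_group_permutes]\<close>)
  then show ?thesis using ext_permutes[OF row_group_permutes[OF \<sigma>]] by (simp add: row_group_def)
qed

lemma ext_col_group: "\<sigma> \<in> col_group nu \<Longrightarrow> ext \<sigma> \<in> col_group lam"
proof -
  assume \<sigma>: "\<sigma> \<in> col_group nu"
  have "colof lam (ext \<sigma> j) = colof lam j" if "j < sum_list lam" for j
    using that by (cases rule: inc_cases)
      (use \<sigma> in \<open>auto simp: ext_inc ext_strip inc col_groupD permutes_lt[OF col_group_permutes]\<close>)
  then show ?thesis using ext_permutes[OF col_group_permutes[OF \<sigma>]] by (simp add: col_group_def)
qed

lemma ext_inject:
  assumes "ext \<sigma> = ext \<tau>" "\<sigma> permutes {..<sum_list nu}" "\<tau> permutes {..<sum_list nu}"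
  shows "\<sigma> = \<tau>"
proof
  fix i show "\<sigma> i = \<tau> i"
  proof (cases "i < sum_list nu")
    case True
    then have "inc (\<sigma> i) = inc (\<tau> i)" using assms(1) by (metis ext_inc)
    then show ?thesis using True assms permutes_lt inc_inj by (metis inj_onD lessThan_iff)
  qed (use assms in \<open>simp add: permutes_not_in\<close>)
qed

lemma emb_permute:
  assumes "\<sigma> permutes {..<sum_list nu}" "length w = sum_list nu"
  shows "emb e (permute_list \<sigma> w) = permute_list (ext \<sigma>) (emb e w)"
proof (rule nth_equalityI)
  fix j assume "j < length (emb e (permute_list \<sigma> w))"
  then have j: "j < sum_list lam" by simp
  from j show "emb e (permute_list \<sigma> w) ! j = permute_list (ext \<sigma>) (emb e w) ! j"
    by (cases rule: inc_cases)
      (use assms j in \<open>auto simp: permute_list_nth ext_permutes emb_inc ext_inc ext_strip emb_strip permutes_lt\<close>)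
qed simp

lemma res_permutes:
  assumes "\<sigma> permutes {..<sum_list lam}" "\<And>j. j \<in> strip \<Longrightarrow> \<sigma> j \<in> strip"
  shows "res \<sigma> permutes {..<sum_list nu}" "i < sum_list nu \<Longrightarrow> inc (res \<sigma> i) = \<sigma> (inc i)"
proof -
  have "\<sigma> ` strip = strip"
    using assms by (intro card_subset_eq) (auto simp: card_image permutes_inj_on)
  then have st: "\<sigma> j \<in> strip \<longleftrightarrow> j \<in> strip" for j
    by (metis assms(1) inj_image_mem_iff permutes_inj)
  have "\<sigma> (inc i) < sum_list lam \<and> inn (\<sigma> (inc i))" if "i < sum_list nu" for i
  proof -
    have "inc i \<in> {..<sum_list lam} - strip" using that inc_image by blast
    then have "\<sigma> (inc i) \<in> {..<sum_list lam} - strip" using st permutes_lt[OF assms(1)] by auto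
    then show ?thesis by (auto simp: strip_def)
  qed
  then show 1: "inc (res \<sigma> i) = \<sigma> (inc i)" if "i < sum_list nu" for i
    using that by (simp add: res_def bk)
  have "inj_on (res \<sigma>) {..<sum_list nu}"
  proof (rule inj_onI)
    fix i j assume "i \<in> {..<sum_list nu}" "j \<in> {..<sum_list nu}" "res \<sigma> i = res \<sigma> j"
    then have "\<sigma> (inc i) = \<sigma> (inc j)" using 1 by (metis lessThan_iff)
    then show "i = j" using \<open>i \<in> _\<close> \<open>j \<in> _\<close> inc_inj assms(1) by (metis inj_onD permutes_inj injD)
  qed
  moreover have "res \<sigma> ` {..<sum_list nu} \<subseteq> {..<sum_list nu}"
    using \<open>\<And>i. i < sum_list nu \<Longrightarrow> \<sigma> (inc i) < sum_list lam \<and> inn (\<sigma> (inc i))\<close> by (auto simp: res_def bk)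
  ultimately show "res \<sigma> permutes {..<sum_list nu}"
    using endo_inj_surj[of "{..<sum_list nu}" "res \<sigma>"]
    by (intro bij_imp_permutes) (auto simp: bij_betw_def, simp add: res_def)
qed

lemma col_group_fixing_strip:
  assumes \<tau>: "\<tau> \<in> col_group lam" and fixd: "\<And>j. j \<in> strip \<Longrightarrow> \<tau> j = j"
  shows "\<tau> \<in> ext ` col_group nu"
proof -
  note p\<tau> = col_group_permutes[OF \<tau>]
  have r: "res \<tau> permutes {..<sum_list nu}" "\<And>i. i < sum_list nu \<Longrightarrow> inc (res \<tau> i) = \<tau> (inc i)"
    using res_permutes[OF p\<tau>] fixd by auto
  have "ext (res \<tau>) j = \<tau> j" for j
  proof (cases "j < sum_list lam")
    case True
    then show ?thesis by (cases rule: inc_cases) (auto simp: ext_inc r ext_strip fixd)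
  next
    case False
    then show ?thesis using permutes_not_in[OF p\<tau>] permutes_not_in[OF ext_permutes[OF r(1)]] by simp
  qed
  then have "\<tau> = ext (res \<tau>)" by presburger
  moreover have "res \<tau> \<in> col_group nu"
  proof -
    have "colof nu (res \<tau> i) = colof nu i" if "i < sum_list nu" for i
    proof -
      have "colof lam (inc (res \<tau> i)) = colof lam (inc i)"
        using r(2)[OF that] col_groupD[OF \<tau> inc(1)[OF that]] by simp
      then show ?thesis using inc(3)[OF that] inc(3)[OF permutes_lt[OF r(1) that]] by simp
    qed
    then show ?thesis using r(1) by (simp add: col_group_def)
  qed
  ultimately show ?thesis by (rule image_eqI)
qed

lemma permute_ext_eq_emb_iff:
  assumes \<tau>: "\<tau> permutes {..<sum_list nu}" and v: "length v = sum_list lam" and w: "length w = sum_list nu"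
  shows "permute_list (ext \<tau>) v = emb e w \<longleftrightarrow> v = emb e (permute_list (inv \<tau>) w)"
proof -
  have "permute_list \<tau> (permute_list (inv \<tau>) w) = w"
    using w \<tau> permute_list_compose[of \<tau> w "inv \<tau>"] by (simp add: permutes_inv_o)
  then have "emb e w = permute_list (ext \<tau>) (emb e (permute_list (inv \<tau>) w))"
    using emb_permute[OF \<tau>, of "permute_list (inv \<tau>) w" e] w by simp
  then show ?thesis
    using permute_list_inj_iff[OF ext_permutes[OF \<tau>], of v "emb e (permute_list (inv \<tau>) w)"] v by simp
qed

text \<open>Common to the diagonal coefficients of general strips and of hooks: once the
  contributing column permutations come from \<open>nu\<close>, they can be moved to the other side,
  and a count of row permutations is left.\<close>

lemma kern_emb_via_ext:
  assumes w': "length w' = sum_list nu"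
    and vanish: "\<And>\<tau> \<rho>. \<tau> \<in> col_group lam \<Longrightarrow> \<tau> \<notin> ext ` col_group nu \<Longrightarrow> \<rho> \<in> row_group lam \<Longrightarrow>
      permute_list \<tau> (permute_list \<rho> (emb e w)) \<noteq> emb e w'"
  shows "kern lam (emb e w) (emb e w') = (\<Sum>\<tau>\<in>col_group nu. of_int (sign \<tau>) *
    (of_nat (card {\<rho> \<in> row_group lam. permute_list \<rho> (emb e w) = emb e (permute_list (inv \<tau>) w')}) :: 'k::field))"
proof -
  define N :: "(nat \<Rightarrow> nat) \<Rightarrow> 'k" where
    "N \<tau> = (\<Sum>\<rho>\<in>row_group lam. of_bool (permute_list \<tau> (permute_list \<rho> (emb e w)) = emb e w'))" for \<tau>
  have N_ext: "N (ext \<tau>) = of_nat (card {\<rho> \<in> row_group lam. permute_list \<rho> (emb e w) = emb e (permute_list (inv \<tau>) w')})"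
    if \<tau>: "\<tau> \<in> col_group nu" for \<tau>
    unfolding N_def using permute_ext_eq_emb_iff[OF col_group_permutes[OF \<tau>] _ w']
    by (simp add: Int_def)
  have inj: "inj_on ext (col_group nu)" using ext_inject col_group_permutes by (meson inj_onI)
  have "kern lam (emb e w) (emb e w') = (\<Sum>\<tau>\<in>col_group lam. of_int (sign \<tau>) * N \<tau>)"
    unfolding kern_def N_def sum_distrib_left ..
  also have "\<dots> = (\<Sum>\<tau>\<in>ext ` col_group nu. of_int (sign \<tau>) * N \<tau>)"
    using ext_col_group vanish by (intro sum.mono_neutral_right) (auto simp: N_def)
  also have "\<dots> = (\<Sum>\<tau>\<in>col_group nu. of_int (sign \<tau>) * N (ext \<tau>))"
    using sign_ext col_group_permutes by (simp add: sum.reindex[OF inj])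
  finally show ?thesis by (simp add: N_ext)
qed

text \<open>The order of this group is the product of the factorials of the row lengths of the
  strip; it is the diagonal entry of the triangular system.\<close>

definition "fixers = {\<kappa> \<in> row_group lam. \<forall>i<sum_list nu. \<kappa> (inc i) = inc i}"

lemma fixers_pos: "0 < card fixers"
proof -
  have "id \<in> fixers" by (simp add: fixers_def)
  moreover have "finite fixers" by (simp add: fixers_def)
  ultimately show ?thesis by (metis card_gt_0_iff empty_iff)
qed

text \<open>The letter \<open>e\<close> marks the strip, so a row permutation carrying one filling
  to the other preserves the strip. It therefore factors uniquely as an extended row permutation of
  \<open>nu\<close> after one that fixes the inner boxes.\<close>

lemma card_row_transporters:
  assumes w: "e \<notin> set w" "length w = sum_list nu" and v: "e \<notin> set v" "length v = sum_list nu"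
  shows "card {\<rho> \<in> row_group lam. permute_list \<rho> (emb e w) = emb e v}
    = card fixers * card {\<rho> \<in> row_group nu. permute_list \<rho> w = v}" (is "card ?A = _ * card ?B")
proof -
  have "bij_betw (\<lambda>(\<rho>, \<kappa>). ext \<rho> \<circ> \<kappa>) (?B \<times> fixers) ?A"
  proof (rule bij_betw_byWitness[of _ "\<lambda>\<rho>. (res \<rho>, inv (ext (res \<rho>)) \<circ> \<rho>)"])
    have strip: "\<rho> j \<in> strip" if "\<rho> \<in> ?A" "j \<in> strip" for \<rho> j
    proof -
      have j: "j < sum_list lam" using that by (simp add: strip_def)
      have p: "\<rho> permutes {..<sum_list lam}" using that row_group_permutes by blast
      have "emb e w ! \<rho> j = emb e v ! j" using that p j by (metis (mono_tags, lifting) length_emb mem_Collect_eq permute_list_nth)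
      moreover have "emb e v ! j = e" by (rule emb_strip[OF that(2)])
      ultimately show ?thesis using emb_eq_e_iff[OF w permutes_lt[OF p j]] by simp
    qed
    have r: "res \<rho> permutes {..<sum_list nu}" "\<And>i. i < sum_list nu \<Longrightarrow> inc (res \<rho> i) = \<rho> (inc i)" if "\<rho> \<in> ?A" for \<rho>
      using res_permutes[of \<rho>] strip[OF that] that row_group_permutes by auto
    show "\<forall>a\<in>?B \<times> fixers. (\<lambda>\<rho>. (res \<rho>, inv (ext (res \<rho>)) \<circ> \<rho>)) (case a of (\<rho>, \<kappa>) \<Rightarrow> ext \<rho> \<circ> \<kappa>) = a"
    proof
      fix a assume "a \<in> ?B \<times> fixers"
      then obtain \<rho> \<kappa> where a: "a = (\<rho>, \<kappa>)" and \<rho>: "\<rho> \<in> row_group nu" and \<kappa>: "\<kappa> \<in> fixers" by auto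
      have "res (ext \<rho> \<circ> \<kappa>) = \<rho>"
      proof
        fix i show "res (ext \<rho> \<circ> \<kappa>) i = \<rho> i"
          using \<kappa> permutes_lt[OF row_group_permutes[OF \<rho>]] permutes_not_in[OF row_group_permutes[OF \<rho>]]
          by (simp add: res_def fixers_def ext_inc inc)
      qed
      moreover have "inv (ext \<rho>) \<circ> (ext \<rho> \<circ> \<kappa>) = \<kappa>"
        using ext_permutes[OF row_group_permutes[OF \<rho>]] by (simp add: comp_assoc[symmetric] permutes_inv_o)
      ultimately show "(\<lambda>\<rho>. (res \<rho>, inv (ext (res \<rho>)) \<circ> \<rho>)) (case a of (\<rho>, \<kappa>) \<Rightarrow> ext \<rho> \<circ> \<kappa>) = a"
        by (simp add: a)
    qed
    show "\<forall>\<rho>\<in>?A. (case (res \<rho>, inv (ext (res \<rho>)) \<circ> \<rho>) of (\<rho>, \<kappa>) \<Rightarrow> ext \<rho> \<circ> \<kappa>) = \<rho>"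
    proof
      fix \<rho> assume "\<rho> \<in> ?A"
      from ext_permutes[OF r(1)[OF this]]
      show "(case (res \<rho>, inv (ext (res \<rho>)) \<circ> \<rho>) of (\<rho>, \<kappa>) \<Rightarrow> ext \<rho> \<circ> \<kappa>) = \<rho>"
        by (simp add: comp_assoc[symmetric] permutes_inv_o)
    qed
    show "(\<lambda>(\<rho>, \<kappa>). ext \<rho> \<circ> \<kappa>) ` (?B \<times> fixers) \<subseteq> ?A"
    proof
      fix x assume "x \<in> (\<lambda>(\<rho>, \<kappa>). ext \<rho> \<circ> \<kappa>) ` (?B \<times> fixers)"
      then obtain \<rho> \<kappa> where x: "x = ext \<rho> \<circ> \<kappa>" and \<rho>: "\<rho> \<in> row_group nu" and \<kappa>: "\<kappa> \<in> fixers"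
        and v: "v = permute_list \<rho> w" by auto
      note p\<rho> = row_group_permutes[OF \<rho>]
      have \<kappa>r: "\<kappa> \<in> row_group lam" and \<kappa>i: "\<And>i. i < sum_list nu \<Longrightarrow> \<kappa> (inc i) = inc i" using \<kappa> by (auto simp: fixers_def)
      note p\<kappa> = row_group_permutes[OF \<kappa>r]
      have \<kappa>s: "\<kappa> j \<in> strip" if "j \<in> strip" for j
      proof (rule ccontr)
        assume "\<kappa> j \<notin> strip"
        moreover have jn: "j < sum_list lam" using that by (simp add: strip_def)
        ultimately have "\<kappa> j \<in> inc ` {..<sum_list nu}" using permutes_lt[OF p\<kappa>] inc_image by auto
        then obtain i where "i < sum_list nu" "\<kappa> j = \<kappa> (inc i)" using \<kappa>i by auto
        then have "j \<in> inc ` {..<sum_list nu}" using permutes_inj[OF p\<kappa>] by (auto dest: injD)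
        then show False using that inc_image by auto
      qed
      have "permute_list \<kappa> (emb e v) = emb e v"
      proof (rule nth_equalityI)
        fix j assume "j < length (permute_list \<kappa> (emb e v))"
        then have j: "j < sum_list lam" by simp
        then show "permute_list \<kappa> (emb e v) ! j = emb e v ! j"
          by (cases rule: inc_cases) (use j p\<kappa> in \<open>auto simp: permute_list_nth \<kappa>i emb_strip \<kappa>s\<close>)
      qed simp
      then have "permute_list (ext \<rho> \<circ> \<kappa>) (emb e w) = emb e v"
        using v p\<rho> p\<kappa> w by (simp add: permute_list_compose emb_permute)
      then show "x \<in> ?A"
        using x \<rho> \<kappa>r ext_row_group row_group_comp by simp
    qed
    show "(\<lambda>\<rho>. (res \<rho>, inv (ext (res \<rho>)) \<circ> \<rho>)) ` ?A \<subseteq> ?B \<times> fixers"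
    proof
      fix x assume "x \<in> (\<lambda>\<rho>. (res \<rho>, inv (ext (res \<rho>)) \<circ> \<rho>)) ` ?A"
      then obtain \<rho> where x: "x = (res \<rho>, inv (ext (res \<rho>)) \<circ> \<rho>)"
        and \<rho>: "\<rho> \<in> row_group lam" "permute_list \<rho> (emb e w) = emb e v" by auto
      then have A: "\<rho> \<in> ?A" by simp
      note r = r[OF A]
      have rr: "res \<rho> \<in> row_group nu"
        using r inc row_groupD[OF \<rho>(1)] by (auto simp: row_group_def) (metis permutes_lt)
      have "v = permute_list (res \<rho>) w"
      proof (rule nth_equalityI)
        fix i assume "i < length v"
        then have i: "i < sum_list nu" using v by simp
        have "v ! i = permute_list \<rho> (emb e w) ! inc i" using emb_inc[OF i, of e v] \<rho> by simp
        also have "\<dots> = emb e w ! inc (res \<rho> i)"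
          using r(2)[OF i] row_group_permutes[OF \<rho>(1)] inc[OF i] by (simp add: permute_list_nth)
        finally show "v ! i = permute_list (res \<rho>) w ! i"
          using i r(1) w by (simp add: emb_inc permutes_lt permute_list_nth)
      qed (use v w in simp)
      moreover have "inv (ext (res \<rho>)) \<circ> \<rho> \<in> fixers"
      proof -
        have "inv (ext (res \<rho>)) (\<rho> (inc i)) = inc i" if "i < sum_list nu" for i
          using r(2)[OF that] ext_inc[OF that, of "res \<rho>"] permutes_inverses(2)[OF ext_permutes[OF r(1)]] by metis
        then show ?thesis using row_group_comp[OF row_group_inv[OF ext_row_group[OF rr]] \<rho>(1)]
          by (simp add: fixers_def)
      qed
      ultimately show "x \<in> ?B \<times> fixers" using rr x by simp
    qed
  qed
  then have "card ?A = card (?B \<times> fixers)" by (simp add: bij_betw_same_card)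
  then show ?thesis by (simp add: card_cartesian_product)
qed

end

abbreviation "emb \<equiv> shape_pair.emb"
abbreviation "strip \<equiv> shape_pair.strip"
abbreviation "strip_weight \<equiv> shape_pair.strip_weight"

lemma hstrip_shape_pair: "nu \<in> hstrips lam \<Longrightarrow> shape_pair lam nu"
  by (auto simp: hstrips_def part_le_def shape_pair_def)

text \<open>Before the permutations \<open>e\<close> sits exactly on the strip of \<open>nu\<close>,
  afterwards at least on the strip of \<open>mu\<close>; this compares the sizes. For equal sizes
  the two strips correspond, and a column permutation can only raise boxes of the strip of
  \<open>mu\<close>, which compares the weights. Equal weights leave no room to move.\<close>

lemma emb_transport:
  assumes lam: "is_partition lam n" and nu: "nu \<in> hstrips lam" and mu: "mu \<in> hstrips lam"
    and w: "e \<notin> set w" "length w = sum_list nu" and w': "length w' = sum_list mu"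
    and \<rho>: "\<rho> \<in> row_group lam" and \<tau>: "\<tau> \<in> col_group lam"
    and eq: "permute_list \<tau> (permute_list \<rho> (emb lam nu e w)) = emb lam mu e w'"
  shows "sum_list nu \<le> sum_list mu"
    "sum_list nu = sum_list mu \<Longrightarrow> e \<notin> set w'"
    "sum_list nu = sum_list mu \<Longrightarrow> strip_weight lam nu \<le> strip_weight lam mu"
    "sum_list nu = sum_list mu \<Longrightarrow> strip_weight lam nu = strip_weight lam mu \<Longrightarrow> nu = mu"
    "sum_list nu = sum_list mu \<Longrightarrow> strip_weight lam nu = strip_weight lam mu \<Longrightarrow> j \<in> strip lam mu \<Longrightarrow> \<tau> j = j"
proof -
  interpret nu: shape_pair lam nu by (rule hstrip_shape_pair[OF nu])
  interpret mu: shape_pair lam mu by (rule hstrip_shape_pair[OF mu])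
  let ?n = "sum_list lam"
  let ?z = "emb lam mu e w'"
  note p\<rho> = row_group_permutes[OF \<rho>] and p\<tau> = col_group_permutes[OF \<tau>]
  have p\<sigma>: "\<rho> \<circ> \<tau> permutes {..<?n}" using p\<rho> p\<tau> permutes_compose by blast
  have nth: "?z ! j = emb lam nu e w ! \<rho> (\<tau> j)" if "j < ?n" for j
    using arg_cong[OF eq, of "\<lambda>l. l ! j"] that p\<rho> p\<tau> permutes_lt[OF p\<tau> that]
    by (simp add: permute_list_nth)
  define E where "E = {j. j < ?n \<and> ?z ! j = e}"
  have E: "E = (\<rho> \<circ> \<tau>) -` strip lam nu"
  proof (intro set_eqI iffI)
    fix j assume "j \<in> E"
    then have j: "j < ?n" "emb lam nu e w ! \<rho> (\<tau> j) = e" using nth by (auto simp: E_def)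
    then show "j \<in> (\<rho> \<circ> \<tau>) -` strip lam nu"
      using nu.emb_eq_e_iff[OF w permutes_lt[OF p\<sigma> j(1)]] by simp
  next
    fix j assume "j \<in> (\<rho> \<circ> \<tau>) -` strip lam nu"
    then have j: "(\<rho> \<circ> \<tau>) j \<in> strip lam nu" by simp
    then have "j < ?n" using permutes_in_image[OF p\<sigma>, of j] by (auto simp: nu.strip_def)
    then show "j \<in> E" using nth nu.emb_strip[OF j] by (auto simp: E_def)
  qed
  have cE: "card E = card (strip lam nu)"
    unfolding E using permutes_inj[OF p\<sigma>] permutes_surj[OF p\<sigma>] by (intro card_vimage_inj) simp_all
  have sub: "strip lam mu \<subseteq> E"
  proof
    fix j assume j: "j \<in> strip lam mu"
    then have "j < ?n" by (simp add: mu.strip_def)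
    then show "j \<in> E" using mu.emb_strip[OF j] by (simp add: E_def)
  qed
  have finE: "finite E" by (simp add: E_def)
  show 1: "sum_list nu \<le> sum_list mu"
    using card_mono[OF finE sub] cE nu.card_strip mu.card_strip by linarith
  assume same: "sum_list nu = sum_list mu"
  have "card E \<le> card (strip lam mu)" using cE nu.card_strip mu.card_strip same by linarith
  then have Emu: "E = strip lam mu"
    using card_seteq[OF finE sub] by simp
  show "e \<notin> set w'"
  proof
    assume "e \<in> set w'"
    then obtain i where i: "i < sum_list mu" "w' ! i = e" using w' by (metis in_set_conv_nth)
    then have "mu.inc i \<in> E" using mu.emb_inc[OF i(1), of e w'] mu.inc(1)[OF i(1)] i(2) by (simp add: E_def)
    then show False using Emu i mu.inc[OF i(1)] by (simp add: mu.strip_def)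
  qed
  \<comment> \<open>By interlacing, the next row of \<open>lam\<close> is no longer than row
    \<open>rowof lam j\<close> of \<open>mu\<close>; so a strip box is the lowest one in its
    column.\<close>
  have up: "rowof lam (\<tau> j) \<le> rowof lam j" if j: "j \<in> strip lam mu" for j
  proof (rule ccontr)
    assume n: "\<not> ?thesis"
    have jn: "j < ?n" using j by (simp add: mu.strip_def)
    have tn: "\<tau> j < ?n" by (rule permutes_lt[OF p\<tau> jn])
    have "colof lam (\<tau> j) < part_at lam (rowof lam (\<tau> j))" by (rule colof_less_part_at[OF tn])
    also have "\<dots> \<le> part_at lam (Suc (rowof lam j))" using n by (intro partition_antimono[OF lam]) simp
    also have "\<dots> \<le> part_at mu (rowof lam j)" using mu by (simp add: hstrips_iff[OF lam])
    finally show False using j col_groupD[OF \<tau> jn] by (simp add: mu.strip_def)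
  qed
  have im: "(\<rho> \<circ> \<tau>) ` strip lam mu = strip lam nu"
    unfolding Emu[symmetric] E by (rule surj_image_vimage_eq[OF permutes_surj[OF p\<sigma>]])
  have inj: "inj_on (\<rho> \<circ> \<tau>) (strip lam mu)" using permutes_inj[OF p\<sigma>] by (simp add: inj_on_def)
  have row: "rowof lam ((\<rho> \<circ> \<tau>) j) = rowof lam (\<tau> j)" if "j \<in> strip lam mu" for j
    using row_groupD[OF \<rho>] permutes_lt[OF p\<tau>] that by (simp add: mu.strip_def)
  have W: "strip_weight lam nu = (\<Sum>j\<in>strip lam mu. rowof lam (\<tau> j))"
    unfolding nu.strip_weight_def im[symmetric] sum.reindex[OF inj] using row by simp
  then show "strip_weight lam nu \<le> strip_weight lam mu"
    unfolding mu.strip_weight_def by (simp add: sum_mono up)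
  assume Weq: "strip_weight lam nu = strip_weight lam mu"
  have roweq: "rowof lam (\<tau> j) = rowof lam j" if "j \<in> strip lam mu" for j
  proof (rule ccontr)
    assume "rowof lam (\<tau> j) \<noteq> rowof lam j"
    then have "(\<Sum>j\<in>strip lam mu. rowof lam (\<tau> j)) < (\<Sum>j\<in>strip lam mu. rowof lam j)"
      using that up by (intro sum_strict_mono_ex1) (auto simp: le_less)
    then show False using W Weq by (simp add: mu.strip_weight_def)
  qed
  then have fixd: "\<tau> j = j" if "j \<in> strip lam mu" for j
    using that row_col_eq[of "\<tau> j" lam j] permutes_lt[OF p\<tau>] col_groupD[OF \<tau>] by (simp add: mu.strip_def)
  show "nu = mu"
  proof (rule partition_eqI)
    show "is_partition nu (sum_list nu)" "is_partition mu (sum_list mu)"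
      using nu mu by (simp_all add: hstrips_def)
    fix r
    have "(\<rho> \<circ> \<tau>) ` {j \<in> strip lam mu. rowof lam j = r} = {j \<in> strip lam nu. rowof lam j = r}"
      unfolding im[symmetric] using row roweq by auto
    moreover have "inj_on (\<rho> \<circ> \<tau>) {j \<in> strip lam mu. rowof lam j = r}"
      using inj by (rule inj_on_subset) auto
    ultimately have "card {j \<in> strip lam mu. rowof lam j = r} = card {j \<in> strip lam nu. rowof lam j = r}"
      using card_image[of "\<rho> \<circ> \<tau>" "{j \<in> strip lam mu. rowof lam j = r}"] by simp
    then show "part_at nu r = part_at mu r"
      using nu.le[of r] mu.le[of r] by (simp add: nu.card_strip_row mu.card_strip_row)
  qed
  show "j \<in> strip lam mu \<Longrightarrow> \<tau> j = j" using fixd .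
qed

lemma kern_nonzeroE:
  assumes "kern lam w z \<noteq> (0 :: 'k::field)"
  obtains \<rho> \<tau> where "\<rho> \<in> row_group lam" "\<tau> \<in> col_group lam" "permute_list \<tau> (permute_list \<rho> w) = z"
proof -
  obtain \<tau> where \<tau>: "\<tau> \<in> col_group lam"
    "(\<Sum>\<rho>\<in>row_group lam. of_int (sign \<tau>) * (of_bool (permute_list \<tau> (permute_list \<rho> w) = z) :: 'k)) \<noteq> 0"
    using assms unfolding kern_def by (meson sum.neutral)
  then obtain \<rho> where "\<rho> \<in> row_group lam"
    "of_int (sign \<tau>) * (of_bool (permute_list \<tau> (permute_list \<rho> w) = z) :: 'k) \<noteq> 0"
    by (meson sum.neutral)
  then show ?thesis using that \<tau>(1) by (cases "permute_list \<tau> (permute_list \<rho> w) = z") auto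
qed

lemma kern_mset:
  assumes "kern lam w z \<noteq> (0 :: 'k::field)" "length w = sum_list lam"
  shows "mset z = mset w"
proof -
  obtain \<rho> \<tau> where *: "\<rho> \<in> row_group lam" "\<tau> \<in> col_group lam" "permute_list \<tau> (permute_list \<rho> w) = z"
    by (rule kern_nonzeroE[OF assms(1)])
  then show ?thesis using row_group_permutes[OF *(1)] col_group_permutes[OF *(2)] assms(2) by auto
qed

lemma kern_emb_triangular:
  assumes lam: "is_partition lam n" and nu: "nu \<in> hstrips lam" and mu: "mu \<in> hstrips lam"
    and w: "e \<notin> set w" "length w = sum_list nu" and w': "length w' = sum_list mu"
    and ne: "kern lam (emb lam nu e w) (emb lam mu e w') \<noteq> (0 :: 'k::field)"
  shows "sum_list nu < sum_list mu \<or> sum_list nu = sum_list mu \<and> e \<notin> set w' \<and>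
    (strip_weight lam nu < strip_weight lam mu \<or> nu = mu)"
  using kern_nonzeroE[OF ne] emb_transport[OF lam nu mu w w']
  by (metis le_neq_implies_less)

text \<open>Source and target have the same strip weight, so every contributing column permutation
  fixes the strip and comes from \<open>nu\<close>; the row permutations then split off the factor
  \<open>fixers\<close>. If \<open>e\<close> occurs in \<open>w'\<close>, the right side vanishes
  because the contents differ, the left side by triangularity.\<close>

lemma kern_emb_diag:
  assumes lam: "is_partition lam n" and nu: "nu \<in> hstrips lam"
    and w: "e \<notin> set w" "length w = sum_list nu" and w': "length w' = sum_list nu"
  shows "kern lam (emb lam nu e w) (emb lam nu e w')
    = (of_nat (card (shape_pair.fixers lam nu)) * kern nu w w' :: 'k::field)"
proof (cases "e \<in> set w'")
  case True
  then have "mset w \<noteq> mset w'" using w by (metis mset_eq_setD)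
  then have "kern nu w w' = (0 :: 'k)" using kern_mset w by metis
  moreover have "kern lam (emb lam nu e w) (emb lam nu e w') = (0 :: 'k)"
    using kern_emb_triangular[OF lam nu nu w w', where 'k = 'k] True by auto
  ultimately show ?thesis by simp
next
  case False
  interpret shape_pair lam nu by (rule hstrip_shape_pair[OF nu])
  have N: "card {\<rho> \<in> row_group lam. permute_list \<rho> (emb e w) = emb e (permute_list (inv \<tau>) w')}
      = card fixers * card {\<rho> \<in> row_group nu. permute_list \<tau> (permute_list \<rho> w) = w'}"
    if \<tau>: "\<tau> \<in> col_group nu" for \<tau>
  proof -
    note p\<tau> = col_group_permutes[OF \<tau>]
    have pi: "inv \<tau> permutes {..<length w'}" using p\<tau> w' permutes_inv by metis
    have v: "length (permute_list (inv \<tau>) w') = sum_list nu" "e \<notin> set (permute_list (inv \<tau>) w')"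
      using w' False pi by simp_all
    have "permute_list \<tau> (permute_list (inv \<tau>) w') = w'"
      using w' p\<tau> permute_list_compose[of \<tau> w' "inv \<tau>"] by (simp add: permutes_inv_o)
    then have b: "permute_list \<tau> (permute_list \<rho> w) = w' \<longleftrightarrow> permute_list \<rho> w = permute_list (inv \<tau>) w'" for \<rho>
      using permute_list_inj_iff[OF p\<tau>, of "permute_list \<rho> w" "permute_list (inv \<tau>) w'"] v w by simp
    show ?thesis unfolding b by (rule card_row_transporters[OF w v(2,1)])
  qed
  have "kern lam (emb e w) (emb e w') = (\<Sum>\<tau>\<in>col_group nu. of_int (sign \<tau>) *
      (of_nat (card {\<rho> \<in> row_group lam. permute_list \<rho> (emb e w) = emb e (permute_list (inv \<tau>) w')}) :: 'k))"
  proof (rule kern_emb_via_ext[OF w'])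
    fix \<tau> \<rho> assume \<tau>: "\<tau> \<in> col_group lam" "\<tau> \<notin> ext ` col_group nu" and \<rho>: "\<rho> \<in> row_group lam"
    show "permute_list \<tau> (permute_list \<rho> (emb e w)) \<noteq> emb e w'"
    proof
      assume "permute_list \<tau> (permute_list \<rho> (emb e w)) = emb e w'"
      from emb_transport(5)[OF lam nu nu w w' \<rho> \<tau>(1) this refl refl]
      show False using col_group_fixing_strip[OF \<tau>(1)] \<tau>(2) by blast
    qed
  qed
  also have "\<dots> = of_nat (card fixers) * kern nu w w'"
    unfolding kern_def sum_distrib_left
    by (rule sum.cong[OF refl]) (simp add: N sum_distrib_left[symmetric] Int_def mult_ac)
  finally show ?thesis .
qed

section \<open>Straightening\<close>

definition words :: "nat \<Rightarrow> nat \<Rightarrow> nat list set" where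
  "words n m = {xs. length xs = n \<and> set xs \<subseteq> {..<m}}"

lemma finite_words [simp]: "finite (words n m)"
  unfolding words_def using finite_lists_length_eq[of "{..<m}" n] by (simp add: conj_commute)

definition valid :: "nat list \<Rightarrow> nat \<Rightarrow> (nat \<times> nat) multiset \<Rightarrow> bool" where
  "valid lam m T \<longleftrightarrow> tabloid lam T \<and> snd ` set_mset T \<subseteq> {..<m}"

text \<open>Functionals on the quotient of row tabloids by the Garnir relations. The elimination argument works
  with these functionals instead of the quotient, so that no double dual is needed.\<close>

definition good :: "nat list \<Rightarrow> nat \<Rightarrow> ((nat \<times> nat) multiset \<Rightarrow> 'k::field) \<Rightarrow> bool" where
  "good lam m F \<longleftrightarrow> (\<forall>i K L p. Suc i < length lam \<longrightarrow> part_at lam i < length L \<longrightarrow> p \<le> length L \<longrightarrow>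
     valid lam m (K + dist i L {..<p}) \<longrightarrow>
     (\<Sum>S | S \<subseteq> {..<length L} \<and> card S = p. F (K + dist i L S)) = 0)"

lemma good_lincomb:
  assumes "good lam m F" "good lam m G"
  shows "good lam m (\<lambda>T. F T + c * G T)"
  using assms unfolding good_def by (simp add: sum.distrib sum_distrib_left[symmetric])

lemma good_zero: "good lam m (\<lambda>T. 0)"
  by (simp add: good_def)

lemma good_sum:
  assumes "finite A" "\<And>a. a \<in> A \<Longrightarrow> good lam m (F a)"
  shows "good lam m (\<lambda>T. \<Sum>a\<in>A. c a * F a T)"
  using assms
proof (induction A)
  case empty then show ?case by (simp add: good_zero)
next
  case (insert a A)
  then have "good lam m (\<lambda>T. (\<Sum>a\<in>A. c a * F a T) + c a * F a T)"
    by (intro good_lincomb) auto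
  then show ?case using insert by (simp add: add.commute)
qed

text \<open>Row invariance makes the choice of a word over each tabloid immaterial, so
  \<open>kern\<close> descends to tabloids, where it satisfies the Garnir relations.\<close>

lemma kern_good:
  assumes "is_partition lam n"
  obtains f :: "(nat \<times> nat) multiset \<Rightarrow> 'k::field_char_0"
  where "good lam m f" "\<And>w. length w = sum_list lam \<Longrightarrow> kern lam w z = f (tab lam w)"
proof -
  define f :: "(nat \<times> nat) multiset \<Rightarrow> 'k" where
    "f T = kern lam (SOME w. length w = sum_list lam \<and> tab lam w = T) z" for T
  have f: "kern lam w z = f (tab lam w)" if "length w = sum_list lam" for w
  proof -
    have "length (SOME v. length v = sum_list lam \<and> tab lam v = tab lam w) = sum_list lam \<and>
      tab lam (SOME v. length v = sum_list lam \<and> tab lam v = tab lam w) = tab lam w"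
      by (rule someI[of _ w]) (simp add: that)
    then show ?thesis unfolding f_def using that by (intro kern_row_invariant) auto
  qed
  have "good lam m f" unfolding good_def valid_def
    using kern_garnir[OF assms, of z f] f by blast
  with f show ?thesis using that by blast
qed

section \<open>How often and how low a letter occurs\<close>

definition eweight :: "nat \<Rightarrow> (nat \<times> nat) multiset \<Rightarrow> nat" where
  "eweight e T = (\<Sum>x\<in>#T. if snd x = e then fst x else 0)"

definition ecount :: "nat \<Rightarrow> (nat \<times> nat) multiset \<Rightarrow> nat" where
  "ecount e T = count (image_mset snd T) e"

lemma eweight_add [simp]: "eweight e (T + T') = eweight e T + eweight e T'"
  by (simp add: eweight_def)

lemma ecount_add [simp]: "ecount e (T + T') = ecount e T + ecount e T'"
  by (simp add: ecount_def)

lemma ecount_0: "e \<notin> snd ` set_mset T \<Longrightarrow> ecount e T = 0"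
  by (simp add: ecount_def count_eq_zero_iff del: count_image_mset)

lemma eweight_0: "e \<notin> snd ` set_mset T \<Longrightarrow> eweight e T = 0"
  by (auto simp: eweight_def intro!: sum_mset.neutral)

lemma snd_dist: "image_mset snd (dist i L S) = mset L"
proof -
  have "image_mset snd (dist i L S) = image_mset ((!) L) (mset_set {..<length L})"
    by (simp add: dist_def image_mset.compositionality o_def)
  also have "\<dots> = mset (map ((!) L) [0..<length L])" by (simp add: mset_upt atLeast0LessThan)
  finally show ?thesis by (simp add: map_nth)
qed

lemma set_snd_dist: "snd ` set_mset (dist i L S) = set L"
  using arg_cong[OF snd_dist, of set_mset] by simp

lemma dist_split:
  assumes "S \<subseteq> {..<length L}"
  shows "dist i L S = image_mset (\<lambda>s. (i, L ! s)) (mset_set S)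
    + image_mset (\<lambda>s. (Suc i, L ! s)) (mset_set ({..<length L} - S))"
proof -
  have "mset_set {..<length L} = mset_set S + mset_set ({..<length L} - S)"
    using assms by (subst mset_set_Union[symmetric]) (auto intro: finite_subset intro!: arg_cong[of _ _ mset_set])
  then show ?thesis
    unfolding dist_def using assms
    by (auto intro!: arg_cong2[of _ _ _ _ "(+)"] image_mset_cong dest: finite_subset)
qed

lemma size_dist_row:
  assumes "S \<subseteq> {..<length L}"
  shows "size (filter_mset (\<lambda>x. fst x = r) (dist i L S))
    = (if r = i then card S else if r = Suc i then length L - card S else 0)"
proof -
  have "finite S" using assms finite_subset by blast
  then show ?thesis
    using assms card_Diff_subset[of S "{..<length L}"]
    by (auto simp: dist_split filter_mset_image_mset)
      (simp add: Diff_eq Int_def)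
qed

lemma valid_dist:
  assumes "S \<subseteq> {..<length L}" "S' \<subseteq> {..<length L}" "card S = card S'"
    "valid lam m (K + dist i L S)"
  shows "valid lam m (K + dist i L S')"
proof -
  have "size (filter_mset (\<lambda>x. fst x = r) (dist i L S')) = size (filter_mset (\<lambda>x. fst x = r) (dist i L S))" for r
    using assms by (simp add: size_dist_row)
  then show ?thesis using assms(4) by (simp add: valid_def tabloid_def set_snd_dist image_Un)
qed

text \<open>With all occurrences of \<open>e\<close> in row \<open>Suc i\<close> the weight would be
  the right side; each occurrence placed in row \<open>i\<close> lowers it by one.\<close>

lemma eweight_dist:
  assumes "S \<subseteq> {..<length L}"
  shows "eweight e (dist i L S) + card {s \<in> S. L ! s = e} = Suc i * card {s. s < length L \<and> L ! s = e}"
proof -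
  have fin: "finite S" using assms finite_subset by blast
  have "eweight e (dist i L S) = (\<Sum>s\<in>{..<length L}. if L ! s = e then (if s \<in> S then i else Suc i) else 0)"
    unfolding eweight_def dist_def image_mset.compositionality o_def sum_unfold_sum_mset
    by (intro arg_cong[of _ _ sum_mset] image_mset_cong) auto
  moreover have "card {s \<in> S. L ! s = e} = (\<Sum>s\<in>{..<length L}. if L ! s = e then (if s \<in> S then 1 else 0) else 0)"
  proof -
    have "card {s \<in> S. L ! s = e} = (\<Sum>s\<in>{s \<in> S. L ! s = e}. 1)" by simp
    also have "\<dots> = (\<Sum>s\<in>{..<length L}. if L ! s = e then (if s \<in> S then 1 else 0) else 0)"
      by (rule sum.mono_neutral_cong_left) (use assms in auto)
    finally show ?thesis .
  qed
  ultimately have "eweight e (dist i L S) + card {s \<in> S. L ! s = e}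
      = (\<Sum>s\<in>{..<length L}. if L ! s = e then Suc i else 0)"
    by (simp add: sum.distrib[symmetric] if_distrib cong: if_cong) (auto intro!: sum.cong)
  also have "\<dots> = Suc i * card {s. s < length L \<and> L ! s = e}"
    by (simp add: sum.If_cases Int_def)
  finally show ?thesis .
qed

text \<open>The bound that makes straightening terminate.\<close>

lemma eweight_tab_le: "eweight e (tab lam w) \<le> sum_list lam * length lam"
proof -
  have "eweight e (tab lam w) = (\<Sum>j<sum_list lam. if w ! j = e then rowof lam j else 0)"
    unfolding eweight_def tab_def image_mset.compositionality o_def sum_unfold_sum_mset
    by (intro arg_cong[of _ _ sum_mset] image_mset_cong) auto
  also have "\<dots> \<le> (\<Sum>j<sum_list lam. length lam)"
    by (intro sum_mono) (auto dest: rowof_less)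
  finally show ?thesis by simp
qed

context shape_pair begin

lemma size_strip_tab_row:
  "size (filter_mset (\<lambda>x. fst x = r) (strip_tab e)) = part_at lam r - part_at nu r"
  using card_strip_row[of r] by (simp add: strip_tab_def filter_mset_image_mset)

lemma eweight_strip_tab: "eweight e (strip_tab e) = strip_weight"
  by (simp add: eweight_def strip_tab_def strip_weight_def image_mset.compositionality o_def sum_unfold_sum_mset)

lemma ecount_strip_tab: "ecount e (strip_tab e) = card strip"
  by (simp add: ecount_def strip_tab_def image_mset.compositionality o_def image_mset_const_eq)

lemma set_strip_tab: "snd ` set_mset (strip_tab e) \<subseteq> {e}"
  by (auto simp: strip_tab_def)

lemma valid_add_strip_tab: "valid nu M T \<Longrightarrow> valid lam (Suc M) (T + strip_tab M)"
  using le set_strip_tab[of M] by (fastforce simp: valid_def tabloid_def size_strip_tab_row image_Un)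

end

lemma mset_const_snd_eqI:
  assumes "\<And>r. size (filter_mset (\<lambda>x. fst x = r) A) = size (filter_mset (\<lambda>x. fst x = r) B)"
    "snd ` set_mset A \<subseteq> {e}" "snd ` set_mset B \<subseteq> {e}"
  shows "A = B"
proof -
  have "A = image_mset (\<lambda>r. (r, e)) (image_mset fst A)" if "snd ` set_mset A \<subseteq> {e}" for A :: "('a \<times> 'b) multiset"
  proof -
    have "image_mset (\<lambda>x. (fst x, e)) A = image_mset id A"
      using that by (intro image_mset_cong) (auto simp: prod_eq_iff)
    then show ?thesis by (simp add: image_mset.compositionality o_def)
  qed
  then show ?thesis using assms mset_map_fst_eqI by metis
qed

lemma valid_obtain_word:
  assumes "valid lam m T"
  obtains w where "length w = sum_list lam" "set w \<subseteq> {..<m}" "tab lam w = T"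
  using tab_surj[of lam T] assms set_tab unfolding valid_def by metis

text \<open>If row \<open>i\<close> has fewer letters other than \<open>M\<close> than row \<open>i + 1\<close> has boxes, the Garnir relation for the copies
  of \<open>M\<close> in row \<open>i\<close> and all of row \<open>i + 1\<close> rewrites the tabloid by tabloids with \<open>M\<close> in lower rows.\<close>

lemma good_straighten:
  fixes F :: "(nat \<times> nat) multiset \<Rightarrow> 'k::field_char_0"
  assumes lam: "is_partition lam n" and F: "good lam (Suc M) F"
    and hyp: "\<And>nu w. nu \<in> hstrips lam \<Longrightarrow> w \<in> words (sum_list nu) M \<Longrightarrow> card (strip lam nu) = E
      \<Longrightarrow> t \<le> strip_weight lam nu \<Longrightarrow> F (tab lam (emb lam nu M w)) = 0"
    and T: "valid lam (Suc M) T" "ecount M T = E" "t \<le> eweight M T"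
  shows "F T = 0"
  using T
\<comment> \<open>Straightening raises \<open>eweight\<close>, and \<open>eweight_tab_le\<close>
  bounds it.\<close>
proof (induction "sum_list lam * length lam - eweight M T" arbitrary: T rule: less_induct)
  case less
  note T = less.prems
  \<comment> \<open>The row lengths of the part of \<open>T\<close> without \<open>M\<close>; the
    case distinction asks whether they interlace with \<open>lam\<close>.\<close>
  define \<alpha> where "\<alpha> r = size (filter_mset (\<lambda>x. fst x = r \<and> snd x \<noteq> M) T)" for r
  have rowsize: "size (filter_mset (\<lambda>x. fst x = r \<and> snd x = M) T) + \<alpha> r = part_at lam r" for r
  proof -
    have "filter_mset (\<lambda>x. fst x = r) T = filter_mset (\<lambda>x. fst x = r \<and> snd x = M) T
        + filter_mset (\<lambda>x. fst x = r \<and> snd x \<noteq> M) T"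
      by (auto intro!: multiset_eqI)
    from arg_cong[OF this, of size] show ?thesis using T(1)
      by (simp add: \<alpha>_def tabloid_def valid_def)
  qed
  show ?case
  proof (cases "\<exists>i. Suc i < length lam \<and> \<alpha> i < part_at lam (Suc i)")
    case True
    then obtain i where i: "Suc i < length lam" "\<alpha> i < part_at lam (Suc i)" by blast
    define Te where "Te = filter_mset (\<lambda>x. fst x = i \<and> snd x = M) T"
    define T1 where "T1 = filter_mset (\<lambda>x. fst x = Suc i) T"
    define K where "K = filter_mset (\<lambda>x. \<not> (fst x = i \<and> snd x = M) \<and> fst x \<noteq> Suc i) T"
    define a where "a = size Te"
    obtain L1 where L1: "mset L1 = image_mset snd T1" using ex_mset by blast
    define L where "L = replicate a M @ L1"
    have lenL1: "length L1 = part_at lam (Suc i)"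
      using arg_cong[OF L1, of size] T(1) by (simp add: T1_def valid_def tabloid_def)
    have lenL: "length L = a + length L1" by (simp add: L_def)
    have La: "L ! s = M" if "s < a" for s using that by (simp add: L_def nth_append)
    have Te: "Te = replicate_mset a (i, M)"
      unfolding a_def by (rule set_mset_subset_singletonD) (auto simp: Te_def prod_eq_iff)
    have T1: "T1 = image_mset (Pair (Suc i)) (mset L1)"
    proof -
      have "image_mset (\<lambda>x. (Suc i, snd x)) T1 = image_mset id T1"
        by (rule image_mset_cong) (auto simp: T1_def prod_eq_iff)
      then show ?thesis by (simp add: L1 image_mset.compositionality o_def)
    qed
    have Tsplit: "T = K + (Te + T1)"
      by (auto simp: K_def Te_def T1_def intro!: multiset_eqI)
    have distM: "dist i L S = Te + T1" if S: "S \<subseteq> {..<length L}" "card S = a" "\<And>s. s \<in> S \<Longrightarrow> L ! s = M" for S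
    proof -
      have fS: "finite S" using S finite_subset by blast
      have 1: "image_mset (\<lambda>s. (i, L ! s)) (mset_set S) = Te"
      proof -
        have "image_mset (\<lambda>s. (i, L ! s)) (mset_set S) = image_mset (\<lambda>s. (i, M)) (mset_set S)"
          using S fS by (intro image_mset_cong) auto
        then show ?thesis using S by (simp add: Te image_mset_const_eq)
      qed
      have "mset L = image_mset snd (dist i L S)" by (simp add: snd_dist)
      also have "\<dots> = replicate_mset a M + image_mset (\<lambda>s. L ! s) (mset_set ({..<length L} - S))"
        using S 1 by (simp add: dist_split Te image_mset.compositionality o_def)
      finally have "image_mset (\<lambda>s. L ! s) (mset_set ({..<length L} - S)) = mset L1"
        by (simp add: L_def)
      then have "image_mset (Pair (Suc i)) (image_mset (\<lambda>s. L ! s) (mset_set ({..<length L} - S))) = T1"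
        by (simp add: T1)
      then show ?thesis using S 1 by (simp add: dist_split image_mset.compositionality o_def)
    qed
    have Ta: "K + dist i L {..<a} = T"
      using distM[of "{..<a}"] La Tsplit by (simp add: lenL)
    let ?P = "{S. S \<subseteq> {..<length L} \<and> card S = a}"
    \<comment> \<open>A set \<open>S\<close> that picks a letter other than \<open>M\<close> holds
      fewer than \<open>a\<close> copies of \<open>M\<close>, so a copy has been pushed down to row
      \<open>Suc i\<close> and the induction hypothesis applies.\<close>
    have vanish: "F (K + dist i L S) = 0" if S: "S \<in> ?P" "\<not> (\<forall>s\<in>S. L ! s = M)" for S
    proof (rule less.hyps)
      have fS: "finite S" using S finite_subset by blast
      have "{s \<in> S. L ! s = M} \<subset> S" using S by blast
      then have "card {s \<in> S. L ! s = M} < card S" by (rule psubset_card_mono[OF fS])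
      then have "card {s \<in> S. L ! s = M} < a" using S by simp
      moreover have "{s \<in> {..<a}. L ! s = M} = {..<a}" using La by auto
      then have "card {s \<in> {..<a}. L ! s = M} = a" by simp
      moreover have "eweight M (dist i L S) + card {s \<in> S. L ! s = M}
          = eweight M (dist i L {..<a}) + card {s \<in> {..<a}. L ! s = M}"
        using eweight_dist[of S L M i] eweight_dist[of "{..<a}" L M i] S lenL by auto
      ultimately have lt: "eweight M T < eweight M (K + dist i L S)"
        by (subst Ta[symmetric]) simp
      show v: "valid lam (Suc M) (K + dist i L S)"
        by (rule valid_dist[of "{..<a}"]) (use S lenL Ta T in auto)
      show "ecount M (K + dist i L S) = E"
        using T(2) Ta by (metis ecount_add ecount_def snd_dist)
      show "t \<le> eweight M (K + dist i L S)" using lt T by simp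
      obtain w where "K + dist i L S = tab lam w" using valid_obtain_word[OF v] by metis
      then have "eweight M (K + dist i L S) \<le> sum_list lam * length lam" using eweight_tab_le by metis
      then show "sum_list lam * length lam - eweight M (K + dist i L S)
          < sum_list lam * length lam - eweight M T" using lt by simp
    qed
    have finP: "finite ?P" by simp
    have "0 = (\<Sum>S\<in>?P. F (K + dist i L S))"
    proof -
      \<comment> \<open>The length is
        \<open>part_at lam i - \<alpha> i + part_at lam (Suc i)\<close>, which exceeds
        \<open>part_at lam i\<close> by the choice of \<open>i\<close>.\<close>
      have "part_at lam i < length L" using rowsize[of i] i lenL lenL1 by (simp add: a_def Te_def)
      moreover have "valid lam (Suc M) (K + dist i L {..<a})" using Ta T by simp
      moreover have "a \<le> length L" using lenL by simp
      ultimately show ?thesis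
        using F[unfolded good_def, rule_format, OF i(1), of L a K] by simp
    qed
    also have "\<dots> = (\<Sum>S\<in>?P. if \<forall>s\<in>S. L ! s = M then F T else 0)"
      using vanish distM Tsplit by (intro sum.cong) auto
    also have "\<dots> = of_nat (card (?P \<inter> {S. \<forall>s\<in>S. L ! s = M})) * F T"
      by (simp only: sum.If_cases[OF finP] sum_constant) simp
    finally have "of_nat (card (?P \<inter> {S. \<forall>s\<in>S. L ! s = M})) * F T = 0" by simp
    \<comment> \<open>Every surviving term equals \<open>F T\<close>, and \<open>{..<a}\<close>
      supplies at least one, so a positive multiple of \<open>F T\<close> is 0.\<close>
    moreover have "card (?P \<inter> {S. \<forall>s\<in>S. L ! s = M}) \<noteq> 0"
    proof -
      have "{..<a} \<in> ?P \<inter> {S. \<forall>s\<in>S. L ! s = M}" using La lenL by auto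
      moreover have "finite (?P \<inter> {S. \<forall>s\<in>S. L ! s = M})" using finP by blast
      ultimately show ?thesis using card_0_eq[of "?P \<inter> {S. \<forall>s\<in>S. L ! s = M}"] by blast
    qed
    ultimately show ?thesis by simp
  next
    case False
    \<comment> \<open>Now \<open>\<alpha>\<close> interlaces with \<open>lam\<close>, so its nonzero
      values form a partition \<open>nu\<close> and \<open>T\<close> is the strip filling
      \<open>emb\<close> of a word of shape \<open>nu\<close>.\<close>
    then have \<alpha>1: "part_at lam (Suc r) \<le> \<alpha> r" for r
      by (cases "Suc r < length lam") (auto simp: part_at_def not_less[symmetric])
    have \<alpha>2: "\<alpha> r \<le> part_at lam r" for r using rowsize[of r] by simp
    have \<alpha>mono: "\<alpha> s \<le> \<alpha> r" if "r \<le> s" for r s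
      using that
    proof (induction s)
      case (Suc s)
      then show ?case using \<alpha>1[of s] \<alpha>2[of "Suc s"] by (cases "r = Suc s") (auto intro: order_trans)
    qed simp
    have ex: "\<alpha> (length lam) = 0" using \<alpha>2[of "length lam"] by (simp add: part_at_def)
    define k where "k = (LEAST r. \<alpha> r = 0)"
    have k: "\<alpha> k = 0" unfolding k_def by (rule LeastI[of "\<lambda>r. \<alpha> r = 0", OF ex])
    define nu where "nu = map \<alpha> [0..<k]"
    have part: "part_at nu r = \<alpha> r" for r
      using \<alpha>mono[of k r] k by (auto simp: part_at_def nu_def)
    have pnu: "is_partition nu (sum_list nu)"
      unfolding is_partition_def
    proof (intro conjI ballI refl)
      show "sorted_wrt (\<ge>) nu" using \<alpha>mono by (auto simp: nu_def sorted_wrt_iff_nth_less)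
      show "0 < x" if "x \<in> set nu" for x
      proof -
        obtain r where "r < k" "x = \<alpha> r" using \<open>x \<in> set nu\<close> by (auto simp: nu_def)
        then show ?thesis using not_less_Least[of r "\<lambda>r. \<alpha> r = 0"] by (simp add: k_def)
      qed
    qed
    have nuH: "nu \<in> hstrips lam"
      using pnu \<alpha>1 \<alpha>2 by (simp add: hstrips_iff[OF lam] part)
    interpret shape_pair lam nu by (rule hstrip_shape_pair[OF nuH])
    have "tabloid nu (filter_mset (\<lambda>x. snd x \<noteq> M) T)"
      by (simp add: tabloid_def part \<alpha>_def filter_filter_mset conj_commute)
    moreover have "snd ` set_mset (filter_mset (\<lambda>x. snd x \<noteq> M) T) \<subseteq> {..<M}"
      using T(1) by (auto simp: valid_def less_Suc_eq)
    ultimately have "valid nu M (filter_mset (\<lambda>x. snd x \<noteq> M) T)" by (simp add: valid_def)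
    then obtain w where w: "length w = sum_list nu" "set w \<subseteq> {..<M}" "tab nu w = filter_mset (\<lambda>x. snd x \<noteq> M) T"
      by (rule valid_obtain_word)
    have "filter_mset (\<lambda>x. snd x = M) T = strip_tab M"
    proof (rule mset_const_snd_eqI)
      show "size (filter_mset (\<lambda>x. fst x = r) (filter_mset (\<lambda>x. snd x = M) T))
          = size (filter_mset (\<lambda>x. fst x = r) (strip_tab M))" for r
        using rowsize[of r] by (simp add: size_strip_tab_row part filter_filter_mset conj_commute)
    qed (use set_strip_tab[of M] in auto)
    then have "T = filter_mset (\<lambda>x. snd x \<noteq> M) T + strip_tab M"
      using multiset_partition[of T "\<lambda>x. snd x \<noteq> M"] by simp
    then have Teq: "T = tab lam (emb M w)" using tab_emb[OF w(1), of M] w(3) by simp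
    have nM: "M \<notin> snd ` set_mset (tab nu w)" using w set_tab[OF w(1)] by auto
    have "ecount M T = card strip" "eweight M T = strip_weight"
      unfolding Teq tab_emb[OF w(1)]
      by (simp_all add: ecount_0[OF nM] eweight_0[OF nM] ecount_strip_tab eweight_strip_tab)
    then show ?thesis using hyp[OF nuH, of w] w T Teq by (simp add: words_def)
  qed
qed

text \<open>A Garnir relation of \<open>nu\<close> becomes one of \<open>lam\<close> when the strip
  copies of \<open>M\<close> in row \<open>i\<close> are added to \<open>L\<close>. Index sets that
  keep all these copies in row \<open>i\<close> reproduce the relation of \<open>nu\<close>; the
  others push a copy of \<open>M\<close> down, and there \<open>F\<close> vanishes by
  hypothesis.\<close>

lemma good_lift:
  fixes F :: "(nat \<times> nat) multiset \<Rightarrow> 'k::field_char_0"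
  assumes lam: "is_partition lam n" and F: "good lam (Suc M) F" and nu: "nu \<in> hstrips lam"
    and vanish: "\<And>T. valid lam (Suc M) T \<Longrightarrow> ecount M T = card (strip lam nu)
      \<Longrightarrow> strip_weight lam nu < eweight M T \<Longrightarrow> F T = 0"
  shows "good nu M (\<lambda>T. F (T + shape_pair.strip_tab lam nu M))"
  unfolding good_def
proof (intro allI impI)
  interpret shape_pair lam nu by (rule hstrip_shape_pair[OF nu])
  fix i and K :: "(nat \<times> nat) multiset" and L :: "nat list" and p
  let ?l = "length L"
  assume i: "Suc i < length nu" and L: "part_at nu i < ?l" "p \<le> ?l"
    and v: "valid nu M (K + dist i L {..<p})"
  \<comment> \<open>With \<open>d\<close> copies of \<open>M\<close> added, the list is again longer
    than row \<open>i\<close> of \<open>lam\<close>, as a Garnir relation requires.\<close>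
  define d where "d = part_at lam i - part_at nu i"
  define L' where "L' = L @ replicate d M"
  define R where "R = filter_mset (\<lambda>x. fst x \<noteq> i) (strip_tab M)"
  let ?D = "{?l..<?l + d}"
  have len: "length L' = ?l + d" by (simp add: L'_def)
  have L'1: "L' ! s = L ! s" if "s < ?l" for s using that by (simp add: L'_def nth_append)
  have L'2: "L' ! s = M" if "s \<in> ?D" for s using that by (auto simp: L'_def nth_append)
  have Mnot: "M \<notin> set L" "M \<notin> snd ` set_mset K"
    using v by (auto simp: valid_def image_Un set_snd_dist)
  have strip: "strip_tab M = replicate_mset d (i, M) + R"
  proof -
    have "filter_mset (\<lambda>x. fst x = i) (strip_tab M) = replicate_mset d (i, M)"
    proof -
      have "filter_mset (\<lambda>x. fst x = i) (strip_tab M)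
          = replicate_mset (size (filter_mset (\<lambda>x. fst x = i) (strip_tab M))) (i, M)"
        by (rule set_mset_subset_singletonD) (auto simp: strip_tab_def)
      then show ?thesis by (simp add: size_strip_tab_row d_def)
    qed
    then show ?thesis using multiset_partition[of "strip_tab M" "\<lambda>x. fst x = i"] by (simp add: R_def)
  qed
  have dist': "dist i L' (S \<union> ?D) = dist i L S + replicate_mset d (i, M)" if S: "S \<subseteq> {..<?l}" for S
  proof -
    have fS: "finite S" using S finite_subset by blast
    have "mset_set (S \<union> ?D) = mset_set S + mset_set ?D"
      using fS S by (intro mset_set_Union) auto
    moreover have "{..<length L'} - (S \<union> ?D) = {..<?l} - S" using S by (auto simp: len)
    moreover have "image_mset (\<lambda>s. (i, L' ! s)) (mset_set S) = image_mset (\<lambda>s. (i, L ! s)) (mset_set S)"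
      using S fS L'1 by (intro image_mset_cong) auto
    moreover have "image_mset (\<lambda>s. (Suc i, L' ! s)) (mset_set ({..<?l} - S))
        = image_mset (\<lambda>s. (Suc i, L ! s)) (mset_set ({..<?l} - S))"
      using L'1 by (intro image_mset_cong) auto
    moreover have "image_mset (\<lambda>s. (i, L' ! s)) (mset_set ?D) = image_mset (\<lambda>s. (i, M)) (mset_set ?D)"
      using L'2 by (intro image_mset_cong) auto
    moreover have "S \<union> ?D \<subseteq> {..<length L'}" using S by (auto simp: len)
    ultimately show ?thesis using S by (simp add: dist_split image_mset_const_eq)
  qed
  have eq: "K + R + dist i L' (S \<union> ?D) = K + dist i L S + strip_tab M" if "S \<subseteq> {..<?l}" for S
    using dist'[OF that] by (simp add: strip)
  let ?P = "{S. S \<subseteq> {..<?l} \<and> card S = p}"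
  let ?P' = "{S. S \<subseteq> {..<length L'} \<and> card S = p + d}"
  have cardU: "card (S \<union> ?D) = card S + d" if "S \<subseteq> {..<?l}" for S
    using that by (subst card_Un_disjoint) (auto intro: finite_subset)
  let ?S0 = "{..<p} \<union> ?D"
  have S0: "?S0 \<subseteq> {..<length L'}" "card ?S0 = p + d"
    using L(2) cardU[of "{..<p}"] by (auto simp: len)
  have v0: "valid lam (Suc M) (K + R + dist i L' ?S0)"
  proof -
    have "{..<p} \<subseteq> {..<?l}" using L(2) by auto
    from eq[OF this] show ?thesis using valid_add_strip_tab[OF v] by (simp only:)
  qed
  \<comment> \<open>A position of \<open>?D\<close> missing from \<open>S\<close> puts a copy of
    \<open>M\<close> into row \<open>Suc i\<close>, so the weight exceeds that of the strip.\<close>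
  have zero: "F (K + R + dist i L' S) = 0" if S: "S \<in> ?P'" "\<not> ?D \<subseteq> S" for S
  proof (rule vanish)
    have fS: "finite S" using S finite_subset by blast
    show "valid lam (Suc M) (K + R + dist i L' S)"
      by (rule valid_dist[OF S0(1) _ _ v0]) (use S S0 in auto)
    have ew: "eweight M (K + R + dist i L' ?S0) = strip_weight" "ecount M (K + R + dist i L' ?S0) = card strip"
    proof -
      have "{..<p} \<subseteq> {..<?l}" using L(2) by auto
      note e = eq[OF this]
      show "eweight M (K + R + dist i L' ?S0) = strip_weight" "ecount M (K + R + dist i L' ?S0) = card strip"
        unfolding e using Mnot
        by (simp_all add: eweight_strip_tab ecount_strip_tab eweight_0 ecount_0 set_snd_dist)
    qed
    have "ecount M (dist i L' S) = ecount M (dist i L' ?S0)" by (simp add: ecount_def snd_dist del: count_image_mset)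
    then show "ecount M (K + R + dist i L' S) = card strip" using ew by simp
    have Mset: "{s \<in> X. L' ! s = M} = X \<inter> ?D" if "X \<subseteq> {..<length L'}" for X
    proof -
      have "L' ! s \<noteq> M" if "s < ?l" for s using that L'1 Mnot(1) by (metis nth_mem)
      then have "s \<in> {s \<in> X. L' ! s = M} \<longleftrightarrow> s \<in> X \<inter> ?D" for s
        using that L'2[of s] by (cases "s < ?l") (auto simp: len)
      then show ?thesis by blast
    qed
    have "S \<inter> ?D \<subset> ?D" using S by blast
    then have "card (S \<inter> ?D) < d" using psubset_card_mono[of ?D "S \<inter> ?D"] by simp
    moreover have "card (?S0 \<inter> ?D) = d" by (simp add: Int_absorb1)
    moreover have "eweight M (dist i L' S) + card (S \<inter> ?D) = eweight M (dist i L' ?S0) + card (?S0 \<inter> ?D)"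
      using eweight_dist[of S L' M i] eweight_dist[of ?S0 L' M i] S S0 Mset[of S] Mset[of ?S0] by simp
    ultimately show "strip_weight < eweight M (K + R + dist i L' S)" using ew(1) by simp
  qed
  have "0 = (\<Sum>S\<in>?P'. F (K + R + dist i L' S))"
  proof -
    have "part_at lam i < length L'" using L le[of i] by (simp add: len d_def)
    moreover have "Suc i < length lam"
    proof -
      have "length nu \<le> length lam" using nu le part_le_length by (auto simp: hstrips_def)
      then show ?thesis using i by simp
    qed
    moreover have "valid lam (Suc M) (K + R + dist i L' {..<p + d})"
      by (rule valid_dist[OF S0(1) _ _ v0]) (use L S0 in \<open>auto simp: len\<close>)
    moreover have "p + d \<le> length L'" using L by (simp add: len)
    ultimately show ?thesis
      using F[unfolded good_def, rule_format, of i L' "p + d" "K + R"] by simp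
  qed
  also have "\<dots> = (\<Sum>S\<in>(\<lambda>S. S \<union> ?D) ` ?P. F (K + R + dist i L' S))"
  proof (rule sum.mono_neutral_right)
    show "(\<lambda>S. S \<union> ?D) ` ?P \<subseteq> ?P'" using cardU by (auto simp: len)
    show "\<forall>S\<in>?P' - (\<lambda>S. S \<union> ?D) ` ?P. F (K + R + dist i L' S) = 0"
    proof
      fix S assume S: "S \<in> ?P' - (\<lambda>S. S \<union> ?D) ` ?P"
      show "F (K + R + dist i L' S) = 0"
      proof (rule zero)
        show "\<not> ?D \<subseteq> S"
        proof
          assume D: "?D \<subseteq> S"
          have "S = (S - ?D) \<union> ?D" using D by blast
          moreover have "S - ?D \<subseteq> {..<?l}" using S by (auto simp: len)
          moreover have "card (S - ?D) = p" using S D by (simp add: card_Diff_subset)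
          ultimately show False using S by blast
        qed
      qed (use S in blast)
    qed
  qed simp
  also have "\<dots> = (\<Sum>S\<in>?P. F (K + dist i L S + strip_tab M))"
  proof (subst sum.reindex)
    show "inj_on (\<lambda>S. S \<union> ?D) ?P"
    proof (rule inj_onI)
      fix S S' assume "S \<in> ?P" "S' \<in> ?P" "S \<union> ?D = S' \<union> ?D"
      then have "(S \<union> ?D) \<inter> {..<?l} = (S' \<union> ?D) \<inter> {..<?l}" "S \<subseteq> {..<?l}" "S' \<subseteq> {..<?l}" by auto
      then show "S = S'" by (auto simp: Int_Un_distrib2 Int_absorb2)
    qed
  qed (auto simp: eq intro!: sum.cong)
  finally show "(\<Sum>S\<in>?P. F (K + dist i L S + strip_tab M)) = 0" by simp
qed

section \<open>Triangular elimination\<close>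

text \<open>Dual form of the presentation by Garnir relations: a functional that respects them
  factors through the Young symmetrizer, whose matrix is \<open>kern\<close>.\<close>

definition kernel_complete :: "'k::field itself \<Rightarrow> nat \<Rightarrow> nat list \<Rightarrow> bool" where
  "kernel_complete _ m lam \<longleftrightarrow> (\<forall>F :: (nat \<times> nat) multiset \<Rightarrow> 'k. good lam m F \<longrightarrow>
     (\<exists>G. \<forall>w\<in>words (sum_list lam) m. F (tab lam w) = (\<Sum>z\<in>words (sum_list lam) m. G z * kern lam w z)))"

text \<open>Orders the strips by size and then by how low the boxes outside the smaller diagram are.\<close>

definition hrank :: "nat list \<Rightarrow> nat list \<Rightarrow> nat" where
  "hrank lam nu = sum_list nu * Suc (sum_list lam * length lam) + strip_weight lam nu"

lemma strip_weight_le: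
  assumes "nu \<in> hstrips lam"
  shows "strip_weight lam nu \<le> sum_list lam * length lam"
proof -
  interpret shape_pair lam nu by (rule hstrip_shape_pair[OF assms])
  have "strip_weight \<le> (\<Sum>j\<in>strip. length lam)" unfolding strip_weight_def
    by (rule sum_mono) (auto simp: strip_def dest: rowof_less)
  also have "\<dots> \<le> sum_list lam * length lam" using card_strip by simp
  finally show ?thesis .
qed

text \<open>The multiplier in \<open>hrank\<close> exceeds every strip weight, so ranks compare
  lexicographically.\<close>

lemma hrank_le:
  assumes "mu \<in> hstrips lam" "hrank lam nu \<le> hrank lam mu"
  shows "sum_list nu < sum_list mu \<or> sum_list nu = sum_list mu \<and> strip_weight lam nu \<le> strip_weight lam mu"
proof (rule ccontr)
  assume n: "\<not> ?thesis"
  show False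
  proof (cases "sum_list nu = sum_list mu")
    case False
    then have "Suc (sum_list mu) \<le> sum_list nu" using n by linarith
    then have "Suc (sum_list mu) * Suc (sum_list lam * length lam) \<le> sum_list nu * Suc (sum_list lam * length lam)"
      by (rule mult_le_mono1)
    then show False using strip_weight_le[OF assms(1)] assms(2) unfolding hrank_def by simp
  qed (use n assms in \<open>simp add: hrank_def\<close>)
qed

lemma kern_emb_hrank:
  assumes lam: "is_partition lam n" and "nu \<in> hstrips lam" "mu \<in> hstrips lam" "mu \<noteq> nu" "hrank lam nu \<le> hrank lam mu"
    and "w \<in> words (sum_list mu) M" "length z = sum_list nu"
  shows "kern lam (emb lam mu M w) (emb lam nu M z) = (0 :: 'k::field)"
proof (rule ccontr)
  assume ne: "kern lam (emb lam mu M w) (emb lam nu M z) \<noteq> (0 :: 'k)"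
  have w: "M \<notin> set w" "length w = sum_list mu" using assms(6) by (auto simp: words_def)
  show False
    using kern_emb_triangular[OF lam assms(3,2) w assms(7) ne] hrank_le[OF assms(3,5)] assms(4) by auto
qed

text \<open>A functional is determined from its values on the words \<open>emb lam nu M w\<close>; these are corrected one strip at a
  time, from the highest rank down, by functionals \<open>\<Xi> nu z\<close> that vanish on strips of higher rank.\<close>

lemma triangular_elimination:
  fixes F :: "(nat \<times> nat) multiset \<Rightarrow> 'k::field_char_0" and h :: "nat list \<Rightarrow> nat list \<Rightarrow> nat list \<Rightarrow> 'k"
    and \<Xi> :: "nat list \<Rightarrow> nat list \<Rightarrow> nat list \<Rightarrow> 'k"
  assumes lam: "is_partition lam n"
    and complete: "\<And>nu. nu \<in> hstrips lam \<Longrightarrow> kernel_complete TYPE('k) M nu"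
    and \<Xi>: "\<And>nu z w. length w = sum_list lam \<Longrightarrow>
      \<Xi> nu z w = (\<Sum>y\<in>words (sum_list lam) (Suc M). h nu z y * kern lam w y)"
    and rk: "\<And>nu mu. nu \<in> hstrips lam \<Longrightarrow> mu \<in> hstrips lam \<Longrightarrow> sum_list nu = sum_list mu \<Longrightarrow>
      strip_weight lam nu < strip_weight lam mu \<Longrightarrow> rk nu < (rk mu :: nat)"
    and tri: "\<And>nu mu w z. nu \<in> hstrips lam \<Longrightarrow> mu \<in> hstrips lam \<Longrightarrow> mu \<noteq> nu \<Longrightarrow> rk nu \<le> rk mu \<Longrightarrow>
      w \<in> words (sum_list mu) M \<Longrightarrow> z \<in> words (sum_list nu) M \<Longrightarrow> \<Xi> nu z (emb lam mu M w) = 0"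
    and diag: "\<And>nu w z. nu \<in> hstrips lam \<Longrightarrow> w \<in> words (sum_list nu) M \<Longrightarrow> z \<in> words (sum_list nu) M \<Longrightarrow>
      \<Xi> nu z (emb lam nu M w) = q nu * kern nu w z"
    and q: "\<And>nu. nu \<in> hstrips lam \<Longrightarrow> q nu \<noteq> 0"
    and F: "good lam (Suc M) F"
  shows "\<exists>G. \<forall>w\<in>words (sum_list lam) (Suc M).
    F (tab lam w) = (\<Sum>nu\<in>hstrips lam. \<Sum>z\<in>words (sum_list nu) M. G nu z * \<Xi> nu z w)"
proof -
  let ?n = "sum_list lam" and ?H = "hstrips lam"
  note finH = finite_hstrips[OF lam]
  have "\<forall>y. \<exists>f. good lam (Suc M) f \<and> (\<forall>w. length w = ?n \<longrightarrow> kern lam w y = (f (tab lam w) :: 'k))"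
  proof
    fix y
    show "\<exists>f. good lam (Suc M) f \<and> (\<forall>w. length w = ?n \<longrightarrow> kern lam w y = (f (tab lam w) :: 'k))"
      by (rule kern_good[OF lam, of "Suc M" y, where 'k = 'k]) blast
  qed
  then obtain f where f: "\<And>y. good lam (Suc M) (f y)"
    "\<And>y w. length w = ?n \<Longrightarrow> kern lam w y = (f y (tab lam w) :: 'k)" by metis
  define X where "X nu z T = (\<Sum>y\<in>words ?n (Suc M). h nu z y * f y T)" for nu z T
  have X: "\<Xi> nu z w = X nu z (tab lam w)" if "length w = ?n" for nu z w
    using that by (simp add: \<Xi> X_def f)
  have goodX: "good lam (Suc M) (X nu z)" for nu z
    unfolding X_def by (rule good_sum) (simp_all add: f)
  have len: "length (emb lam nu M w) = ?n" if "nu \<in> ?H" for nu w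
    using shape_pair.length_emb[OF hstrip_shape_pair[OF that]] .
  \<comment> \<open>Induction on a threshold \<open>s\<close>, for functionals that vanish on all
    strips of rank at least \<open>s\<close>. At \<open>s = 0\<close> straightening shows the
    functional to be 0; the induction step clears the strips of rank \<open>s\<close>.\<close>
  have main: "\<forall>F. good lam (Suc M) F \<longrightarrow>
    (\<forall>nu\<in>?H. s \<le> rk nu \<longrightarrow> (\<forall>w\<in>words (sum_list nu) M. F (tab lam (emb lam nu M w)) = 0)) \<longrightarrow>
    (\<exists>G. \<forall>w\<in>words ?n (Suc M). F (tab lam w) = (\<Sum>nu\<in>?H. \<Sum>z\<in>words (sum_list nu) M. G nu z * \<Xi> nu z w))" for s
  proof (induction s)
    case 0
    show ?case
    proof (intro allI impI exI ballI)
      fix F :: "(nat \<times> nat) multiset \<Rightarrow> 'k" and w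
      assume F: "good lam (Suc M) F"
        and van: "\<forall>nu\<in>?H. 0 \<le> rk nu \<longrightarrow> (\<forall>w\<in>words (sum_list nu) M. F (tab lam (emb lam nu M w)) = 0)"
        and w: "w \<in> words ?n (Suc M)"
      have "F (tab lam w) = 0"
      proof (rule good_straighten[OF lam F, of "ecount M (tab lam w)" 0])
        show "valid lam (Suc M) (tab lam w)" using w set_tab[of w lam] tabloid_tab[of lam w] by (simp add: valid_def words_def)
      qed (use van in auto)
      then show "F (tab lam w) = (\<Sum>nu\<in>?H. \<Sum>z\<in>words (sum_list nu) M. (\<lambda>_ _. 0) nu z * \<Xi> nu z w)" by simp
    qed
  next
    case (Suc s)
    show ?case
    proof (intro allI impI)
      fix F :: "(nat \<times> nat) multiset \<Rightarrow> 'k"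
      assume F: "good lam (Suc M) F"
        and van: "\<forall>nu\<in>?H. Suc s \<le> rk nu \<longrightarrow> (\<forall>w\<in>words (sum_list nu) M. F (tab lam (emb lam nu M w)) = 0)"
      define R where "R = {nu \<in> ?H. rk nu = s}"
      have "\<exists>G. \<forall>w\<in>words (sum_list nu) M. F (tab lam (emb lam nu M w)) = (\<Sum>z\<in>words (sum_list nu) M. G z * kern nu w z)"
        if nu: "nu \<in> R" for nu
      proof -
        have nuH: "nu \<in> ?H" and rs: "rk nu = s" using nu by (auto simp: R_def)
        interpret shape_pair lam nu by (rule hstrip_shape_pair[OF nuH])
        \<comment> \<open>A tabloid with as many copies of \<open>M\<close>, placed lower,
          straightens to strips of the same size and larger weight. These have larger
          \<open>rk\<close>, and \<open>F\<close> vanishes on them already.\<close>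
        have "good nu M (\<lambda>T. F (T + strip_tab M))"
        proof (rule good_lift[OF lam F nuH])
          fix T assume T: "valid lam (Suc M) T" "ecount M T = card strip" "strip_weight < eweight M T"
          show "F T = 0"
          proof (rule good_straighten[OF lam F _ T(1,2)])
            show "Suc strip_weight \<le> eweight M T" using T by simp
            fix mu w assume mu: "mu \<in> ?H" "w \<in> words (sum_list mu) M" "card (shape_pair.strip lam mu) = card strip"
              "Suc strip_weight \<le> shape_pair.strip_weight lam mu"
            have "sum_list nu = sum_list mu"
              using mu(3) card_strip shape_pair.card_strip[OF hstrip_shape_pair[OF mu(1)]] by linarith
            then have "rk nu < rk mu" using rk[OF nuH mu(1)] mu(4) by simp
            then show "F (tab lam (shape_pair.emb lam mu M w)) = 0" using van mu rs by simp
          qed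
        qed
        then obtain G where G: "\<forall>w\<in>words (sum_list nu) M. F (tab nu w + strip_tab M) = (\<Sum>z\<in>words (sum_list nu) M. G z * kern nu w z)"
          using complete[OF nuH] unfolding kernel_complete_def by blast
        have "F (tab lam (emb M w)) = (\<Sum>z\<in>words (sum_list nu) M. G z * kern nu w z)" if "w \<in> words (sum_list nu) M" for w
          using G that tab_emb[of w M] by (simp add: words_def)
        then show ?thesis by blast
      qed
      then obtain Gs where Gs: "\<And>nu w. nu \<in> R \<Longrightarrow> w \<in> words (sum_list nu) M \<Longrightarrow>
        F (tab lam (emb lam nu M w)) = (\<Sum>z\<in>words (sum_list nu) M. Gs nu z * kern nu w z)" by metis
      define D where "D T = (\<Sum>nu\<in>R. 1 * (\<Sum>z\<in>words (sum_list nu) M. (Gs nu z / q nu) * X nu z T))" for T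
      have finR: "finite R" using finH by (simp add: R_def)
      have goodD: "good lam (Suc M) D"
        unfolding D_def by (intro good_sum finR finite_words goodX)
      \<comment> \<open>Subtracting \<open>D\<close> cancels \<open>F\<close> on the strips of rank
        \<open>s\<close> and, by \<open>tri\<close>, does not disturb the vanishing on higher
        ranks.\<close>
      define F2 where "F2 T = F T + (-1) * D T" for T
      have goodF2: "good lam (Suc M) F2" unfolding F2_def by (rule good_lincomb[OF F goodD])
      have Demb: "D (tab lam (emb lam mu M w)) = (if mu \<in> R then F (tab lam (emb lam mu M w)) else 0)"
        if mu: "mu \<in> ?H" "s \<le> rk mu" and w: "w \<in> words (sum_list mu) M" for mu w
      proof -
        have "(\<Sum>z\<in>words (sum_list nu) M. (Gs nu z / q nu) * X nu z (tab lam (emb lam mu M w)))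
          = (if nu = mu then F (tab lam (emb lam mu M w)) else 0)" if nu: "nu \<in> R" for nu
        proof -
          have nuH: "nu \<in> ?H" "rk nu = s" using nu by (auto simp: R_def)
          have XX: "X nu z (tab lam (emb lam mu M w)) = \<Xi> nu z (emb lam mu M w)" for z
            using X len[OF mu(1)] by simp
          show ?thesis
          proof (cases "nu = mu")
            case True
            have "(\<Sum>z\<in>words (sum_list nu) M. (Gs nu z / q nu) * \<Xi> nu z (emb lam mu M w))
                = (\<Sum>z\<in>words (sum_list nu) M. Gs nu z * kern nu w z)"
              using w True diag[OF nuH(1), of w] q[OF nuH(1)] by (intro sum.cong) auto
            then show ?thesis unfolding XX using Gs[OF nu, of w] w True by simp
          next
            case False
            then show ?thesis using tri[OF nuH(1) mu(1)] w mu(2) nuH(2) by (simp add: XX)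
          qed
        qed
        then have "D (tab lam (emb lam mu M w)) = (\<Sum>nu\<in>R. if nu = mu then F (tab lam (emb lam mu M w)) else 0)"
          unfolding D_def by (intro sum.cong) auto
        then show ?thesis using finR by simp
      qed
      have "\<forall>nu\<in>?H. s \<le> rk nu \<longrightarrow> (\<forall>w\<in>words (sum_list nu) M. F2 (tab lam (emb lam nu M w)) = 0)"
      proof (intro ballI impI)
        fix nu w assume nu: "nu \<in> ?H" "s \<le> rk nu" "w \<in> words (sum_list nu) M"
        show "F2 (tab lam (emb lam nu M w)) = 0"
        proof (cases "nu \<in> R")
          case False
          then have "Suc s \<le> rk nu" using nu by (auto simp: R_def)
          then show ?thesis using van nu Demb[OF nu] False by (simp add: F2_def)
        qed (use Demb[OF nu] in \<open>simp add: F2_def\<close>)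
      qed
      then obtain G2 where G2: "\<And>w. w \<in> words ?n (Suc M) \<Longrightarrow>
          F2 (tab lam w) = (\<Sum>nu\<in>?H. \<Sum>z\<in>words (sum_list nu) M. G2 nu z * \<Xi> nu z w)"
        using Suc.IH goodF2 by blast
      define G where "G nu z = G2 nu z + (if nu \<in> R then Gs nu z / q nu else 0)" for nu z
      have "F (tab lam w) = (\<Sum>nu\<in>?H. \<Sum>z\<in>words (sum_list nu) M. G nu z * \<Xi> nu z w)"
        if w: "w \<in> words ?n (Suc M)" for w
      proof -
        have lw: "length w = ?n" using w by (simp add: words_def)
        have "D (tab lam w) = (\<Sum>nu\<in>R. \<Sum>z\<in>words (sum_list nu) M. Gs nu z / q nu * \<Xi> nu z w)"
          by (simp add: D_def X[OF lw])
        also have "\<dots> = (\<Sum>nu\<in>?H. \<Sum>z\<in>words (sum_list nu) M. (if nu \<in> R then Gs nu z / q nu else 0) * \<Xi> nu z w)"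
          by (rule sum.mono_neutral_cong_left[OF finH]) (auto simp: R_def)
        finally have "F (tab lam w) = F2 (tab lam w)
            + (\<Sum>nu\<in>?H. \<Sum>z\<in>words (sum_list nu) M. (if nu \<in> R then Gs nu z / q nu else 0) * \<Xi> nu z w)"
          by (simp add: F2_def)
        then show ?thesis using G2[OF w]
          by (simp add: G_def sum.distrib[symmetric] distrib_right)
      qed
      then show "\<exists>G. \<forall>w\<in>words ?n (Suc M). F (tab lam w) = (\<Sum>nu\<in>?H. \<Sum>z\<in>words (sum_list nu) M. G nu z * \<Xi> nu z w)"
        by blast
    qed
  qed
  \<comment> \<open>Above the maximal rank the vanishing condition in \<open>main\<close> is empty,
    so \<open>main\<close> covers every good functional.\<close>
  have "\<not> Suc (Max (insert 0 (rk ` ?H))) \<le> rk nu" if "nu \<in> ?H" for nu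
    using that finH by (simp add: not_le less_Suc_eq_le Max_ge)
  then show ?thesis using main[of "Suc (Max (insert 0 (rk ` ?H)))", rule_format, OF F] by blast
qed

lemma kern_Nil: "kern [] [] [] = 1"
proof -
  have "col_group [] = {id}" "row_group [] = {id}"
    by (auto simp: col_group_def row_group_def permutes_empty)
  then show ?thesis by (simp add: kern_def)
qed

text \<open>Induction on the number of letters: the new letter \<open>M\<close> fills a strip, and
  the other letters fill a shape \<open>nu\<close> for which the claim is known. The functionals
  \<open>\<Xi> nu z\<close> are entries \<open>kern lam _ (emb lam nu M z)\<close>, so the
  triangularity is that of \<open>kern\<close>.\<close>

lemma kernel_complete: "is_partition lam n \<Longrightarrow> kernel_complete TYPE('k::field_char_0) m lam"
proof (induction m arbitrary: lam n)
  case 0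
  show ?case
  \<comment> \<open>Without letters only the empty shape has a word, and there \<open>kern\<close>
    is 1.\<close>
  proof (cases "lam = []")
    case True
    have "words 0 0 = {[]}" by (auto simp: words_def)
    then show ?thesis unfolding kernel_complete_def True
      by (auto simp: kern_Nil intro!: exI[of _ "\<lambda>_. F (tab [] [])" for F])
  next
    case False
    then have "sum_list lam \<noteq> 0" using 0 by (cases lam) (auto simp: is_partition_def)
    then have "words (sum_list lam) 0 = {}" by (auto simp: words_def)
    then show ?thesis by (simp add: kernel_complete_def)
  qed
next
  case (Suc M)
  note lam = Suc.prems
  show ?case
    unfolding kernel_complete_def
  proof (intro allI impI)
    fix F :: "(nat \<times> nat) multiset \<Rightarrow> 'k" assume F: "good lam (Suc M) F"
    let ?n = "sum_list lam"
    \<comment> \<open>The indicator writes a single entry of \<open>kern\<close> as the combination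
      of entries that \<open>triangular_elimination\<close> asks for.\<close>
    define \<Xi> :: "nat list \<Rightarrow> nat list \<Rightarrow> nat list \<Rightarrow> 'k" where
      "\<Xi> nu z w = (\<Sum>y\<in>words ?n (Suc M). of_bool (y = emb lam nu M z) * kern lam w y)" for nu z w
    have emb_words: "emb lam nu M z \<in> words ?n (Suc M)"
      if "nu \<in> hstrips lam" "z \<in> words (sum_list nu) M" for nu z
      using shape_pair.set_emb[OF hstrip_shape_pair[OF that(1)], of z M] that
        shape_pair.length_emb[OF hstrip_shape_pair[OF that(1)]]
      by (force simp: words_def)
    have \<Xi>: "\<Xi> nu z w = kern lam w (emb lam nu M z)" if "nu \<in> hstrips lam" "z \<in> words (sum_list nu) M" for nu z w
      using emb_words[OF that] by (simp add: \<Xi>_def if_distrib cong: if_cong)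
    have wM: "M \<notin> set w" "length w = k" if "w \<in> words k M" for w k using that by (auto simp: words_def)
    have "\<exists>G. \<forall>w\<in>words ?n (Suc M).
      F (tab lam w) = (\<Sum>nu\<in>hstrips lam. \<Sum>z\<in>words (sum_list nu) M. G nu z * \<Xi> nu z w)"
    proof (rule triangular_elimination[OF lam, where rk = "hrank lam" and
        q = "\<lambda>nu. of_nat (card (shape_pair.fixers lam nu))" and h = "\<lambda>nu z y. of_bool (y = emb lam nu M z)"])
      show "kernel_complete TYPE('k) M nu" if "nu \<in> hstrips lam" for nu
        using that Suc.IH by (auto simp: hstrips_def)
      show "\<Xi> nu z (emb lam mu M w) = 0"
        if "nu \<in> hstrips lam" "mu \<in> hstrips lam" "mu \<noteq> nu" "hrank lam nu \<le> hrank lam mu"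
          "w \<in> words (sum_list mu) M" "z \<in> words (sum_list nu) M" for nu mu w z
        using kern_emb_hrank[OF lam that(1-5), of z, where 'k = 'k] that \<Xi> wM by simp
      show "\<Xi> nu z (emb lam nu M w) = of_nat (card (shape_pair.fixers lam nu)) * kern nu w z"
        if "nu \<in> hstrips lam" "w \<in> words (sum_list nu) M" "z \<in> words (sum_list nu) M" for nu w z
        using kern_emb_diag[OF lam that(1) wM[OF that(2)] wM(2)[OF that(3)], where 'k = 'k] \<Xi> that by simp
      show "of_nat (card (shape_pair.fixers lam nu)) \<noteq> (0 :: 'k)" if "nu \<in> hstrips lam" for nu
        using shape_pair.fixers_pos[OF hstrip_shape_pair[OF that]] by simp
    qed (use F in \<open>simp_all add: \<Xi>_def hrank_def\<close>)
    then obtain G where G: "\<And>w. w \<in> words ?n (Suc M) \<Longrightarrow>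
      F (tab lam w) = (\<Sum>nu\<in>hstrips lam. \<Sum>z\<in>words (sum_list nu) M. G nu z * \<Xi> nu z w)" by blast
    define G' where "G' y = (\<Sum>nu\<in>hstrips lam. \<Sum>z\<in>words (sum_list nu) M. G nu z * of_bool (y = emb lam nu M z))" for y
    have "F (tab lam w) = (\<Sum>y\<in>words ?n (Suc M). G' y * kern lam w y)" if "w \<in> words ?n (Suc M)" for w
    proof -
      have "F (tab lam w) = (\<Sum>nu\<in>hstrips lam. \<Sum>z\<in>words (sum_list nu) M. \<Sum>y\<in>words ?n (Suc M).
          G nu z * (of_bool (y = emb lam nu M z) * kern lam w y))"
        using G[OF that] unfolding \<Xi>_def sum_distrib_left .
      also have "\<dots> = (\<Sum>y\<in>words ?n (Suc M). \<Sum>nu\<in>hstrips lam. \<Sum>z\<in>words (sum_list nu) M.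
          G nu z * (of_bool (y = emb lam nu M z) * kern lam w y))"
        by (subst sum.swap) (rule sum.swap)
      finally show ?thesis unfolding G'_def sum_distrib_right mult.assoc .
    qed
    then show "\<exists>G. \<forall>w\<in>words ?n (Suc M). F (tab lam w) = (\<Sum>z\<in>words ?n (Suc M). G z * kern lam w z)" by blast
  qed
qed

section \<open>Natural operators on tensors\<close>

definition conv :: "nat \<Rightarrow> ((nat \<Rightarrow> nat) \<Rightarrow> 'k::field) \<Rightarrow> ((nat \<Rightarrow> nat) \<Rightarrow> 'k) \<Rightarrow> (nat \<Rightarrow> nat) \<Rightarrow> 'k" where
  "conv k \<alpha> \<beta> \<sigma> = (\<Sum>\<rho> | \<rho> permutes {..<k}. \<alpha> \<rho> * \<beta> (inv \<rho> \<circ> \<sigma>))"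

interpretation fun_vs: vector_space "\<lambda>(c :: 'k::field) (f :: 'a \<Rightarrow> 'k) x. c * f x"
  by unfold_locales (auto simp: fun_eq_iff algebra_simps)

lemma conv_shift:
  assumes "g permutes {..<k}"
  shows "conv k \<alpha> \<beta> (g \<circ> \<sigma>) = conv k (\<lambda>\<tau>. \<alpha> (g \<circ> \<tau>)) \<beta> \<sigma>"
proof -
  have "bij_betw ((\<circ>) g) {\<rho>. \<rho> permutes {..<k}} {\<rho>. \<rho> permutes {..<k}}"
    using assms permutes_bij[OF assms] permutes_inv[OF assms] permutes_compose by (intro bij_betw_comp_left) auto
  then have "conv k \<alpha> \<beta> (g \<circ> \<sigma>) = (\<Sum>\<rho> | \<rho> permutes {..<k}. \<alpha> (g \<circ> \<rho>) * \<beta> (inv (g \<circ> \<rho>) \<circ> (g \<circ> \<sigma>)))"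
    unfolding conv_def by (rule sum.reindex_bij_betw[symmetric])
  also have "\<dots> = conv k (\<lambda>\<tau>. \<alpha> (g \<circ> \<tau>)) \<beta> \<sigma>"
    unfolding conv_def
  proof (rule sum.cong[OF refl])
    fix \<rho> assume "\<rho> \<in> {\<rho>. \<rho> permutes {..<k}}"
    then have "inv (g \<circ> \<rho>) = inv \<rho> \<circ> inv g" using assms by (simp add: o_inv_distrib permutes_bij)
    then show "\<alpha> (g \<circ> \<rho>) * \<beta> (inv (g \<circ> \<rho>) \<circ> (g \<circ> \<sigma>)) = \<alpha> (g \<circ> \<rho>) * \<beta> (inv \<rho> \<circ> \<sigma>)"
      using permutes_inv_o(2)[OF assms] by (simp add: comp_assoc) (simp add: comp_assoc[symmetric])
  qed
  finally show ?thesis .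
qed

lemma sum_fun_eq: "sum f A = (\<lambda>x. \<Sum>a\<in>A. f a x)"
  by (induction A rule: infinite_finite_induct) (auto simp: fun_eq_iff)

text \<open>Averaging a linear projection onto the left ideal generated by \<open>\<kappa>\<close>, as in Maschke's theorem.\<close>

lemma group_algebra_regular:
  fixes \<kappa> :: "(nat \<Rightarrow> nat) \<Rightarrow> 'k::field_char_0"
  assumes supp: "\<And>\<sigma>. \<not> \<sigma> permutes {..<k} \<Longrightarrow> \<kappa> \<sigma> = 0"
  obtains d where "\<And>\<sigma>. conv k \<kappa> (conv k d \<kappa>) \<sigma> = \<kappa> \<sigma>"
proof -
  let ?S = "{\<sigma>. \<sigma> permutes {..<k}}"
  have finS: "finite ?S" by (simp add: finite_permutations)
  have bijl: "bij_betw ((\<circ>) g) ?S ?S" if "g permutes {..<k}" for g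
    using that permutes_bij[OF that] permutes_inv[OF that] permutes_compose by (intro bij_betw_comp_left) auto
  define V where "V = range (\<lambda>\<alpha>. conv k \<alpha> \<kappa>)"
  have subV: "fun_vs.subspace V"
    unfolding fun_vs.subspace_def
  proof (intro conjI ballI allI)
    show "0 \<in> V" unfolding V_def by (rule image_eqI[of _ _ "\<lambda>_. 0"]) (auto simp: conv_def fun_eq_iff)
  next
    fix x y assume "x \<in> V" "y \<in> V"
    then obtain \<alpha> \<beta> where "x = conv k \<alpha> \<kappa>" "y = conv k \<beta> \<kappa>" by (auto simp: V_def)
    then have "x + y = conv k (\<lambda>\<sigma>. \<alpha> \<sigma> + \<beta> \<sigma>) \<kappa>" by (auto simp: conv_def fun_eq_iff sum.distrib distrib_right)
    then show "x + y \<in> V" by (simp add: V_def)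
  next
    fix c x assume "x \<in> V"
    then obtain \<alpha> where "x = conv k \<alpha> \<kappa>" by (auto simp: V_def)
    then have "(\<lambda>z. c * x z) = conv k (\<lambda>\<sigma>. c * \<alpha> \<sigma>) \<kappa>" by (auto simp: conv_def fun_eq_iff sum_distrib_left mult.assoc)
    then show "(\<lambda>z. c * x z) \<in> V" by (simp add: V_def)
  qed
  interpret pair: vector_space_pair "\<lambda>(c :: 'k) (f :: (nat \<Rightarrow> nat) \<Rightarrow> 'k) x. c * f x" "\<lambda>(c :: 'k) (f :: (nat \<Rightarrow> nat) \<Rightarrow> 'k) x. c * f x" ..
  \<comment> \<open>A mere linear projection onto \<open>V\<close>; it becomes equivariant only
    after averaging.\<close>
  obtain \<pi> where \<pi>: "range \<pi> \<subseteq> V" "Vector_Spaces.linear (\<lambda>(c :: 'k) (f :: (nat \<Rightarrow> nat) \<Rightarrow> 'k) x. c * f x) (\<lambda>c f x. c * f x) \<pi>" "\<And>v. v \<in> V \<Longrightarrow> \<pi> v = v"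
    using pair.linear_exists_left_inverse_on[OF fun_vs.linear_id subV inj_on_id] by auto
  interpret \<pi>: Vector_Spaces.linear "\<lambda>(c :: 'k) (f :: (nat \<Rightarrow> nat) \<Rightarrow> 'k) x. c * f x" "\<lambda>(c :: 'k) (f :: (nat \<Rightarrow> nat) \<Rightarrow> 'k) x. c * f x" \<pi>
    by (rule \<pi>(2))
  \<comment> \<open>The averaged projection applied to the unit: each \<open>g\<close> is projected
    and translated back by \<open>g\<close>. It lies in \<open>V\<close>, hence has the form
    \<open>conv k d \<kappa>\<close>, and by equivariance multiplying \<open>\<kappa>\<close> by it
    gives the projection of \<open>\<kappa>\<close>, which is \<open>\<kappa>\<close>.\<close>
  define e where "e \<sigma> = (1 / of_nat (card ?S)) * (\<Sum>g\<in>?S. \<pi> (\<lambda>\<tau>. of_bool (\<tau> = g)) (g \<circ> \<sigma>))" for \<sigma>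
  have "\<forall>g. \<exists>\<alpha>. \<pi> (\<lambda>\<tau>. of_bool (\<tau> = g)) = conv k \<alpha> \<kappa>" using \<pi>(1) by (auto simp: V_def)
  then obtain a where a: "\<And>g. \<pi> (\<lambda>\<tau>. of_bool (\<tau> = g)) = conv k (a g) \<kappa>" by metis
  define d where "d \<sigma> = (1 / of_nat (card ?S)) * (\<Sum>g\<in>?S. a g (g \<circ> \<sigma>))" for \<sigma>
  have ed: "e = conv k d \<kappa>"
  proof
    fix \<sigma>
    have "e \<sigma> = (1 / of_nat (card ?S)) * (\<Sum>g\<in>?S. conv k (\<lambda>\<tau>. a g (g \<circ> \<tau>)) \<kappa> \<sigma>)"
      unfolding e_def a by (simp add: conv_shift)
    also have "(\<Sum>g\<in>?S. conv k (\<lambda>\<tau>. a g (g \<circ> \<tau>)) \<kappa> \<sigma>) = (\<Sum>\<rho>\<in>?S. (\<Sum>g\<in>?S. a g (g \<circ> \<rho>)) * \<kappa> (inv \<rho> \<circ> \<sigma>))"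
      unfolding conv_def by (subst sum.swap) (simp add: sum_distrib_right)
    finally show "e \<sigma> = conv k d \<kappa> \<sigma>"
      unfolding conv_def d_def by (subst (asm) sum_distrib_left) (simp only: mult.assoc)
  qed
  have "conv k \<kappa> e \<sigma> = \<kappa> \<sigma>" for \<sigma>
  proof -
    define N where "N = (of_nat (card ?S) :: 'k)"
    have "?S \<noteq> {}" using permutes_id by blast
    then have N: "N \<noteq> 0" using finS unfolding N_def of_nat_eq_0_iff card_eq_0_iff by blast
    have shiftV: "(\<lambda>\<tau>. \<kappa> (inv h \<circ> \<tau>)) \<in> V" if h: "h permutes {..<k}" for h
    proof -
      have "conv k (\<lambda>\<rho>. of_bool (\<rho> = h)) \<kappa> \<tau> = \<kappa> (inv h \<circ> \<tau>)" for \<tau>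
      proof -
        have "conv k (\<lambda>\<rho>. of_bool (\<rho> = h)) \<kappa> \<tau> = (\<Sum>\<rho>\<in>?S. if \<rho> = h then \<kappa> (inv \<rho> \<circ> \<tau>) else 0)"
          unfolding conv_def by (rule sum.cong) auto
        then show ?thesis using h by (simp only: sum.delta[OF finS]) simp
      qed
      then have "(\<lambda>\<tau>. \<kappa> (inv h \<circ> \<tau>)) = conv k (\<lambda>\<rho>. of_bool (\<rho> = h)) \<kappa>" by presburger
      then show ?thesis by (simp add: V_def)
    qed
    \<comment> \<open>The sum assembles the translate of \<open>\<kappa>\<close> by \<open>h\<close>
      inside \<open>\<pi>\<close>; this translate lies in \<open>V\<close>, so \<open>\<pi>\<close>
      fixes it, and evaluating at \<open>h \<circ> \<sigma>\<close> undoes the translation.\<close>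
    have sum_eq: "(\<Sum>\<rho>\<in>?S. \<kappa> \<rho> * \<pi> (\<lambda>\<tau>. of_bool (\<tau> = h \<circ> \<rho>)) (h \<circ> \<sigma>)) = \<kappa> \<sigma>"
      if h: "h permutes {..<k}" for h
    proof -
      have "(\<Sum>\<rho>\<in>?S. \<kappa> \<rho> * \<pi> (\<lambda>\<tau>. of_bool (\<tau> = h \<circ> \<rho>)) (h \<circ> \<sigma>))
          = \<pi> (\<Sum>\<rho>\<in>?S. (\<lambda>\<tau>. \<kappa> \<rho> * of_bool (\<tau> = h \<circ> \<rho>))) (h \<circ> \<sigma>)"
        by (simp only: \<pi>.sum \<pi>.scale) (simp only: sum_fun_eq)
      also have "(\<Sum>\<rho>\<in>?S. (\<lambda>\<tau>. \<kappa> \<rho> * of_bool (\<tau> = h \<circ> \<rho>))) = (\<lambda>\<tau>. \<kappa> (inv h \<circ> \<tau>))"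
      proof
        fix \<tau> :: "nat \<Rightarrow> nat"
        have "\<tau> = h \<circ> \<rho> \<longleftrightarrow> \<rho> = inv h \<circ> \<tau>" for \<rho> :: "nat \<Rightarrow> nat"
          using permutes_inv_o[OF h] by (metis comp_assoc id_comp)
        then have "(\<Sum>\<rho>\<in>?S. \<kappa> \<rho> * of_bool (\<tau> = h \<circ> \<rho>)) = (\<Sum>\<rho>\<in>?S. if \<rho> = inv h \<circ> \<tau> then \<kappa> \<rho> else 0)"
          by (intro sum.cong) auto
        also have "\<dots> = (if inv h \<circ> \<tau> \<in> ?S then \<kappa> (inv h \<circ> \<tau>) else 0)" by (rule sum.delta[OF finS])
        finally have "(\<Sum>\<rho>\<in>?S. \<kappa> \<rho> * of_bool (\<tau> = h \<circ> \<rho>)) = (if inv h \<circ> \<tau> \<in> ?S then \<kappa> (inv h \<circ> \<tau>) else 0)" .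
        then show "(\<Sum>\<rho>\<in>?S. (\<lambda>\<tau>. \<kappa> \<rho> * of_bool (\<tau> = h \<circ> \<rho>))) \<tau> = \<kappa> (inv h \<circ> \<tau>)"
          using supp by (auto simp: sum_fun_eq)
      qed
      also have "\<pi> \<dots> (h \<circ> \<sigma>) = \<kappa> (inv h \<circ> (h \<circ> \<sigma>))" by (simp add: \<pi>(3)[OF shiftV[OF h]])
      also have "inv h \<circ> (h \<circ> \<sigma>) = \<sigma>" using permutes_inv_o(2)[OF h] by (simp add: comp_assoc[symmetric])
      finally show ?thesis .
    qed
    have "N * conv k \<kappa> e \<sigma> = (\<Sum>\<rho>\<in>?S. \<Sum>g\<in>?S. \<kappa> \<rho> * \<pi> (\<lambda>\<tau>. of_bool (\<tau> = g)) (g \<circ> (inv \<rho> \<circ> \<sigma>)))"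
      using N by (simp add: conv_def e_def N_def sum_distrib_left mult.assoc)
    also have "\<dots> = (\<Sum>\<rho>\<in>?S. \<Sum>h\<in>?S. \<kappa> \<rho> * \<pi> (\<lambda>\<tau>. of_bool (\<tau> = h \<circ> \<rho>)) (h \<circ> \<sigma>))"
    proof (rule sum.cong[OF refl])
      fix \<rho> assume \<rho>: "\<rho> \<in> ?S"
      have "bij_betw (\<lambda>h. h \<circ> \<rho>) ?S ?S"
        by (rule bij_betw_byWitness[of _ "\<lambda>h. h \<circ> inv \<rho>"])
          (use \<rho> permutes_inv_o[of \<rho> "{..<k}"] in \<open>auto simp: comp_assoc intro: permutes_compose permutes_inv\<close>)
      then have "(\<Sum>g\<in>?S. \<kappa> \<rho> * \<pi> (\<lambda>\<tau>. of_bool (\<tau> = g)) (g \<circ> (inv \<rho> \<circ> \<sigma>)))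
        = (\<Sum>h\<in>?S. \<kappa> \<rho> * \<pi> (\<lambda>\<tau>. of_bool (\<tau> = h \<circ> \<rho>)) (h \<circ> \<rho> \<circ> (inv \<rho> \<circ> \<sigma>)))"
        by (rule sum.reindex_bij_betw[symmetric])
      moreover have "h \<circ> \<rho> \<circ> (inv \<rho> \<circ> \<sigma>) = h \<circ> \<sigma>" for h :: "nat \<Rightarrow> nat"
        using permutes_inv_o(1)[of \<rho> "{..<k}"] \<rho> by (metis comp_assoc comp_id mem_Collect_eq)
      ultimately show "(\<Sum>g\<in>?S. \<kappa> \<rho> * \<pi> (\<lambda>\<tau>. of_bool (\<tau> = g)) (g \<circ> (inv \<rho> \<circ> \<sigma>)))
        = (\<Sum>h\<in>?S. \<kappa> \<rho> * \<pi> (\<lambda>\<tau>. of_bool (\<tau> = h \<circ> \<rho>)) (h \<circ> \<sigma>))" by simp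
    qed
    also have "\<dots> = (\<Sum>h\<in>?S. \<kappa> \<sigma>)"
      by (subst sum.swap) (auto simp: sum_eq intro!: sum.cong)
    also have "\<dots> = N * \<kappa> \<sigma>" by (simp add: N_def)
    finally show ?thesis using N by simp
  qed
  then show ?thesis using that ed by blast
qed

section \<open>Linear maps and natural transformations of tensor powers\<close>

definition lin :: "(('a \<Rightarrow> 'k::field) \<Rightarrow> 'b \<Rightarrow> 'k) \<Rightarrow> bool" where
  "lin T \<longleftrightarrow> (\<forall>x y. T (\<lambda>z. x z + y z) = (\<lambda>z. T x z + T y z)) \<and> (\<forall>c x. T (\<lambda>z. c * x z) = (\<lambda>z. c * T x z))"

lemma lin_add: "lin T \<Longrightarrow> T (\<lambda>z. x z + y z) = (\<lambda>z. T x z + T y z)"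
  unfolding lin_def by blast

lemma lin_scale: "lin T \<Longrightarrow> T (\<lambda>z. c * x z) = (\<lambda>z. c * T x z)"
  unfolding lin_def by blast

lemma lin_zero: "lin T \<Longrightarrow> T (\<lambda>_. 0) = (\<lambda>_. 0)"
proof -
  assume "lin T"
  then have "\<And>c x. T (\<lambda>z. c * x z) = (\<lambda>z. c * T x z)" unfolding lin_def by blast
  from this[of 0 "\<lambda>_. 0"] show ?thesis by simp
qed

lemma lin_sum:
  assumes "lin T" "finite A"
  shows "T (\<lambda>z. \<Sum>a\<in>A. c a * u a z) = (\<lambda>z. \<Sum>a\<in>A. c a * T (u a) z)"
  using assms(2)
proof (induction A)
  case empty
  then show ?case using lin_zero[OF assms(1)] by simp
next
  case (insert a A)
  then have "T (\<lambda>z. \<Sum>a\<in>insert a A. c a * u a z) = T (\<lambda>z. c a * u a z + (\<Sum>a\<in>A. c a * u a z))"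
    by simp
  also have "\<dots> = (\<lambda>z. c a * T (u a) z + (\<Sum>a\<in>A. c a * T (u a) z))"
    using assms(1) insert by (simp add: lin_def)
  finally show ?case using insert by simp
qed

lemma lin_comp: "lin S \<Longrightarrow> lin T \<Longrightarrow> lin (\<lambda>v. S (T v))"
  by (simp add: lin_def)

lemma lin_lincomb:
  assumes "finite A" "\<And>a. a \<in> A \<Longrightarrow> lin (T a)"
  shows "lin (\<lambda>v z. \<Sum>a\<in>A. c a * T a v z)"
  using assms unfolding lin_def
  by (simp add: sum.distrib[symmetric] sum_distrib_left distrib_left mult.left_commute)

text \<open>The linear extension of \<open>h\<close> to functions on the finite set
  \<open>A\<close>. Substituting letters and selecting or permuting slots all have this form, so
  naturality reduces to \<open>pf_comp\<close>.\<close>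

definition pf :: "('a \<Rightarrow> 'b) \<Rightarrow> 'a set \<Rightarrow> ('a \<Rightarrow> 'k::field) \<Rightarrow> 'b \<Rightarrow> 'k" where
  "pf h A v = (\<lambda>y. \<Sum>x | x \<in> A \<and> h x = y. v x)"

lemma lin_pf: "finite A \<Longrightarrow> lin (pf h A)"
  by (simp add: lin_def pf_def sum.distrib sum_distrib_left)

lemma pf_comp:
  assumes "finite A" "finite B" "h ` A \<subseteq> B"
  shows "pf g B (pf h A v) = pf (\<lambda>x. g (h x)) A v"
proof
  fix y
  have "pf g B (pf h A v) y = (\<Sum>b | b \<in> B \<and> g b = y. \<Sum>x | x \<in> {x \<in> A. g (h x) = y} \<and> h x = b. v x)"
    unfolding pf_def by (rule sum.cong[OF refl], rule sum.cong) auto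
  also have "\<dots> = (\<Sum>x | x \<in> A \<and> g (h x) = y. v x)"
    by (rule sum.group) (use assms in auto)
  finally show "pf g B (pf h A v) y = pf (\<lambda>x. g (h x)) A v y" by (simp add: pf_def)
qed

lemma pf_cong: "(\<And>x. x \<in> A \<Longrightarrow> h x = g x) \<Longrightarrow> pf h A v = pf g A v"
  by (auto simp: pf_def fun_eq_iff intro!: sum.cong)

definition sel :: "(nat \<Rightarrow> nat) \<Rightarrow> nat \<Rightarrow> nat list \<Rightarrow> nat list" where
  "sel g k w = map (\<lambda>i. w ! g i) [0..<k]"

lemma length_sel [simp]: "length (sel g k w) = k"
  by (simp add: sel_def)

lemma sel_nth [simp]: "i < k \<Longrightarrow> sel g k w ! i = w ! g i"
  by (simp add: sel_def)

lemma wordsD: "w \<in> words n m \<Longrightarrow> length w = n" "w \<in> words n m \<Longrightarrow> i < n \<Longrightarrow> w ! i < m"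
  by (force simp: words_def)+

lemma wordsI: "length w = n \<Longrightarrow> (\<And>i. i < n \<Longrightarrow> w ! i < m) \<Longrightarrow> w \<in> words n m"
  by (auto simp: words_def in_set_conv_nth)

lemma sel_words: "w \<in> words n m \<Longrightarrow> g ` {..<k} \<subseteq> {..<n} \<Longrightarrow> sel g k w \<in> words k m"
  by (rule wordsI) (auto simp: wordsD image_subset_iff)

lemma permute_words: "w \<in> words n m \<Longrightarrow> \<sigma> permutes {..<n} \<Longrightarrow> permute_list \<sigma> w \<in> words n m"
  by (rule wordsI) (auto simp: wordsD permute_list_nth permutes_lt)

lemma permute_list_eq_sel: "length w = n \<Longrightarrow> permute_list \<sigma> w = sel \<sigma> n w"
  by (simp add: permute_list_def sel_def)

lemma tens_iff: "v \<in> tens n m \<longleftrightarrow> (\<forall>ys. ys \<notin> words n m \<longrightarrow> v ys = 0)"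
  by (auto simp: tens_def words_def)

lemma push_eq_pf: "v \<in> tens n m \<Longrightarrow> push f m m' v = pf (map f) (words n m) v"
proof
  fix ys assume v: "v \<in> tens n m"
  show "push f m m' v ys = pf (map f) (words n m) v ys"
  proof (cases "length ys = n")
    case True
    then show ?thesis by (auto simp: push_def pf_def words_def intro!: sum.cong)
  next
    case False
    then show ?thesis using v by (auto simp: push_def pf_def words_def tens_iff intro!: sum.neutral)
  qed
qed

lemma pf_tens:
  assumes "h ` words n m \<subseteq> words k m'"
  shows "pf h (words n m) v \<in> tens k m'"
  unfolding tens_iff pf_def using assms by (auto intro!: sum.neutral)

lemma map_words: "fa_map f m m' \<Longrightarrow> map f ` words n m \<subseteq> words n m'"
  by (fastforce simp: fa_map_def words_def)

lemma push_tens: "fa_map f m m' \<Longrightarrow> v \<in> tens n m \<Longrightarrow> push f m m' v \<in> tens n m'"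
  by (simp add: push_eq_pf pf_tens map_words)

definition natural :: "nat \<Rightarrow> nat \<Rightarrow> (nat \<Rightarrow> 'k::field tensor \<Rightarrow> 'k tensor) \<Rightarrow> bool" where
  "natural n k T \<longleftrightarrow> (\<forall>m. lin (T m)) \<and> (\<forall>m. \<forall>v\<in>tens n m. T m v \<in> tens k m) \<and>
     (\<forall>m m' f. \<forall>v\<in>tens n m. fa_map f m m' \<longrightarrow> push f m m' (T m v) = T m' (push f m m' v))"

lemma natural_comp: "natural n k T \<Longrightarrow> natural k l S \<Longrightarrow> natural n l (\<lambda>m v. S m (T m v))"
  by (auto simp: natural_def intro: lin_comp)

lemma tens_lincomb: "(\<And>a. a \<in> A \<Longrightarrow> u a \<in> tens n m) \<Longrightarrow> (\<lambda>z. \<Sum>a\<in>A. c a * u a z) \<in> tens n m"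
  by (auto simp: tens_iff)

lemma natural_lincomb:
  fixes T :: "'b \<Rightarrow> nat \<Rightarrow> 'k::field tensor \<Rightarrow> 'k tensor"
  assumes "finite A" "\<And>a. a \<in> A \<Longrightarrow> natural n k (T a)"
  shows "natural n k (\<lambda>m v z. \<Sum>a\<in>A. c a * T a m v z)"
  unfolding natural_def
proof (intro conjI allI ballI impI)
  show "lin (\<lambda>v z. \<Sum>a\<in>A. c a * T a m v z)" for m
    using assms by (intro lin_lincomb) (auto simp: natural_def)
  show t: "(\<lambda>z. \<Sum>a\<in>A. c a * T a m v z) \<in> tens k m" if "v \<in> tens n m" for m v
    using assms that by (intro tens_lincomb) (auto simp: natural_def)
  fix m m' f and v :: "'k tensor" assume v: "v \<in> tens n m" and f: "fa_map f m m'"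
  have Ta: "T a m v \<in> tens k m" "push f m m' (T a m v) = T a m' (push f m m' v)" if "a \<in> A" for a
    using assms(2)[OF that] v f by (auto simp: natural_def)
  have "push f m m' (\<lambda>z. \<Sum>a\<in>A. c a * T a m v z) = pf (map f) (words k m) (\<lambda>z. \<Sum>a\<in>A. c a * T a m v z)"
    by (rule push_eq_pf[OF t[OF v]])
  also have "\<dots> = (\<lambda>z. \<Sum>a\<in>A. c a * pf (map f) (words k m) (T a m v) z)"
    by (rule lin_sum[OF lin_pf assms(1)]) simp
  also have "\<dots> = (\<lambda>z. \<Sum>a\<in>A. c a * T a m' (push f m m' v) z)"
    using Ta push_eq_pf[OF Ta(1)] by (intro ext sum.cong) auto
  finally show "push f m m' (\<lambda>z. \<Sum>a\<in>A. c a * T a m v z) = (\<lambda>z. \<Sum>a\<in>A. c a * T a m' (push f m m' v) z)" .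
qed

text \<open>By the Yoneda lemma these maps, for all \<open>g\<close> from \<open>k\<close> slots to
  \<open>n\<close> slots, form a basis of the natural transformations between the two tensor powers
  of P.\<close>

definition pull :: "(nat \<Rightarrow> nat) \<Rightarrow> nat \<Rightarrow> nat \<Rightarrow> nat \<Rightarrow> 'k::field tensor \<Rightarrow> 'k tensor" where
  "pull g n k m = pf (sel g k) (words n m)"

lemma natural_pull:
  assumes g: "g ` {..<k} \<subseteq> {..<n}"
  shows "natural n k (pull g n k :: nat \<Rightarrow> 'k::field tensor \<Rightarrow> 'k tensor)"
  unfolding natural_def
proof (intro conjI allI ballI impI)
  show "lin (pull g n k m)" for m by (simp add: pull_def lin_pf)
  have sub: "sel g k ` words n m \<subseteq> words k m" for m using g by (auto intro: sel_words)
  show t: "pull g n k m v \<in> tens k m" for m and v :: "'k tensor" unfolding pull_def by (rule pf_tens[OF sub])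
  fix m m' f and v :: "'k tensor" assume v: "v \<in> tens n m" and f: "fa_map f m m'"
  have "push f m m' (pull g n k m v) = pf (map f) (words k m) (pf (sel g k) (words n m) v)"
    using push_eq_pf[OF t] by (simp add: pull_def)
  also have "\<dots> = pf (\<lambda>w. map f (sel g k w)) (words n m) v" by (rule pf_comp) (use sub in auto)
  also have "\<dots> = pf (\<lambda>w. sel g k (map f w)) (words n m) v"
    using g by (intro pf_cong) (auto simp: sel_def wordsD image_subset_iff)
  also have "\<dots> = pf (sel g k) (words n m') (pf (map f) (words n m) v)"
    by (rule pf_comp[symmetric]) (use map_words[OF f] in auto)
  finally show "push f m m' (pull g n k m v) = pull g n k m' (push f m m' v)"
    using push_eq_pf[OF v] by (simp add: pull_def)
qed

lemma natural_cong:
  assumes "natural n k T" "\<And>m. lin (S m)" "\<And>m v. v \<in> tens n m \<Longrightarrow> S m v = T m v"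
  shows "natural n k S"
  using assms push_tens unfolding natural_def by metis

lemma rperm_eq_pull:
  assumes "\<sigma> permutes {..<n}" "v \<in> tens n m"
  shows "rperm v \<sigma> = pull \<sigma> n n m v"
proof
  fix ys
  have inv: "inv \<sigma> permutes {..<n}" using assms permutes_inv by blast
  show "rperm v \<sigma> ys = pull \<sigma> n n m v ys"
  proof (cases "ys \<in> words n m")
    case True
    have "{w. w \<in> words n m \<and> sel \<sigma> n w = ys} = {permute_list (inv \<sigma>) ys}"
    proof (intro set_eqI iffI)
      fix w assume w: "w \<in> {w. w \<in> words n m \<and> sel \<sigma> n w = ys}"
      then have "permute_list (inv \<sigma>) ys = w"
        using permute_list_eq_iff[of \<sigma> ys w] assms(1) wordsD(1)[OF True]
        by (auto simp: permute_list_eq_sel wordsD)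
      then show "w \<in> {permute_list (inv \<sigma>) ys}" by simp
    next
      fix w assume "w \<in> {permute_list (inv \<sigma>) ys}"
      then have w: "permute_list (inv \<sigma>) ys = w" by simp
      then have "ys = permute_list \<sigma> w \<and> length w = length ys"
        using permute_list_eq_iff[of \<sigma> ys w] assms(1) wordsD(1)[OF True] by simp
      then show "w \<in> {w. w \<in> words n m \<and> sel \<sigma> n w = ys}"
        using permute_words[OF True inv] w wordsD(1)[OF True] permute_list_eq_sel[of w n \<sigma>] by auto
    qed
    then show ?thesis by (simp add: rperm_def pull_def pf_def)
  next
    case False
    have "permute_list (inv \<sigma>) ys \<notin> words n m"
    proof
      assume p: "permute_list (inv \<sigma>) ys \<in> words n m"
      then have l: "length ys = n" using wordsD(1) by fastforce
      then have "permute_list \<sigma> (permute_list (inv \<sigma>) ys) = ys"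
        using assms(1) permute_list_compose[of \<sigma> ys "inv \<sigma>"] by (simp add: permutes_inv_o)
      then show False using permute_words[OF p assms(1)] False by simp
    qed
    moreover have "sel \<sigma> n w \<noteq> ys" if "w \<in> words n m" for w
      using permute_words[OF that assms(1)] permute_list_eq_sel[of w n \<sigma>] wordsD(1)[OF that] False by auto
    ultimately show ?thesis using assms(2) by (auto simp: rperm_def pull_def pf_def tens_iff intro!: sum.neutral)
  qed
qed

lemma lin_rperm: "lin (\<lambda>v. rperm v \<sigma>)"
  by (simp add: lin_def rperm_def)

lemma natural_rperm: "\<sigma> permutes {..<n} \<Longrightarrow> natural n n (\<lambda>m v. rperm v \<sigma>)"
  by (rule natural_cong[OF natural_pull[of \<sigma> n n]])
    (auto simp: lin_rperm rperm_eq_pull permutes_lt)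

definition gact :: "nat \<Rightarrow> ((nat \<Rightarrow> nat) \<Rightarrow> 'k::field) \<Rightarrow> 'k tensor \<Rightarrow> 'k tensor" where
  "gact k d v = (\<lambda>z. \<Sum>\<sigma> | \<sigma> permutes {..<k}. d \<sigma> * rperm v \<sigma> z)"

lemma natural_gact: "natural k k (\<lambda>m. gact k d)"
  unfolding gact_def[abs_def]
  by (rule natural_lincomb) (auto simp: finite_permutations natural_rperm)

text \<open>The factor \<open>1\<close> brings the inner sum into the form of
  \<open>natural_lincomb\<close>.\<close>

lemma young_sym_eq: "young_sym lam v = (\<lambda>z. \<Sum>\<tau>\<in>col_group lam. of_int (sign \<tau>) *
    (\<lambda>y. \<Sum>\<rho>\<in>row_group lam. 1 * rperm (rperm v \<rho>) \<tau> y) z)"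
  by (simp add: young_sym_def Let_def rperm_def)

lemma natural_young_sym: "natural (sum_list lam) (sum_list lam) (\<lambda>m. young_sym lam)"
proof -
  have "natural (sum_list lam) (sum_list lam) (\<lambda>m v z. \<Sum>\<tau>\<in>col_group lam. of_int (sign \<tau>) *
    (\<lambda>v y. \<Sum>\<rho>\<in>row_group lam. 1 * rperm (rperm v \<rho>) \<tau> y) v z)"
    by (rule natural_lincomb[OF finite_col_group natural_lincomb[OF finite_row_group natural_comp]])
      (rule natural_rperm[OF row_group_permutes] natural_rperm[OF col_group_permutes], assumption)+
  then show ?thesis unfolding young_sym_eq[abs_def] .
qed

lemma lin_young_sym: "lin (young_sym lam :: 'k::field tensor \<Rightarrow> 'k tensor)"
  using natural_young_sym[of lam, where 'a = 'k] by (simp add: natural_def)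

section \<open>A basis adapted to the reduced functor\<close>

text \<open>\<open>bt M w\<close> is the tensor product of the vectors \<open>[a] - [M]\<close> for letters \<open>a \<noteq> M\<close> and of \<open>[M]\<close> for the letter \<open>M\<close>;
  for words without \<open>M\<close> these form a basis of the tensor power of the reduced functor.\<close>

definition bv :: "nat \<Rightarrow> nat \<Rightarrow> nat \<Rightarrow> 'k::field" where
  "bv M a y = of_bool (y = a) - of_bool (a \<noteq> M \<and> y = M)"

definition bt :: "nat \<Rightarrow> nat list \<Rightarrow> 'k::field tensor" where
  "bt M w ys = (if length ys = length w then \<Prod>i<length w. bv M (w ! i) (ys ! i) else 0)"

lemma words_Suc_bij: "bij_betw (\<lambda>(w, b). w @ [b]) (words n m \<times> {..<m}) (words (Suc n) m)"
proof (rule bij_betw_byWitness[of _ "\<lambda>w. (butlast w, last w)"])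
  show "(\<lambda>w. (butlast w, last w)) ` words (Suc n) m \<subseteq> words n m \<times> {..<m}"
  proof clarsimp
    fix w assume w: "w \<in> words (Suc n) m"
    then obtain v b where "w = v @ [b]" by (cases w rule: rev_cases) (auto simp: words_def)
    then show "butlast w \<in> words n m \<and> last w < m" using w by (auto simp: words_def)
  qed
qed (auto simp: words_def intro!: append_butlast_last_id)

text \<open>Distributivity over words. It turns a change of basis in each slot into a change of
  basis of the tensor power.\<close>

lemma words_prod_sum:
  fixes f :: "nat \<Rightarrow> nat \<Rightarrow> 'k::comm_semiring_1"
  shows "(\<Sum>w\<in>words n m. \<Prod>i<n. f i (w ! i)) = (\<Prod>i<n. \<Sum>b<m. f i b)"
proof (induction n)
  case 0
  have "words 0 m = {[]}" by (auto simp: words_def)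
  then show ?case by simp
next
  case (Suc n)
  have "(\<Sum>w\<in>words (Suc n) m. \<Prod>i<Suc n. f i (w ! i))
      = (\<Sum>(w, b)\<in>words n m \<times> {..<m}. \<Prod>i<Suc n. f i ((w @ [b]) ! i))"
    using sum.reindex_bij_betw[OF words_Suc_bij, of "\<lambda>w. \<Prod>i<Suc n. f i (w ! i)" n m]
    by (simp add: case_prod_beta)
  also have "\<dots> = (\<Sum>(w, b)\<in>words n m \<times> {..<m}. (\<Prod>i<n. f i (w ! i)) * f n b)"
  proof (rule sum.cong[OF refl], clarify)
    fix w b assume w: "w \<in> words n m"
    have "(\<Prod>i<n. f i ((w @ [b]) ! i)) = (\<Prod>i<n. f i (w ! i))"
      using wordsD(1)[OF w] by (intro prod.cong) (auto simp: nth_append)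
    then show "(\<Prod>i<Suc n. f i ((w @ [b]) ! i)) = (\<Prod>i<n. f i (w ! i)) * f n b"
      using wordsD(1)[OF w] by (simp add: nth_append)
  qed
  also have "\<dots> = (\<Sum>w\<in>words n m. \<Prod>i<n. f i (w ! i)) * (\<Sum>b<m. f n b)"
    by (simp add: sum_product sum.cartesian_product)
  finally show ?case by (simp add: Suc.IH)
qed

lemma bt_nonzero: "bt M w ys \<noteq> (0 :: 'a::field) \<Longrightarrow> length ys = length w \<and> (\<forall>i<length w. ys ! i = w ! i \<or> ys ! i = M)"
proof -
  assume "bt M w ys \<noteq> (0 :: 'a)"
  then have l: "length ys = length w" and ne: "\<forall>i\<in>{..<length w}. bv M (w ! i) (ys ! i) \<noteq> (0 :: 'a)"
    by (auto simp: bt_def split: if_splits)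
  have "ys ! i = w ! i \<or> ys ! i = M" if "i < length w" for i
    using ne[rule_format, of i] that by (auto simp: bv_def)
  then show ?thesis using l by blast
qed

lemma bt_tens: "w \<in> words n (Suc M) \<Longrightarrow> bt M w \<in> tens n (Suc M)"
  unfolding tens_iff
proof (intro allI impI, rule ccontr)
  fix ys assume w: "w \<in> words n (Suc M)" and ys: "ys \<notin> words n (Suc M)" and "bt M w ys \<noteq> 0"
  then have "length ys = n" "\<forall>i<n. ys ! i = w ! i \<or> ys ! i = M" using bt_nonzero[of M w ys] wordsD(1)[OF w] by auto
  then have "ys \<in> words n (Suc M)" using wordsD(2)[OF w] by (intro wordsI) auto
  then show False using ys by simp
qed

lemma words_mono: "m \<le> m' \<Longrightarrow> words n m \<subseteq> words n m'"
  by (auto simp: words_def)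

text \<open>Of the two terms of \<open>[a] - [M]\<close> only the first is seen by a word free of
  \<open>M\<close>; so evaluation at such words reads off coefficients.\<close>

lemma bt_eval: "z \<in> words n M \<Longrightarrow> length w = n \<Longrightarrow> bt M w z = of_bool (z = w)"
proof -
  assume z: "z \<in> words n M" and w: "length w = n"
  have "bt M w z = (\<Prod>i<n. of_bool (z ! i = w ! i))"
    unfolding bt_def using z w by (auto simp: bv_def wordsD intro!: prod.cong dest: wordsD(2))
  also have "\<dots> = of_bool (\<forall>i<n. z ! i = w ! i)"
    by (cases "\<forall>i<n. z ! i = w ! i") (auto intro!: prod_zero)
  finally show ?thesis using wordsD(1)[OF z] w by (simp add: list_eq_iff_nth_eq)
qed

lemma rperm_bt:
  assumes \<sigma>: "\<sigma> permutes {..<n}" and w: "length w = n"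
  shows "rperm (bt M w) \<sigma> = (bt M (permute_list \<sigma> w) :: 'k::field tensor)"
proof
  fix ys
  show "rperm (bt M w) \<sigma> ys = (bt M (permute_list \<sigma> w) ys :: 'k)"
  proof (cases "length ys = n")
    case True
    have "bt M (permute_list \<sigma> w) ys = (\<Prod>i<n. bv M (w ! \<sigma> i) (ys ! i) :: 'k)"
      using True w \<sigma> by (simp add: bt_def permute_list_nth)
    also have "\<dots> = (\<Prod>i<n. bv M (w ! \<sigma> i) (ys ! inv \<sigma> (\<sigma> i)))"
      using permutes_inverses(2)[OF \<sigma>] by simp
    also have "\<dots> = (\<Prod>i<n. bv M (w ! i) (ys ! inv \<sigma> i))"
      using prod.reindex_bij_betw[OF permutes_imp_bij[OF \<sigma>], of "\<lambda>i. bv M (w ! i) (ys ! inv \<sigma> i)"] by simp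
    also have "\<dots> = rperm (bt M w) \<sigma> ys"
      using True w permutes_inv[OF \<sigma>] by (simp add: rperm_def bt_def permute_list_nth)
    finally show ?thesis by simp
  qed (simp add: rperm_def bt_def w)
qed

lemma tens_span_bt:
  fixes v :: "'k::field tensor"
  assumes "v \<in> tens n (Suc M)"
  obtains c where "v = (\<lambda>x. \<Sum>w\<in>words n (Suc M). c w * bt M w x)"
proof -
  \<comment> \<open>The inverse change of basis in one slot: \<open>[a]\<close> is
    \<open>[a] - [M]\<close> plus \<open>[M]\<close>.\<close>
  define e :: "nat \<Rightarrow> nat \<Rightarrow> 'k" where "e a b = of_bool (b = a) + of_bool (a \<noteq> M \<and> b = M)" for a b
  have e: "(\<Sum>b<Suc M. e a b * bv M b y) = of_bool (y = a)" if "a < Suc M" for a y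
  proof (cases "a = M")
    case True
    then show ?thesis by (simp add: e_def bv_def of_bool_def if_distrib[of "\<lambda>x. x * _"] cong: if_cong)
  next
    case False
    then have "(\<Sum>b<Suc M. e a b * bv M b y) = (\<Sum>b<Suc M. of_bool (b = a) * bv M b y) + (\<Sum>b<Suc M. of_bool (b = M) * bv M b y)"
      by (simp add: e_def distrib_right sum.distrib)
    also have "\<dots> = bv M a y + bv M M y"
      using that by (simp only: of_bool_def if_distrib[of "\<lambda>x. x * _"] mult_1_left mult_zero_left) simp
    finally show ?thesis using False by (auto simp: bv_def)
  qed
  have delta: "delta z = (\<lambda>x. \<Sum>w\<in>words n (Suc M). (\<Prod>i<n. e (z ! i) (w ! i)) * bt M w x)"
    if z: "z \<in> words n (Suc M)" for z
  proof
    fix x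
    show "delta z x = (\<Sum>w\<in>words n (Suc M). (\<Prod>i<n. e (z ! i) (w ! i)) * bt M w x)"
    proof (cases "length x = n")
      case True
      have "(\<Sum>w\<in>words n (Suc M). (\<Prod>i<n. e (z ! i) (w ! i)) * bt M w x)
          = (\<Sum>w\<in>words n (Suc M). \<Prod>i<n. e (z ! i) (w ! i) * bv M (w ! i) (x ! i))"
        using True by (intro sum.cong) (auto simp: bt_def wordsD prod.distrib)
      also have "\<dots> = (\<Prod>i<n. \<Sum>b<Suc M. e (z ! i) b * bv M b (x ! i))" by (rule words_prod_sum)
      also have "\<dots> = (\<Prod>i<n. of_bool (x ! i = z ! i))"
        using wordsD(2)[OF z] by (intro prod.cong) (auto simp del: sum.lessThan_Suc simp: e)
      also have "\<dots> = of_bool (\<forall>i<n. x ! i = z ! i)"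
        by (cases "\<forall>i<n. x ! i = z ! i") (auto intro!: prod_zero)
      also have "\<dots> = delta z x" using True wordsD(1)[OF z] by (simp add: delta_def list_eq_iff_nth_eq)
      finally show ?thesis by simp
    next
      case False
      then show ?thesis using wordsD(1)[OF z] by (auto simp: delta_def bt_def wordsD)
    qed
  qed
  define c where "c w = (\<Sum>z\<in>words n (Suc M). v z * (\<Prod>i<n. e (z ! i) (w ! i)))" for w
  have "v x = (\<Sum>w\<in>words n (Suc M). c w * bt M w x)" for x
  proof -
    have "v x = (\<Sum>z\<in>words n (Suc M). v z * delta z x)"
      using assms by (cases "x \<in> words n (Suc M)") (auto simp: delta_def of_bool_def tens_iff if_distrib[of "\<lambda>x. _ * x"] cong: if_cong intro!: sum.neutral[symmetric])
    also have "\<dots> = (\<Sum>z\<in>words n (Suc M). \<Sum>w\<in>words n (Suc M). v z * (\<Prod>i<n. e (z ! i) (w ! i)) * bt M w x)"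
      by (intro sum.cong refl) (simp only: delta sum_distrib_left mult.assoc)
    also have "\<dots> = (\<Sum>w\<in>words n (Suc M). c w * bt M w x)"
      unfolding c_def sum_distrib_right by (rule sum.swap)
    finally show ?thesis .
  qed
  then show ?thesis using that by blast
qed

text \<open>Place permutations move the factors of \<open>bt\<close> in the same way as letters, so
  \<open>kern\<close> is also the matrix of the Young symmetrizer in the adapted basis.\<close>

lemma young_sym_bt:
  fixes m M :: nat
  assumes w: "w \<in> words (sum_list lam) m"
  shows "young_sym lam (bt M w) = (\<lambda>x. \<Sum>y\<in>words (sum_list lam) m. kern lam w y * bt M y x :: 'k::field)"
proof
  fix x
  have lw: "length w = sum_list lam" using wordsD(1)[OF w] .
  have eq: "rperm (rperm (bt M w) \<rho>) \<tau> = (bt M (permute_list \<tau> (permute_list \<rho> w)) :: 'k tensor)"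
    and mem: "permute_list \<tau> (permute_list \<rho> w) \<in> words (sum_list lam) m"
    if "\<rho> \<in> row_group lam" "\<tau> \<in> col_group lam" for \<rho> \<tau>
    using rperm_bt[OF row_group_permutes[OF that(1)] lw, where 'k = 'k]
      rperm_bt[OF col_group_permutes[OF that(2)], of "permute_list \<rho> w", where 'k = 'k]
      permute_words[OF permute_words[OF w row_group_permutes[OF that(1)]] col_group_permutes[OF that(2)]] lw by simp_all
  have "young_sym lam (bt M w) x = (\<Sum>\<tau>\<in>col_group lam. \<Sum>\<rho>\<in>row_group lam.
      of_int (sign \<tau>) * bt M (permute_list \<tau> (permute_list \<rho> w)) x :: 'k)"
    unfolding young_sym_eq using eq by (simp add: sum_distrib_left)
  also have "\<dots> = (\<Sum>\<tau>\<in>col_group lam. \<Sum>\<rho>\<in>row_group lam. \<Sum>y\<in>words (sum_list lam) m.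
      of_int (sign \<tau>) * of_bool (permute_list \<tau> (permute_list \<rho> w) = y) * bt M y x)"
    using mem by (intro sum.cong refl)
      (simp add: of_bool_def if_distrib[of "\<lambda>x. x * _"] if_distrib[of "\<lambda>x. _ * x"] cong: if_cong)
  also have "\<dots> = (\<Sum>\<tau>\<in>col_group lam. \<Sum>y\<in>words (sum_list lam) m. \<Sum>\<rho>\<in>row_group lam.
      of_int (sign \<tau>) * of_bool (permute_list \<tau> (permute_list \<rho> w) = y) * bt M y x)"
    by (intro sum.cong refl sum.swap)
  also have "\<dots> = (\<Sum>y\<in>words (sum_list lam) m. kern lam w y * bt M y x)"
    unfolding kern_def sum_distrib_right by (rule sum.swap)
  finally show "young_sym lam (bt M w) x = (\<Sum>y\<in>words (sum_list lam) m. kern lam w y * bt M y x :: 'k)" .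
qed

lemma rperm_rperm:
  assumes "\<sigma> permutes {..<k}" "\<tau> permutes {..<k}" "\<And>z. length z \<noteq> k \<Longrightarrow> v z = 0"
  shows "rperm (rperm v \<sigma>) \<tau> = rperm v (\<sigma> \<circ> \<tau>)"
proof
  fix z
  show "rperm (rperm v \<sigma>) \<tau> z = rperm v (\<sigma> \<circ> \<tau>) z"
  proof (cases "length z = k")
    case True
    have "inv (\<sigma> \<circ> \<tau>) = inv \<tau> \<circ> inv \<sigma>" using assms by (simp add: o_inv_distrib permutes_bij)
    then show ?thesis using True permutes_inv[OF assms(1)]
      by (simp add: rperm_def permute_list_compose)
  qed (simp add: rperm_def assms(3))
qed

lemma gact_gact:
  assumes v: "\<And>z. length z \<noteq> k \<Longrightarrow> v z = 0"
  shows "gact k \<beta> (gact k \<alpha> v) = gact k (conv k \<alpha> \<beta>) v"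
proof
  fix z
  let ?S = "{\<sigma>. \<sigma> permutes {..<k}}"
  have "gact k \<beta> (gact k \<alpha> v) z = (\<Sum>\<tau>\<in>?S. \<Sum>\<sigma>\<in>?S. \<alpha> \<sigma> * \<beta> \<tau> * rperm (rperm v \<sigma>) \<tau> z)"
    by (simp add: gact_def rperm_def sum_distrib_left mult_ac)
  also have "\<dots> = (\<Sum>\<sigma>\<in>?S. \<Sum>\<tau>\<in>?S. \<alpha> \<sigma> * \<beta> \<tau> * rperm v (\<sigma> \<circ> \<tau>) z)"
    using rperm_rperm[of _ k _ v] v by (subst sum.swap) (intro sum.cong, auto)
  also have "\<dots> = (\<Sum>\<sigma>\<in>?S. \<Sum>\<tau>\<in>?S. \<alpha> \<sigma> * \<beta> (inv \<sigma> \<circ> \<tau>) * rperm v \<tau> z)"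
  proof (rule sum.cong[OF refl])
    fix \<sigma> assume \<sigma>: "\<sigma> \<in> ?S"
    have "bij_betw ((\<circ>) \<sigma>) ?S ?S"
      using \<sigma> permutes_bij permutes_inv permutes_compose by (intro bij_betw_comp_left) auto
    then have "(\<Sum>\<tau>\<in>?S. \<alpha> \<sigma> * \<beta> (inv \<sigma> \<circ> \<tau>) * rperm v \<tau> z)
        = (\<Sum>\<tau>\<in>?S. \<alpha> \<sigma> * \<beta> (inv \<sigma> \<circ> (\<sigma> \<circ> \<tau>)) * rperm v (\<sigma> \<circ> \<tau>) z)"
      by (rule sum.reindex_bij_betw[symmetric])
    then show "(\<Sum>\<tau>\<in>?S. \<alpha> \<sigma> * \<beta> \<tau> * rperm v (\<sigma> \<circ> \<tau>) z) = (\<Sum>\<tau>\<in>?S. \<alpha> \<sigma> * \<beta> (inv \<sigma> \<circ> \<tau>) * rperm v \<tau> z)"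
      using \<sigma> permutes_inv_o(2)[of \<sigma> "{..<k}"] by (simp add: comp_assoc[symmetric])
  qed
  also have "\<dots> = gact k (conv k \<alpha> \<beta>) v z"
    by (subst sum.swap) (simp add: gact_def conv_def sum_distrib_right)
  finally show "gact k \<beta> (gact k \<alpha> v) z = gact k (conv k \<alpha> \<beta>) v z" .
qed

text \<open>This is c d c = c for the Young symmetrizer c, whose coefficient function is
  \<open>\<kappa>\<close>; so \<open>d\<close> followed by c is the identity on the image of
  c.\<close>

lemma young_sym_regular:
  "\<exists>d :: (nat \<Rightarrow> nat) \<Rightarrow> 'k::field_char_0. \<forall>v. (\<forall>z. length z \<noteq> sum_list nu \<longrightarrow> v z = 0) \<longrightarrow>
      young_sym nu (gact (sum_list nu) d (young_sym nu v)) = young_sym nu v"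
proof -
  let ?k = "sum_list nu" and ?S = "{\<sigma>. \<sigma> permutes {..<sum_list nu}}"
  define \<kappa> :: "(nat \<Rightarrow> nat) \<Rightarrow> 'k" where
    "\<kappa> \<pi> = (\<Sum>\<tau>\<in>col_group nu. \<Sum>\<rho>\<in>row_group nu. of_int (sign \<tau>) * of_bool (\<rho> \<circ> \<tau> = \<pi>))" for \<pi>
  have comp: "\<rho> \<circ> \<tau> permutes {..<?k}" if "\<rho> \<in> row_group nu" "\<tau> \<in> col_group nu" for \<rho> \<tau>
    using row_group_permutes[OF that(1)] col_group_permutes[OF that(2)] permutes_compose by blast
  have supp: "\<kappa> \<sigma> = 0" if "\<not> \<sigma> permutes {..<?k}" for \<sigma>
  proof -
    have "\<rho> \<circ> \<tau> \<noteq> \<sigma>" if "\<rho> \<in> row_group nu" "\<tau> \<in> col_group nu" for \<rho> \<tau>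
      using comp[OF that] \<open>\<not> \<sigma> permutes {..<?k}\<close> by auto
    then show ?thesis unfolding \<kappa>_def by (intro sum.neutral ballI) simp
  qed
  have ys: "young_sym nu v = gact ?k \<kappa> v" if v: "\<And>z. length z \<noteq> ?k \<Longrightarrow> v z = 0" for v
  proof
    fix z
    have "young_sym nu v z = (\<Sum>\<tau>\<in>col_group nu. \<Sum>\<rho>\<in>row_group nu. of_int (sign \<tau>) * rperm v (\<rho> \<circ> \<tau>) z)"
      unfolding young_sym_eq using rperm_rperm[of _ ?k _ v] v row_group_permutes col_group_permutes
      by (simp add: sum_distrib_left)
    also have "\<dots> = (\<Sum>\<tau>\<in>col_group nu. \<Sum>\<rho>\<in>row_group nu. \<Sum>\<pi>\<in>?S. of_int (sign \<tau>) * of_bool (\<rho> \<circ> \<tau> = \<pi>) * rperm v \<pi> z)"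
      using comp by (intro sum.cong refl)
        (simp add: of_bool_def if_distrib[of "\<lambda>x. x * _"] if_distrib[of "\<lambda>x. _ * x"] finite_permutations cong: if_cong)
    also have "\<dots> = (\<Sum>\<tau>\<in>col_group nu. \<Sum>\<pi>\<in>?S. \<Sum>\<rho>\<in>row_group nu. of_int (sign \<tau>) * of_bool (\<rho> \<circ> \<tau> = \<pi>) * rperm v \<pi> z)"
      by (intro sum.cong refl sum.swap)
    also have "\<dots> = gact ?k \<kappa> v z"
      unfolding gact_def \<kappa>_def sum_distrib_right by (rule sum.swap)
    finally show "young_sym nu v z = gact ?k \<kappa> v z" .
  qed
  obtain d where d: "\<And>\<sigma>. conv ?k \<kappa> (conv ?k d \<kappa>) \<sigma> = \<kappa> \<sigma>" using group_algebra_regular[of ?k \<kappa>] supp by metis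
  show ?thesis
  proof (intro exI[of _ d] allI impI)
    fix v :: "'k tensor" assume "\<forall>z. length z \<noteq> ?k \<longrightarrow> v z = 0"
    then have v: "\<And>z. length z \<noteq> ?k \<Longrightarrow> v z = 0" by blast
    have g: "gact ?k \<alpha> v' z = 0" if "\<And>z. length z \<noteq> ?k \<Longrightarrow> v' z = 0" "length z \<noteq> ?k" for \<alpha> v' z
      using that by (simp add: gact_def rperm_def)
    have yv: "young_sym nu v = gact ?k \<kappa> v" by (rule ys) (rule v)
    have h: "gact ?k \<kappa> v z = 0" "gact ?k d (gact ?k \<kappa> v) z = 0" if "length z \<noteq> ?k" for z
      using g[OF v that] g[OF g[OF v] that] by simp_all
    have "young_sym nu (gact ?k d (young_sym nu v)) = gact ?k \<kappa> (gact ?k d (gact ?k \<kappa> v))"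
      unfolding yv by (rule ys) (rule h(2))
    also have "\<dots> = gact ?k (conv ?k d \<kappa>) (gact ?k \<kappa> v)" by (rule gact_gact) (rule h(1))
    also have "\<dots> = gact ?k (conv ?k \<kappa> (conv ?k d \<kappa>)) v" by (rule gact_gact) (rule v)
    also have "conv ?k \<kappa> (conv ?k d \<kappa>) = \<kappa>" using d by blast
    finally show "young_sym nu (gact ?k d (young_sym nu v)) = young_sym nu v" using v by (simp add: ys)
  qed
qed

text \<open>A slot outside the image of \<open>g\<close> is summed over all letters. There
  \<open>bt\<close> carries \<open>[a] - [M]\<close>, whose coordinate sum is 0.\<close>

lemma pull_bt_zero:
  assumes w: "w \<in> words n (Suc M)" and l: "l < n" "l \<notin> g ` {..<k}" "w ! l \<noteq> M"
  shows "pull g n k (Suc M) (bt M w) = (\<lambda>_. 0 :: 'k::field)"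
proof
  fix y
  let ?A = "{x \<in> words n (Suc M). sel g k x = y}"
  let ?Z = "{x \<in> ?A. x ! l = 0}"
  have upd: "sel g k (x[l := b]) = sel g k x" for x b
    using l(2) by (auto simp: sel_def intro!: nth_list_update_neq)
  have updw: "x[l := b] \<in> words n (Suc M)" if "x \<in> words n (Suc M)" "b < Suc M" for x b
    using that l(1) by (intro wordsI) (auto simp: wordsD nth_list_update)
  \<comment> \<open>The letter in slot \<open>l\<close> does not affect \<open>sel g k\<close>, so
    the fibre is a product: words with 0 in slot \<open>l\<close> are representatives, and
    \<open>b\<close> runs over all letters for that slot.\<close>
  have "(\<Sum>x\<in>?A. bt M w x) = (\<Sum>(x, b)\<in>?Z \<times> {..<Suc M}. (bt M w (x[l := b]) :: 'k))"
  proof (rule sum.reindex_bij_witness[of _ "\<lambda>(x, b). x[l := b]" "\<lambda>x. (x[l := 0], x ! l)"])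
    have id0: "x[l := 0] = x" if "x ! l = 0" for x :: "nat list" using that by (metis list_update_id)
    fix a assume "a \<in> ?Z \<times> {..<Suc M}"
    then obtain x b where a: "a = (x, b)" "x \<in> words n (Suc M)" "sel g k x = y" "x ! l = 0" "b < Suc M" by auto
    have lx: "l < length x" using a l(1) by (simp add: wordsD)
    show "(\<lambda>x. (x[l := 0], x ! l)) (case a of (x, b) \<Rightarrow> x[l := b]) = a"
      using a lx id0 by simp
    have "x[l := b] \<in> ?A" using updw[OF a(2,5)] upd[of x b] a(3) by simp
    then show "(case a of (x, b) \<Rightarrow> x[l := b]) \<in> ?A" by (simp add: a(1))
  next
    fix a assume "a \<in> ?A"
    then have a: "a \<in> words n (Suc M)" "sel g k a = y" by auto
    have la: "l < length a" using a l(1) by (simp add: wordsD)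
    show "(case (a[l := 0], a ! l) of (x, b) \<Rightarrow> x[l := b]) = a" by simp
    show "(a[l := 0], a ! l) \<in> ?Z \<times> {..<Suc M}"
      using a updw upd la wordsD(2)[OF a(1) l(1)] by simp
    show "(case (a[l := 0], a ! l) of (x, b) \<Rightarrow> bt M w (x[l := b])) = (bt M w a :: 'k)" by simp
  qed
  also have "\<dots> = (\<Sum>x\<in>?Z. \<Sum>b<Suc M. bt M w (x[l := b]))"
    by (rule sum.cartesian_product[symmetric])
  also have "\<dots> = 0"
  proof (rule sum.neutral, rule ballI)
    fix x assume x: "x \<in> ?Z"
    have lx: "length x = n" "length w = n" using x w by (auto simp: wordsD)
    have "bt M w (x[l := b]) = (\<Prod>i\<in>{..<n} - {l}. bv M (w ! i) (x ! i)) * (bv M (w ! l) b :: 'k)" for b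
    proof -
      have "bt M w (x[l := b]) = (\<Prod>i\<in>insert l ({..<n} - {l}). bv M (w ! i) (x[l := b] ! i))"
        using l(1) lx by (simp add: bt_def insert_absorb)
      also have "\<dots> = bv M (w ! l) b * (\<Prod>i\<in>{..<n} - {l}. bv M (w ! i) (x[l := b] ! i))"
        using l(1) lx by (subst prod.insert) auto
      also have "(\<Prod>i\<in>{..<n} - {l}. bv M (w ! i) (x[l := b] ! i)) = (\<Prod>i\<in>{..<n} - {l}. bv M (w ! i) (x ! i))"
        by (rule prod.cong) auto
      finally show ?thesis by (simp add: mult.commute)
    qed
    moreover have "(\<Sum>b<Suc M. bv M (w ! l) b) = (0 :: 'k)"
    proof -
      have "w ! l < M" using wordsD(2)[OF w l(1)] l(3) by simp
      then show ?thesis using l(3) by (simp add: bv_def sum_subtractf of_bool_def)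
    qed
    ultimately show "(\<Sum>b<Suc M. bt M w (x[l := b])) = (0 :: 'k)"
      by (simp only: sum_distrib_left[symmetric] mult_zero_right)
  qed
  finally show "pull g n k (Suc M) (bt M w) y = (0 :: 'k)" by (simp add: pull_def pf_def)
qed

context shape_pair begin

lemma emb_words: "z \<in> words (sum_list nu) m \<Longrightarrow> M < m \<Longrightarrow> emb M z \<in> words (sum_list lam) m"
  by (rule wordsI) (auto simp: emb_nth bk wordsD)

lemma sel_emb: "length z = sum_list nu \<Longrightarrow> sel inc (sum_list nu) (emb M z) = z"
  by (rule nth_equalityI) (auto simp: emb_inc)

lemma inc_range: "inc ` {..<sum_list nu} \<subseteq> {..<sum_list lam}"
  by (auto simp: inc)

text \<open>On the strip \<open>emb\<close> carries the vector \<open>[M]\<close> with coordinate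
  sum 1, so forgetting these slots just removes them.\<close>

lemma pull_bt_emb:
  assumes z: "z \<in> words (sum_list nu) (Suc M)"
  shows "pull inc (sum_list lam) (sum_list nu) (Suc M) (bt M (emb M z)) = (bt M z :: 'k::field tensor)"
proof
  fix y
  let ?n = "sum_list lam" and ?k = "sum_list nu"
  show "pull inc ?n ?k (Suc M) (bt M (emb M z)) y = (bt M z y :: 'k)"
  proof (cases "y \<in> words ?k (Suc M)")
    case False
    then have "{x \<in> words ?n (Suc M). sel inc ?k x = y} = {}" using sel_words inc_range by blast
    then show ?thesis using False bt_tens[OF z, where 'a = 'k] by (simp add: pull_def pf_def tens_iff del: Collect_empty_eq)
  next
    case True
    let ?A = "{x \<in> words ?n (Suc M). sel inc ?k x = y}"
    have ey: "emb M y \<in> ?A" using True emb_words sel_emb by (simp add: wordsD)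
    have "bt M (emb M z) x = (0 :: 'k)" if x: "x \<in> ?A - {emb M y}" for x
    proof (rule ccontr)
      assume ne: "bt M (emb M z) x \<noteq> (0 :: 'k)"
      have lx: "length x = ?n" using x by (auto simp: wordsD)
      have "x = emb M y"
      proof (rule nth_equalityI)
        fix j assume "j < length x"
        then have j: "j < ?n" using lx by simp
        from j show "x ! j = emb M y ! j"
        proof (cases rule: inc_cases)
          case (1 i)
          then show ?thesis using x emb_inc[of i M y] by auto
        next
          case 2
          then show ?thesis using bt_nonzero[OF ne] j emb_strip[OF 2(1), of M z] emb_strip[OF 2(1), of M y] by auto
        qed
      qed (simp add: lx)
      then show False using x by simp
    qed
    then have "(\<Sum>x\<in>?A. bt M (emb M z) x) = (\<Sum>x\<in>{emb M y}. bt M (emb M z) x :: 'k)"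
      using ey by (intro sum.mono_neutral_right) auto
    also have "\<dots> = (\<Prod>j<?n. bv M (emb M z ! j) (emb M y ! j))" by (simp add: bt_def)
    also have "\<dots> = (\<Prod>j\<in>inc ` {..<?k}. bv M (emb M z ! j) (emb M y ! j))"
      by (rule prod.mono_neutral_right) (use inc_range in \<open>auto simp: inc_image emb_strip bv_def\<close>)
    also have "\<dots> = (\<Prod>i<?k. bv M (z ! i) (y ! i))"
      by (simp add: prod.reindex[OF inc_inj] emb_inc)
    also have "\<dots> = bt M z y" using True z by (simp add: bt_def wordsD)
    finally show ?thesis by (simp add: pull_def pf_def)
  qed
qed

text \<open>Forgetting the strip kills every \<open>bt M y\<close> with a letter other than
  \<open>M\<close> on the strip. What is left are the entries of \<open>kern\<close> whose second
  word is a strip filling.\<close>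

lemma pull_young_sym_bt:
  assumes w: "w \<in> words (sum_list lam) (Suc M)"
  shows "pull inc (sum_list lam) (sum_list nu) (Suc M) (young_sym lam (bt M w))
    = (\<lambda>x. \<Sum>z\<in>words (sum_list nu) (Suc M). kern lam w (emb M z) * (bt M z x :: 'k::field))"
proof -
  let ?n = "sum_list lam" and ?k = "sum_list nu"
  have lin: "lin (pull inc ?n ?k (Suc M) :: 'k tensor \<Rightarrow> 'k tensor)" by (simp add: pull_def lin_pf)
  have "pull inc ?n ?k (Suc M) (young_sym lam (bt M w))
      = (\<lambda>x. \<Sum>y\<in>words ?n (Suc M). kern lam w y * (pull inc ?n ?k (Suc M) (bt M y) x :: 'k))"
    unfolding young_sym_bt[OF w] by (rule lin_sum[OF lin]) simp
  also have "\<dots> = (\<lambda>x. \<Sum>z\<in>words ?k (Suc M). kern lam w (emb M z) * (bt M z x :: 'k))"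
  proof
    fix x
    have inj: "inj_on (emb M) (words ?k (Suc M))"
      by (rule inj_onI, rule emb_inject) (auto simp: wordsD)
    have "(\<Sum>y\<in>words ?n (Suc M). kern lam w y * (pull inc ?n ?k (Suc M) (bt M y) x :: 'k))
      = (\<Sum>y\<in>emb M ` words ?k (Suc M). kern lam w y * (pull inc ?n ?k (Suc M) (bt M y) x :: 'k))"
    proof (rule sum.mono_neutral_right)
      show "\<forall>y\<in>words ?n (Suc M) - emb M ` words ?k (Suc M). kern lam w y * (pull inc ?n ?k (Suc M) (bt M y) x :: 'k) = 0"
      proof
        fix y assume y: "y \<in> words ?n (Suc M) - emb M ` words ?k (Suc M)"
        have "\<exists>j\<in>strip. y ! j \<noteq> M"
        proof (rule ccontr)
          assume a: "\<not> ?thesis"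
          have "y = emb M (sel inc ?k y)"
          proof (rule nth_equalityI)
            fix j assume "j < length y"
            moreover have "length y = ?n" using y by (blast dest: wordsD(1))
            ultimately have "j < ?n" by simp
            then show "y ! j = emb M (sel inc ?k y) ! j"
              by (cases rule: inc_cases) (use a in \<open>auto simp: emb_inc emb_strip\<close>)
          qed (use y in \<open>auto dest: wordsD(1)\<close>)
          moreover have "sel inc ?k y \<in> words ?k (Suc M)" using y inc_range by (intro sel_words) auto
          ultimately show False using y by blast
        qed
        then obtain j where "j \<in> strip" "y ! j \<noteq> M" by blast
        moreover have "j < ?n" "j \<notin> inc ` {..<?k}" using calculation by (auto simp: inc_image strip_def)
        ultimately show "kern lam w y * (pull inc ?n ?k (Suc M) (bt M y) x :: 'k) = 0"
          using y by (simp add: pull_bt_zero)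
      qed
    qed (use emb_words in auto)
    also have "\<dots> = (\<Sum>z\<in>words ?k (Suc M). kern lam w (emb M z) * (bt M z x :: 'k))"
      by (simp add: sum.reindex[OF inj] pull_bt_emb)
    finally show "(\<Sum>y\<in>words ?n (Suc M). kern lam w y * (pull inc ?n ?k (Suc M) (bt M y) x :: 'k))
      = (\<Sum>z\<in>words ?k (Suc M). kern lam w (emb M z) * (bt M z x :: 'k))" .
  qed
  finally show ?thesis .
qed

end

section \<open>Retractions onto Schur functors of the reduced functor\<close>

text \<open>In \<open>fspan\<close> the sum runs over a set of vectors, so the coefficients of
  indices with equal \<open>u i\<close> are added up.\<close>

lemma fspan_lincomb:
  assumes "finite I" "\<And>i. i \<in> I \<Longrightarrow> u i \<in> S"
  shows "(\<lambda>x. \<Sum>i\<in>I. c i * u i x) \<in> fspan S"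
proof -
  have "(\<lambda>x. \<Sum>i\<in>I. c i * u i x) = (\<lambda>x. \<Sum>a\<in>u ` I. (\<Sum>i | i \<in> I \<and> u i = a. c i) * a x)"
  proof
    fix x
    have "(\<Sum>i\<in>I. c i * u i x) = (\<Sum>a\<in>u ` I. \<Sum>i | i \<in> I \<and> u i = a. c i * u i x)"
      by (rule sum.group[symmetric]) (use assms in auto)
    also have "\<dots> = (\<Sum>a\<in>u ` I. (\<Sum>i | i \<in> I \<and> u i = a. c i) * a x)"
      unfolding sum_distrib_right by (intro sum.cong refl) auto
    finally show "(\<Sum>i\<in>I. c i * u i x) = (\<Sum>a\<in>u ` I. (\<Sum>i | i \<in> I \<and> u i = a. c i) * a x)" .
  qed
  then show ?thesis unfolding fspan_def using assms by (auto intro!: exI[of _ "u ` I"])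
qed

lemma fspan_subset:
  assumes "S \<subseteq> W" "\<And>A c. finite A \<Longrightarrow> A \<subseteq> W \<Longrightarrow> (\<lambda>x. \<Sum>a\<in>A. c a * a x) \<in> W"
  shows "fspan S \<subseteq> W"
  using assms unfolding fspan_def by blast

lemma ptensor_tens:
  assumes "length vs = n" "set vs \<subseteq> tens 1 m"
  shows "ptensor vs \<in> tens n m"
  unfolding tens_iff
proof (intro allI impI, rule ccontr)
  fix ys assume ys: "ys \<notin> words n m" and ne: "ptensor vs ys \<noteq> 0"
  then have l: "length ys = n" and nz: "\<forall>i\<in>{..<n}. (vs ! i) [ys ! i] \<noteq> 0"
    using assms(1) by (auto simp: ptensor_def split: if_splits)
  have "ys ! i < m" if "i < n" for i
  proof -
    have "vs ! i \<in> tens 1 m" using assms that by auto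
    then show ?thesis using nz[rule_format, of i] that by (auto simp: tens_def)
  qed
  then show False using ys l by (auto intro: wordsI)
qed

lemma tpow_PFA: "tpow PFA n m = (tens n m :: 'k::field tensor set)"
proof
  show "tpow PFA n m \<subseteq> (tens n m :: 'k tensor set)"
    unfolding tpow_def
  proof (rule fspan_subset)
    show "{ptensor vs |vs. length vs = n \<and> set vs \<subseteq> PFA m} \<subseteq> (tens n m :: 'k tensor set)"
      unfolding PFA_def using ptensor_tens by blast
  qed (rule tens_lincomb, auto)
  show "(tens n m :: 'k tensor set) \<subseteq> tpow PFA n m"
  proof
    fix v :: "'k tensor" assume v: "v \<in> tens n m"
    have d: "delta w = (ptensor (map (\<lambda>a. delta [a]) w) :: 'k tensor)" for w :: "nat list"
    proof
      fix z show "delta w z = (ptensor (map (\<lambda>a. delta [a]) w) z :: 'k)"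
      proof (cases "length z = length w")
        case True
        then have "ptensor (map (\<lambda>a. delta [a]) w) z = (\<Prod>i<length w. of_bool (z ! i = w ! i) :: 'k)"
          by (simp add: ptensor_def delta_def)
        also have "\<dots> = of_bool (\<forall>i<length w. z ! i = w ! i)"
          by (cases "\<forall>i<length w. z ! i = w ! i") (auto intro!: prod_zero)
        finally show ?thesis using True by (simp add: delta_def list_eq_iff_nth_eq)
      qed (auto simp: ptensor_def delta_def)
    qed
    have "v = (\<lambda>x. \<Sum>w\<in>words n m. v w * ptensor (map (\<lambda>a. delta [a]) w) x)"
    proof
      fix x
      have "(\<Sum>w\<in>words n m. v w * ptensor (map (\<lambda>a. delta [a]) w) x) = (\<Sum>w\<in>words n m. if w = x then v w else 0)"
        unfolding d[symmetric] by (rule sum.cong) (auto simp: delta_def)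
      then show "v x = (\<Sum>w\<in>words n m. v w * ptensor (map (\<lambda>a. delta [a]) w) x)"
        using v by (simp add: tens_iff)
    qed
    also have "\<dots> \<in> tpow PFA n m"
      unfolding tpow_def
    proof (rule fspan_lincomb[OF finite_words])
      fix w assume w: "w \<in> words n m"
      have "length (map (\<lambda>a. delta [a]) w) = n" using w by (simp add: words_def)
      moreover have "set (map (\<lambda>a. delta [a]) w) \<subseteq> (PFA m :: 'k tensor set)"
        using w by (auto simp: words_def PFA_def tens_def delta_def)
      ultimately show "ptensor (map (\<lambda>a. delta [a]) w) \<in> {ptensor vs | vs. length vs = n \<and> set vs \<subseteq> (PFA m :: 'k tensor set)}"
        by blast
    qed
    finally show "v \<in> tpow PFA n m" .
  qed
qed

lemma tpow_Pbar_tens: "tpow Pbar k m \<subseteq> (tens k m :: 'k::field tensor set)"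
  unfolding tpow_def
proof (rule fspan_subset)
  show "{ptensor vs |vs. length vs = k \<and> set vs \<subseteq> Pbar m} \<subseteq> (tens k m :: 'k tensor set)"
    unfolding Pbar_def using ptensor_tens by blast
qed (rule tens_lincomb, auto)

definition bspan :: "nat \<Rightarrow> nat \<Rightarrow> 'k::field tensor set" where
  "bspan k M = range (\<lambda>c x. \<Sum>w\<in>words k M. c w * bt M w x)"

lemma bspanI:
  assumes "v = (\<lambda>x. \<Sum>w\<in>words k M. c w * bt M w x)"
  shows "v \<in> bspan k M"
  unfolding bspan_def by (rule image_eqI[where x = c]) (rule assms, rule UNIV_I)

lemma bspan_lincomb:
  assumes "finite A" "\<And>a. a \<in> A \<Longrightarrow> u a \<in> bspan k M"
  shows "(\<lambda>x. \<Sum>a\<in>A. c a * u a x) \<in> bspan k M"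
proof -
  have "\<forall>a\<in>A. \<exists>g. u a = (\<lambda>x. \<Sum>w\<in>words k M. g w * bt M w x)" using assms(2) by (auto simp: bspan_def)
  then obtain g where g: "\<And>a. a \<in> A \<Longrightarrow> u a = (\<lambda>x. \<Sum>w\<in>words k M. g a w * bt M w x)" by metis
  have "(\<Sum>a\<in>A. c a * u a x) = (\<Sum>w\<in>words k M. (\<Sum>a\<in>A. c a * g a w) * bt M w x)" for x
  proof -
    have "(\<Sum>a\<in>A. c a * u a x) = (\<Sum>a\<in>A. \<Sum>w\<in>words k M. c a * g a w * bt M w x)"
      by (rule sum.cong[OF refl]) (simp add: g sum_distrib_left mult.assoc)
    also have "\<dots> = (\<Sum>w\<in>words k M. (\<Sum>a\<in>A. c a * g a w) * bt M w x)"
      unfolding sum_distrib_right by (rule sum.swap)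
    finally show ?thesis .
  qed
  then have "(\<lambda>x. \<Sum>a\<in>A. c a * u a x) = (\<lambda>x. \<Sum>w\<in>words k M. (\<Sum>a\<in>A. c a * g a w) * bt M w x)" by blast
  then show ?thesis by (rule bspanI)
qed

lemma bt_bspan: "w \<in> words k M \<Longrightarrow> bt M w \<in> bspan k M"
proof -
  assume w: "w \<in> words k M"
  have "bt M w = (\<lambda>x. \<Sum>v\<in>words k M. of_bool (v = w) * bt M v x)"
  proof
    fix x
    have "(\<Sum>v\<in>words k M. of_bool (v = w) * bt M v x) = (\<Sum>v\<in>words k M. if v = w then bt M v x else 0)"
      by (rule sum.cong) auto
    then show "bt M w x = (\<Sum>v\<in>words k M. of_bool (v = w) * bt M v x)" using w by simp
  qed
  then show ?thesis by (rule bspanI)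
qed

lemma bspan_rperm:
  assumes "v \<in> bspan k M" "\<sigma> permutes {..<k}"
  shows "rperm v \<sigma> \<in> bspan k M"
proof -
  obtain c where v: "v = (\<lambda>x. \<Sum>w\<in>words k M. c w * bt M w x)" using assms(1) by (auto simp: bspan_def)
  have "rperm v \<sigma> = (\<lambda>x. \<Sum>w\<in>words k M. c w * rperm (bt M w) \<sigma> x)"
    unfolding v by (rule lin_sum[OF lin_rperm]) simp
  also have "\<dots> \<in> bspan k M"
    by (rule bspan_lincomb) (simp_all add: rperm_bt[OF assms(2)] wordsD bt_bspan permute_words assms(2))
  finally show ?thesis .
qed

lemma bspan_gact: "v \<in> bspan k M \<Longrightarrow> gact k d v \<in> bspan k M"
  unfolding gact_def by (rule bspan_lincomb) (auto simp: finite_permutations bspan_rperm)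

lemma bspan_young_sym: "v \<in> bspan (sum_list lam) M \<Longrightarrow> young_sym lam v \<in> bspan (sum_list lam) M"
  unfolding young_sym_eq
  by (intro bspan_lincomb finite_col_group finite_row_group bspan_rperm row_group_permutes col_group_permutes)

lemma sum_bv: "a < M \<Longrightarrow> (\<Sum>b<Suc M. bv M a b) = (0 :: 'k::field)"
  by (simp add: bv_def sum_subtractf of_bool_def)

text \<open>A vector of coordinate sum 0 is the combination of the \<open>[a] - [M]\<close> with its
  own coefficients at the letters below \<open>M\<close>; the coefficient at \<open>M\<close> is
  then forced.\<close>

lemma tpow_Pbar_eq_bspan: "tpow Pbar k (Suc M) = (bspan k M :: 'k::field tensor set)"
proof
  show "tpow Pbar k (Suc M) \<subseteq> (bspan k M :: 'k tensor set)"
    unfolding tpow_def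
  proof (rule fspan_subset)
    show "{ptensor vs |vs. length vs = k \<and> set vs \<subseteq> Pbar (Suc M)} \<subseteq> (bspan k M :: 'k tensor set)"
    proof clarify
      fix vs :: "'k tensor list" assume vs: "k = length vs" "set vs \<subseteq> Pbar (Suc M)"
      have expand: "(vs ! i) [y] = (\<Sum>a<M. (vs ! i) [a] * bv M a y)" if "i < k" for i y
      proof -
        have v: "vs ! i \<in> tens 1 (Suc M)" "(\<Sum>x<Suc M. (vs ! i) [x]) = 0"
        proof -
          have "vs ! i \<in> Pbar (Suc M)" using vs that nth_mem[of i vs] by blast
          then show "vs ! i \<in> tens 1 (Suc M)" "(\<Sum>x<Suc M. (vs ! i) [x]) = 0"
            unfolding Pbar_def by blast+
        qed
        consider "y < M" | "y = M" | "y > M" by linarith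
        then show ?thesis
        proof cases
          case 1
          then have "(\<Sum>a<M. (vs ! i) [a] * bv M a y) = (\<Sum>a<M. if a = y then (vs ! i) [a] else 0)"
            by (intro sum.cong) (auto simp: bv_def)
          then show ?thesis using 1 by simp
        next
          case 2
          then have "(\<Sum>a<M. (vs ! i) [a] * bv M a y) = (\<Sum>a<M. - (vs ! i) [a])"
            by (intro sum.cong) (auto simp: bv_def)
          moreover have "(vs ! i) [M] = - (\<Sum>a<M. (vs ! i) [a])"
            using v(2) by (simp add: eq_neg_iff_add_eq_0 add.commute)
          ultimately show ?thesis using 2 by (simp add: sum_negf)
        next
          case 3
          then have "[y] \<notin> words 1 (Suc M)" by (auto simp: words_def)
          then have "(vs ! i) [y] = 0" using v(1) by (simp add: tens_iff)
          moreover have "(\<Sum>a<M. (vs ! i) [a] * bv M a y) = 0"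
            using 3 by (intro sum.neutral) (auto simp: bv_def)
          ultimately show ?thesis by simp
        qed
      qed
      have "ptensor vs = (\<lambda>x. \<Sum>w\<in>words k M. (\<Prod>i<k. (vs ! i) [w ! i]) * bt M w x)"
      proof
        fix x show "ptensor vs x = (\<Sum>w\<in>words k M. (\<Prod>i<k. (vs ! i) [w ! i]) * bt M w x)"
        proof (cases "length x = k")
          case True
          have "ptensor vs x = (\<Prod>i<k. \<Sum>a<M. (vs ! i) [a] * bv M a (x ! i))"
            using True vs(1) by (simp add: ptensor_def expand[symmetric])
          also have "\<dots> = (\<Sum>w\<in>words k M. \<Prod>i<k. (vs ! i) [w ! i] * bv M (w ! i) (x ! i))"
            by (rule words_prod_sum[symmetric])
          also have "\<dots> = (\<Sum>w\<in>words k M. (\<Prod>i<k. (vs ! i) [w ! i]) * bt M w x)"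
            using True by (intro sum.cong) (auto simp: bt_def wordsD prod.distrib)
          finally show ?thesis .
        next
          case False
          then show ?thesis using vs(1) by (auto simp: ptensor_def bt_def wordsD intro!: sum.neutral)
        qed
      qed
      then show "ptensor vs \<in> bspan (length vs) M" unfolding vs(1) by (rule bspanI)
    qed
  qed (rule bspan_lincomb, auto)
  show "(bspan k M :: 'k tensor set) \<subseteq> tpow Pbar k (Suc M)"
  proof
    fix v :: "'k tensor" assume "v \<in> bspan k M"
    then obtain c where v: "v = (\<lambda>x. \<Sum>w\<in>words k M. c w * bt M w x)" by (auto simp: bspan_def)
    have b: "bt M [a] \<in> (Pbar (Suc M) :: 'k tensor set)" if "a < M" for a
    proof -
      have "bt M [a] \<in> (tens 1 (Suc M) :: 'k tensor set)"
        by (rule bt_tens) (use that in \<open>auto simp: words_def\<close>)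
      moreover have "(\<Sum>x<Suc M. bt M [a] [x]) = (0 :: 'k)"
        using sum_bv[OF that, where 'k = 'k] by (simp add: bt_def)
      ultimately show ?thesis by (simp add: Pbar_def)
    qed
    have "bt M w = (ptensor (map (\<lambda>a. bt M [a]) w) :: 'k tensor)" for w
      by (auto simp: fun_eq_iff bt_def ptensor_def intro!: prod.cong)
    moreover have "length (map (\<lambda>a. bt M [a]) w) = k" "set (map (\<lambda>a. bt M [a]) w) \<subseteq> (Pbar (Suc M) :: 'k tensor set)"
      if "w \<in> words k M" for w
      using b that by (auto simp: words_def)
    ultimately have "bt M w \<in> {ptensor vs | vs. length vs = k \<and> set vs \<subseteq> (Pbar (Suc M) :: 'k tensor set)}"
      if "w \<in> words k M" for w using that by blast
    then show "v \<in> tpow Pbar k (Suc M)"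
      unfolding v tpow_def by (rule fspan_lincomb[OF finite_words])
  qed
qed

text \<open>Each slot takes its base point from another slot of the same word; since slot 0 cannot
  be its own base point, it uses slot 1.\<close>

definition partner :: "nat set \<Rightarrow> nat \<Rightarrow> nat" where
  "partner B l = (if l \<in> B then (if l = 0 then 1 else 0) else l)"

text \<open>The operator \<open>[x] \<mapsto> ([x\<^sub>0] - [x\<^sub>1]) \<otimes> ([x\<^sub>1] - [x\<^sub>0]) \<otimes> ([x\<^sub>2] - [x\<^sub>0]) \<otimes> \<dots>\<close>, expanded
  over the set \<open>B\<close> of factors in which the second term is taken.\<close>

definition proj_bar :: "nat \<Rightarrow> nat \<Rightarrow> 'k::field tensor \<Rightarrow> 'k tensor" where
  "proj_bar k m v = (\<lambda>z. \<Sum>B\<in>Pow {..<k}. (-1) ^ card B * pull (partner B) k k m v z)"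

lemma partner_range: "2 \<le> k \<Longrightarrow> partner B ` {..<k} \<subseteq> {..<k}"
  by (auto simp: partner_def)

lemma natural_proj_bar: "2 \<le> k \<Longrightarrow> natural k k (proj_bar k)"
  unfolding proj_bar_def[abs_def]
  by (rule natural_lincomb) (auto intro: natural_pull[OF partner_range])

lemma lin_proj_bar: "lin (proj_bar k m)"
  unfolding proj_bar_def[abs_def] by (rule lin_lincomb) (auto simp: pull_def lin_pf)

text \<open>Every slot contributes a difference of two basis vectors, which has coordinate sum 0;
  multiplying out over the slots yields the alternating sum over \<open>B\<close>.\<close>

lemma proj_bar_tpow:
  fixes v :: "'k::field tensor"
  assumes k: "2 \<le> k" and v: "v \<in> tens k m"
  shows "proj_bar k m v \<in> tpow Pbar k m"
proof -
  define d :: "nat list \<Rightarrow> 'k tensor list" where "d x = map (\<lambda>l ys. delta [x ! l] ys - delta [x ! partner {..<k} l] ys) [0..<k]" for x :: "nat list"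
  have pt: "ptensor (d x) z = (\<Sum>B\<in>Pow {..<k}. (-1) ^ card B * of_bool (sel (partner B) k x = z) :: 'k)" for x z
  proof (cases "length z = k")
    case True
    have "ptensor (d x) z = (\<Prod>l<k. of_bool (z ! l = x ! l) - of_bool (z ! l = x ! partner {..<k} l))"
      using True by (simp add: ptensor_def d_def delta_def)
    also have "\<dots> = (\<Sum>B\<in>Pow {..<k}. (-1) ^ card B * (\<Prod>l\<in>B. of_bool (z ! l = x ! partner {..<k} l))
        * (\<Prod>l\<in>{..<k} - B. of_bool (z ! l = x ! l)))"
      by (rule prod_diff_conv_sum) simp
    also have "\<dots> = (\<Sum>B\<in>Pow {..<k}. (-1) ^ card B * of_bool (sel (partner B) k x = z))"
    proof (rule sum.cong[OF refl])
      fix B assume B: "B \<in> Pow {..<k}"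
      have "(\<Prod>l\<in>B. of_bool (z ! l = x ! partner {..<k} l)) * (\<Prod>l\<in>{..<k} - B. of_bool (z ! l = x ! l))
        = (\<Prod>l\<in>{..<k}. of_bool (z ! l = x ! partner B l) :: 'k)"
      proof -
        have "(\<Prod>l\<in>{..<k}. of_bool (z ! l = x ! partner B l) :: 'k)
          = (\<Prod>l\<in>{..<k} - B. of_bool (z ! l = x ! partner B l)) * (\<Prod>l\<in>B. of_bool (z ! l = x ! partner B l))"
          using B by (intro prod.subset_diff) auto
        also have "(\<Prod>l\<in>B. of_bool (z ! l = x ! partner B l) :: 'k) = (\<Prod>l\<in>B. of_bool (z ! l = x ! partner {..<k} l))"
          using B by (intro prod.cong) (auto simp: partner_def)
        also have "(\<Prod>l\<in>{..<k} - B. of_bool (z ! l = x ! partner B l) :: 'k) = (\<Prod>l\<in>{..<k} - B. of_bool (z ! l = x ! l))"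
          by (intro prod.cong) (auto simp: partner_def)
        finally show ?thesis by (simp add: mult.commute)
      qed
      also have "\<dots> = of_bool (\<forall>l<k. z ! l = x ! partner B l)"
        by (cases "\<forall>l<k. z ! l = x ! partner B l") (auto intro!: prod_zero)
      also have "(\<forall>l<k. z ! l = x ! partner B l) \<longleftrightarrow> sel (partner B) k x = z"
        using True by (auto simp: list_eq_iff_nth_eq)
      finally show "(-1) ^ card B * (\<Prod>l\<in>B. of_bool (z ! l = x ! partner {..<k} l))
        * (\<Prod>l\<in>{..<k} - B. of_bool (z ! l = x ! l)) = (-1) ^ card B * (of_bool (sel (partner B) k x = z) :: 'k)"
        by (simp add: mult.assoc)
    qed
    finally show ?thesis .
  next
    case False
    then have "sel (partner B) k x \<noteq> z" for B by (metis length_sel)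
    then show ?thesis using False by (simp add: ptensor_def d_def)
  qed
  have "proj_bar k m v = (\<lambda>z. \<Sum>x\<in>words k m. v x * ptensor (d x) z)"
  proof
    fix z
    have "proj_bar k m v z = (\<Sum>B\<in>Pow {..<k}. \<Sum>x\<in>words k m. v x * ((-1) ^ card B * of_bool (sel (partner B) k x = z)))"
      unfolding proj_bar_def pull_def pf_def sum_distrib_left
      by (rule sum.cong[OF refl], rule sum.mono_neutral_cong_left) auto
    also have "\<dots> = (\<Sum>x\<in>words k m. v x * ptensor (d x) z)"
      unfolding pt sum_distrib_left by (rule sum.swap)
    finally show "proj_bar k m v z = (\<Sum>x\<in>words k m. v x * ptensor (d x) z)" .
  qed
  also have "\<dots> \<in> tpow Pbar k m"
    unfolding tpow_def
  proof (rule fspan_lincomb)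
    fix x assume x: "x \<in> words k m"
    have "(\<lambda>ys. delta [x ! l] ys - delta [x ! partner {..<k} l] ys) \<in> (Pbar m :: 'k tensor set)" if l: "l < k" for l
    proof -
      have lt: "x ! l < m" "x ! partner {..<k} l < m"
        using wordsD(2)[OF x] l partner_range[OF k, of "{..<k}"] by auto
      have "(\<Sum>y<m. delta [x ! l] [y] - delta [x ! partner {..<k} l] [y]) = (0 :: 'k)"
        using lt by (simp add: sum_subtractf delta_def of_bool_def)
      moreover have "(\<lambda>ys. delta [x ! l] ys - delta [x ! partner {..<k} l] ys) \<in> (tens 1 m :: 'k tensor set)"
        using lt by (auto simp: tens_iff delta_def words_def)
      ultimately show ?thesis by (simp add: Pbar_def)
    qed
    then have "set (d x) \<subseteq> Pbar m" by (auto simp: d_def)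
    moreover have "length (d x) = k" by (simp add: d_def)
    ultimately show "ptensor (d x) \<in> {ptensor vs |vs. length vs = k \<and> set vs \<subseteq> Pbar m}" by blast
  qed simp
  finally show ?thesis .
qed

lemma proj_bar_bt:
  assumes k: "2 \<le> k" and w: "w \<in> words k M"
  shows "proj_bar k (Suc M) (bt M w) = (\<lambda>z. bt M w z + (bt M (permute_list (transpose 0 1) w) z :: 'k::field))"
proof
  fix z
  let ?t = "transpose (0::nat) 1"
  have w': "w \<in> words k (Suc M)" using w words_mono[of M "Suc M" k] by auto
  \<comment> \<open>For every other \<open>B\<close> some slot of \<open>B\<close> is missed by
    \<open>partner B\<close>: any slot from 2 on that belongs to \<open>B\<close>, or the only
    element of \<open>{0}\<close> or \<open>{1}\<close>.\<close>
  have zero: "pull (partner B) k k (Suc M) (bt M w) = (\<lambda>_. 0 :: 'k)" if B: "B \<subseteq> {..<k}" "B \<noteq> {}" "B \<noteq> {0, 1}" for B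
  proof -
    obtain l where l: "l \<in> B" "l \<notin> partner B ` {..<k}"
    proof (cases "\<exists>l\<in>B. 2 \<le> l")
      case True
      then obtain l where "l \<in> B" "2 \<le> l" by blast
      then have "l \<notin> partner B ` {..<k}" by (auto simp: partner_def split: if_splits)
      then show ?thesis using that \<open>l \<in> B\<close> by blast
    next
      case False
      then have "B \<subseteq> {0, 1}" by (auto simp: not_le less_2_cases_iff)
      then have "B = {0} \<or> B = {1}" using B by blast
      then show ?thesis
        by (rule disjE) (rule that[of 0] that[of 1], auto simp: partner_def split: if_splits)+
    qed
    then have "l < k" using B by auto
    moreover have "w ! l \<noteq> M" using wordsD(2)[OF w \<open>l < k\<close>] by simp
    ultimately show ?thesis using l(2) w' by (intro pull_bt_zero)
  qed
  have pid: "pull (partner {}) k k (Suc M) (bt M w) = (bt M w :: 'k tensor)"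
  proof -
    have "partner {} = id" by (auto simp: partner_def)
    moreover have "pull id k k (Suc M) (bt M w) = rperm (bt M w :: 'k tensor) id"
      by (rule rperm_eq_pull[OF permutes_id bt_tens[OF w'], symmetric])
    ultimately show ?thesis by (simp add: rperm_def)
  qed
  have pt: "pull (partner {0, 1}) k k (Suc M) (bt M w) = (bt M (permute_list ?t w) :: 'k tensor)"
  proof -
    have "partner {0, 1} = ?t" by (auto simp: partner_def transpose_def)
    moreover have t: "?t permutes {..<k}" using k by (intro permutes_swap_id) auto
    ultimately show ?thesis
      using rperm_eq_pull[OF t bt_tens[OF w'], where 'a = 'k] rperm_bt[OF t wordsD(1)[OF w], where 'k = 'k] by simp
  qed
  have "proj_bar k (Suc M) (bt M w) z
      = (\<Sum>B\<in>{{}, {0, 1}}. (-1) ^ card B * (pull (partner B) k k (Suc M) (bt M w) z :: 'k))"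
    unfolding proj_bar_def using k
    by (intro sum.mono_neutral_right) (auto simp: zero)
  also have "\<dots> = (-1) ^ card ({} :: nat set) * pull (partner {}) k k (Suc M) (bt M w) z
      + (-1) ^ card {0::nat, 1} * pull (partner {0, 1}) k k (Suc M) (bt M w) z"
    by simp
  finally show "proj_bar k (Suc M) (bt M w) z = (bt M w z + bt M (permute_list ?t w) z :: 'k)"
    unfolding pid pt by simp
qed

text \<open>The projection acts as \<open>1 + (0 1)\<close> on the reduced tensor power, and the transposition \<open>(0 1)\<close> is a row
  permutation of \<open>nu\<close>.\<close>

lemma young_sym_proj_bar:
  assumes nu: "2 \<le> part_at nu 0" and v: "v \<in> bspan (sum_list nu) M"
  shows "young_sym nu (proj_bar (sum_list nu) (Suc M) v) = (\<lambda>z. 2 * young_sym nu v z :: 'k::field)"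
proof -
  let ?k = "sum_list nu" and ?t = "transpose (0::nat) 1"
  have l: "0 < length nu" "2 \<le> nu ! 0" using nu by (auto simp: part_at_def split: if_splits)
  have b: "box nu 0 0 = 0" "box nu 0 1 = 1" by (simp_all add: box_def psum_def)
  have k: "2 \<le> ?k" using box_less[of 0 nu 1] l b by simp
  have r: "rowof nu 0 = 0" "rowof nu 1 = 0"
    using rowof_box[of 0 nu 0] rowof_box[of 0 nu 1] l b by simp_all
  have t: "?t \<in> row_group nu" using k r by (auto simp: row_group_def transpose_def intro!: permutes_swap_id)
  obtain c where v: "v = (\<lambda>x. \<Sum>w\<in>words ?k M. c w * bt M w x)" using v by (auto simp: bspan_def)
  have linT: "lin (\<lambda>v. young_sym nu (proj_bar ?k (Suc M) v) :: 'k tensor)"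
    by (rule lin_comp[OF lin_young_sym lin_proj_bar])
  have step: "young_sym nu (proj_bar ?k (Suc M) (bt M w)) = (\<lambda>z. 2 * young_sym nu (bt M w) z :: 'k)"
    if w: "w \<in> words ?k M" for w
  proof -
    let ?w = "permute_list ?t w"
    have w': "?w \<in> words ?k M" by (rule permute_words[OF w row_group_permutes[OF t]])
    have tab: "tab nu ?w = tab nu w"
    proof -
      have "tab nu ?w = image_mset (\<lambda>j. (rowof nu j, w ! j)) (image_mset ?t (mset_set {..<?k}))"
        unfolding tab_def image_mset.compositionality o_def
        using row_groupD[OF t] row_group_permutes[OF t] wordsD(1)[OF w]
        by (intro image_mset_cong) (auto simp: permute_list_nth)
      then show ?thesis using permutes_image_mset[OF row_group_permutes[OF t]] by (simp add: tab_def)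
    qed
    have "young_sym nu (bt M ?w) = (young_sym nu (bt M w) :: 'k tensor)"
      unfolding young_sym_bt[OF w] young_sym_bt[OF w']
      using kern_row_invariant[OF tab, where 'a = 'k] wordsD(1)[OF w] by simp
    then show ?thesis
      unfolding proj_bar_bt[OF k w] using lin_young_sym[of nu, where 'k = 'k] by (simp add: lin_def)
  qed
  have "young_sym nu (proj_bar ?k (Suc M) v) = (\<lambda>z. \<Sum>w\<in>words ?k M. c w * young_sym nu (proj_bar ?k (Suc M) (bt M w)) z)"
    unfolding v by (rule lin_sum[OF linT]) simp
  also have "\<dots> = (\<lambda>z. 2 * (\<Sum>w\<in>words ?k M. c w * young_sym nu (bt M w) z))"
    by (simp add: step sum_distrib_left mult.left_commute)
  also have "(\<lambda>z. 2 * (\<Sum>w\<in>words ?k M. c w * young_sym nu (bt M w) z)) = (\<lambda>z. 2 * young_sym nu v z)"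
    unfolding v lin_sum[OF lin_young_sym finite_words] ..
  finally show ?thesis .
qed

text \<open>With c for \<open>young_sym nu\<close>, the map \<open>T\<close> applies
  \<open>d / 2\<close>, then \<open>proj_bar\<close>, then c. On reduced tensors
  \<open>proj_bar\<close> followed by c is 2 c, so c d c = c shows that \<open>T\<close> fixes the
  image of c there.\<close>

lemma retraction_exists:
  assumes nu: "2 \<le> part_at nu 0"
  obtains T :: "nat \<Rightarrow> 'k::field_char_0 tensor \<Rightarrow> 'k tensor" where
    "natural (sum_list nu) (sum_list nu) T"
    "\<And>m v. v \<in> tens (sum_list nu) m \<Longrightarrow> T m v \<in> young_sym nu ` tpow Pbar (sum_list nu) m"
    "\<And>M w. w \<in> words (sum_list nu) M \<Longrightarrow> T (Suc M) (young_sym nu (bt M w)) = young_sym nu (bt M w)"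
proof -
  let ?k = "sum_list nu"
  have l: "0 < length nu" "2 \<le> nu ! 0" using nu by (auto simp: part_at_def split: if_splits)
  have k: "2 \<le> ?k" using box_less[of 0 nu 1] l by (simp add: box_def psum_def)
  obtain d :: "(nat \<Rightarrow> nat) \<Rightarrow> 'k" where d: "\<forall>v. (\<forall>z. length z \<noteq> ?k \<longrightarrow> v z = 0) \<longrightarrow>
      young_sym nu (gact ?k d (young_sym nu v)) = young_sym nu v"
    using young_sym_regular[of nu, where 'k = 'k] by blast
  define T where "T m v = young_sym nu (proj_bar ?k m (gact ?k (\<lambda>\<sigma>. d \<sigma> / 2) v))" for m v
  have nat: "natural ?k ?k (\<lambda>m v. proj_bar ?k m (gact ?k (\<lambda>\<sigma>. d \<sigma> / 2) v))"
    by (rule natural_comp[OF natural_gact natural_proj_bar[OF k]])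
  show ?thesis
  proof (rule that[of T])
    show "natural ?k ?k T" unfolding T_def[abs_def] by (rule natural_comp[OF nat natural_young_sym])
    show "T m v \<in> young_sym nu ` tpow Pbar ?k m" if "v \<in> tens ?k m" for m v
    proof -
      have "gact ?k (\<lambda>\<sigma>. d \<sigma> / 2) v \<in> tens ?k m" using natural_gact that unfolding natural_def by blast
      then show ?thesis unfolding T_def using proj_bar_tpow[OF k] by blast
    qed
    fix M w assume w: "w \<in> words ?k M"
    have half: "gact ?k (\<lambda>\<sigma>. d \<sigma> / 2) v = (\<lambda>z. (1 / 2) * gact ?k d v z)" for v
      by (simp add: gact_def sum_distrib_left)
    have b: "gact ?k (\<lambda>\<sigma>. d \<sigma> / 2) (young_sym nu (bt M w)) \<in> bspan ?k M"
      by (intro bspan_gact bspan_young_sym bt_bspan w)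
    have "T (Suc M) (young_sym nu (bt M w)) = (\<lambda>z. 2 * young_sym nu (gact ?k (\<lambda>\<sigma>. d \<sigma> / 2) (young_sym nu (bt M w))) z)"
      unfolding T_def by (rule young_sym_proj_bar[OF nu b])
    also have "\<dots> = (\<lambda>z. 2 * ((1 / 2) * young_sym nu (gact ?k d (young_sym nu (bt M w))) z))"
    proof -
      have "young_sym nu (\<lambda>z. c * x z) = (\<lambda>z. c * young_sym nu x z)" for c and x :: "'k tensor"
        using lin_young_sym[of nu, where 'k = 'k] by (simp add: lin_def)
      then show ?thesis unfolding half by (simp only:)
    qed
    also have "\<dots> = young_sym nu (gact ?k d (young_sym nu (bt M w)))" by simp
    also have "\<dots> = young_sym nu (bt M w)" using d[rule_format, of "bt M w"] by (simp add: bt_def wordsD[OF w])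
    finally show "T (Suc M) (young_sym nu (bt M w)) = young_sym nu (bt M w)" .
  qed
qed

section \<open>Components of the decomposition\<close>

text \<open>The augmentation, sending every \<open>[x]\<close> to 1, applied in the slots of the
  strip.\<close>

definition forget :: "nat list \<Rightarrow> nat list \<Rightarrow> nat \<Rightarrow> 'k::field tensor \<Rightarrow> 'k tensor" where
  "forget lam nu = pull (shape_pair.inc lam nu) (sum_list lam) (sum_list nu)"

lemma natural_forget: "nu \<in> hstrips lam \<Longrightarrow> natural (sum_list lam) (sum_list nu) (forget lam nu)"
  unfolding forget_def using shape_pair.inc_range[OF hstrip_shape_pair] by (intro natural_pull) blast

lemma lin_forget: "lin (forget lam nu m)"
  by (simp add: forget_def pull_def lin_pf)

lemma forget_young_sym_bt:
  assumes nu: "nu \<in> hstrips lam" and w: "w \<in> words (sum_list lam) (Suc M)"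
  shows "forget lam nu (Suc M) (young_sym lam (bt M w))
    = (\<lambda>x. \<Sum>z\<in>words (sum_list nu) (Suc M). kern lam w (emb lam nu M z) * (bt M z x :: 'k::field))"
  unfolding forget_def by (rule shape_pair.pull_young_sym_bt[OF hstrip_shape_pair[OF nu] w])

lemma forget_emb_other:
  assumes lam: "is_partition lam n" and H: "nu \<in> hstrips lam" "mu \<in> hstrips lam" "mu \<noteq> nu"
    and rk: "hrank lam nu \<le> hrank lam mu" and w: "w \<in> words (sum_list mu) M"
  shows "forget lam nu (Suc M) (young_sym lam (bt M (emb lam mu M w))) = (\<lambda>_. 0 :: 'k::field)"
proof -
  have e: "emb lam mu M w \<in> words (sum_list lam) (Suc M)"
    using w words_mono[of M "Suc M"] by (intro shape_pair.emb_words[OF hstrip_shape_pair[OF H(2)]]) auto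
  show ?thesis
    unfolding forget_young_sym_bt[OF H(1) e]
    using kern_emb_hrank[OF lam H rk w, where 'k = 'k] by (simp add: wordsD)
qed

lemma forget_emb_same:
  assumes lam: "is_partition lam n" and nu: "nu \<in> hstrips lam" and w: "w \<in> words (sum_list nu) M"
  shows "forget lam nu (Suc M) (young_sym lam (bt M (emb lam nu M w)))
    = (\<lambda>x. of_nat (card (shape_pair.fixers lam nu)) * young_sym nu (bt M w) x :: 'k::field)"
proof -
  have w': "w \<in> words (sum_list nu) (Suc M)" using w words_mono[of M "Suc M"] by auto
  have e: "emb lam nu M w \<in> words (sum_list lam) (Suc M)"
    by (rule shape_pair.emb_words[OF hstrip_shape_pair[OF nu] w']) simp
  have M: "M \<notin> set w" "length w = sum_list nu" using w by (auto simp: words_def)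
  show ?thesis
    unfolding forget_young_sym_bt[OF nu e] young_sym_bt[OF w']
    using kern_emb_diag[OF lam nu M, where 'k = 'k]
    by (simp add: wordsD sum_distrib_left mult.assoc)
qed

text \<open>Here \<open>post\<close> abstracts over what follows the forgetful map: a retraction in
  general, the identity for the two columns of a hook. Only its effect on the image of reduced
  tensors enters.\<close>

lemma schur_injective:
  fixes post :: "nat list \<Rightarrow> 'k::field_char_0 tensor \<Rightarrow> 'k tensor"
  assumes lam: "is_partition lam n"
    and lin: "\<And>nu. nu \<in> hstrips lam \<Longrightarrow> lin (post nu)"
    and post: "\<And>nu w. nu \<in> hstrips lam \<Longrightarrow> w \<in> words (sum_list nu) M \<Longrightarrow>
      post nu (young_sym nu (bt M w)) = young_sym nu (bt M w)"
    and v: "v \<in> tens (sum_list lam) (Suc M)"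
    and zero: "\<And>nu. nu \<in> hstrips lam \<Longrightarrow> post nu (forget lam nu (Suc M) (young_sym lam v)) = (\<lambda>_. 0)"
  shows "young_sym lam v = (\<lambda>_. 0)"
proof -
  let ?n = "sum_list lam" and ?H = "hstrips lam"
  obtain c where vc: "v = (\<lambda>x. \<Sum>w\<in>words ?n (Suc M). c w * bt M w x)" by (rule tens_span_bt[OF v])
  \<comment> \<open>By linearity each coordinate of a component is a fixed combination of entries of
    \<open>kern\<close>, the format that \<open>triangular_elimination\<close> expects.\<close>
  define h where "h nu z y = post nu (forget lam nu (Suc M) (bt M y)) z" for nu z y
  define \<Xi> where "\<Xi> nu z w = (\<Sum>y\<in>words ?n (Suc M). h nu z y * kern lam w y)" for nu z w
  have linF: "lin (\<lambda>v. post nu (forget lam nu (Suc M) v))" if "nu \<in> ?H" for nu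
    by (rule lin_comp[OF lin[OF that] lin_forget])
  have \<Xi>: "\<Xi> nu z w = post nu (forget lam nu (Suc M) (young_sym lam (bt M w))) z"
    if "nu \<in> ?H" "w \<in> words ?n (Suc M)" for nu z w
    unfolding young_sym_bt[OF that(2)] lin_sum[OF linF[OF that(1)] finite_words]
    by (simp add: \<Xi>_def h_def mult.commute)
  have e: "emb lam nu M w \<in> words ?n (Suc M)" if "nu \<in> ?H" "w \<in> words (sum_list nu) M" for nu w
    using that words_mono[of M "Suc M"] by (intro shape_pair.emb_words[OF hstrip_shape_pair]) auto
  \<comment> \<open>This is the coefficient of \<open>young_sym lam v\<close> at
    \<open>bt M y\<close>. The functional given by \<open>kern\<close> at \<open>y\<close> is good,
    hence a combination of coordinates of the components, and these vanish on
    \<open>v\<close>.\<close>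
  have coeff: "(\<Sum>w\<in>words ?n (Suc M). c w * kern lam w y) = 0" for y
  proof -
    obtain f where f: "good lam (Suc M) f" "\<And>w. length w = ?n \<Longrightarrow> kern lam w y = (f (tab lam w) :: 'k)"
      using kern_good[OF lam, of "Suc M" y, where 'k = 'k] by blast
    have "\<exists>G. \<forall>w\<in>words ?n (Suc M). f (tab lam w) = (\<Sum>nu\<in>?H. \<Sum>z\<in>words (sum_list nu) M. G nu z * \<Xi> nu z w)"
    proof (rule triangular_elimination[OF lam, where rk = "hrank lam" and h = h and
        q = "\<lambda>nu. of_nat (card (shape_pair.fixers lam nu))"])
      show "kernel_complete TYPE('k) M nu" if "nu \<in> ?H" for nu
        using that kernel_complete by (auto simp: hstrips_def)
      show "\<Xi> nu z (emb lam mu M w) = 0"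
        if "nu \<in> ?H" "mu \<in> ?H" "mu \<noteq> nu" "hrank lam nu \<le> hrank lam mu" "w \<in> words (sum_list mu) M" for nu mu w z
        using forget_emb_other[OF lam that, where 'k = 'k] lin_zero[OF lin[OF that(1)]] \<Xi>[OF that(1) e[OF that(2,5)]] by simp
      show "\<Xi> nu z (emb lam nu M w) = of_nat (card (shape_pair.fixers lam nu)) * kern nu w z"
        if nu: "nu \<in> ?H" and w: "w \<in> words (sum_list nu) M" and z: "z \<in> words (sum_list nu) M" for nu w z
      proof -
        have "post nu (\<lambda>x. of_nat (card (shape_pair.fixers lam nu)) * young_sym nu (bt M w) x)
            = (\<lambda>x. of_nat (card (shape_pair.fixers lam nu)) * young_sym nu (bt M w) x)"
          using lin[OF nu] post[OF nu w] by (simp add: lin_def)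
        then have "\<Xi> nu z (emb lam nu M w) = of_nat (card (shape_pair.fixers lam nu)) * young_sym nu (bt M w) z"
          using \<Xi>[OF nu e[OF nu w]] forget_emb_same[OF lam nu w, where 'k = 'k] by simp
        moreover have "young_sym nu (bt M w) z = (\<Sum>y\<in>words (sum_list nu) M. if y = z then kern nu w y else 0 :: 'k)"
          unfolding young_sym_bt[OF w] using z by (intro sum.cong) (auto simp: bt_eval wordsD)
        ultimately show ?thesis using z by simp
      qed
      show "of_nat (card (shape_pair.fixers lam nu)) \<noteq> (0 :: 'k)" if "nu \<in> ?H" for nu
        using shape_pair.fixers_pos[OF hstrip_shape_pair[OF that]] by simp
    qed (use f in \<open>simp_all add: \<Xi>_def hrank_def\<close>)
    then obtain G where G: "\<And>w. w \<in> words ?n (Suc M) \<Longrightarrow>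
        f (tab lam w) = (\<Sum>nu\<in>?H. \<Sum>z\<in>words (sum_list nu) M. G nu z * \<Xi> nu z w)" by blast
    have c\<Xi>: "(\<Sum>w\<in>words ?n (Suc M). c w * \<Xi> nu z w) = 0" if nu: "nu \<in> ?H" for nu z
    proof -
      have "post nu (forget lam nu (Suc M) (young_sym lam v))
          = (\<lambda>x. \<Sum>w\<in>words ?n (Suc M). c w * post nu (forget lam nu (Suc M) (young_sym lam (bt M w))) x)"
        unfolding vc by (rule lin_sum[OF lin_comp[OF linF[OF nu] lin_young_sym]]) simp
      from fun_cong[OF this, of z] show ?thesis using zero[OF nu] \<Xi>[OF nu] by simp
    qed
    have "(\<Sum>w\<in>words ?n (Suc M). c w * kern lam w y)
        = (\<Sum>w\<in>words ?n (Suc M). \<Sum>nu\<in>?H. \<Sum>z\<in>words (sum_list nu) M. G nu z * (c w * \<Xi> nu z w))"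
      by (rule sum.cong[OF refl]) (simp add: f(2) G wordsD sum_distrib_left mult.left_commute)
    also have "\<dots> = (\<Sum>nu\<in>?H. \<Sum>z\<in>words (sum_list nu) M. \<Sum>w\<in>words ?n (Suc M). G nu z * (c w * \<Xi> nu z w))"
      by (subst sum.swap, rule sum.cong[OF refl], rule sum.swap)
    also have "\<dots> = 0" using c\<Xi> by (simp add: sum_distrib_left[symmetric])
    finally show ?thesis .
  qed
  have "young_sym lam v = (\<lambda>x. \<Sum>w\<in>words ?n (Suc M). c w * young_sym lam (bt M w) x)"
    unfolding vc by (rule lin_sum[OF lin_young_sym]) simp
  also have "\<dots> = (\<lambda>x. \<Sum>y\<in>words ?n (Suc M). (\<Sum>w\<in>words ?n (Suc M). c w * kern lam w y) * bt M y x)"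
  proof
    fix x
    have "(\<Sum>w\<in>words ?n (Suc M). c w * young_sym lam (bt M w) x)
        = (\<Sum>w\<in>words ?n (Suc M). \<Sum>y\<in>words ?n (Suc M). c w * kern lam w y * bt M y x)"
      by (rule sum.cong[OF refl]) (simp add: young_sym_bt sum_distrib_left mult.assoc)
    also have "\<dots> = (\<Sum>y\<in>words ?n (Suc M). (\<Sum>w\<in>words ?n (Suc M). c w * kern lam w y) * bt M y x)"
      unfolding sum_distrib_right by (rule sum.swap)
    finally show "(\<Sum>w\<in>words ?n (Suc M). c w * young_sym lam (bt M w) x)
        = (\<Sum>y\<in>words ?n (Suc M). (\<Sum>w\<in>words ?n (Suc M). c w * kern lam w y) * bt M y x)" .
  qed
  finally show ?thesis by (simp add: coeff)
qed

text \<open>Preimages are combinations of strip fillings: on these the component of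
  \<open>nu\<close> is the wanted tensor up to the factor \<open>q\<close>, and the other components
  of rank at most that of \<open>nu\<close> vanish by triangularity.\<close>

lemma schur_surjective:
  fixes t :: "'k::field_char_0 tensor"
  assumes lam: "is_partition lam n" and nu: "nu \<in> hstrips lam"
    and t: "t \<in> young_sym nu ` bspan (sum_list nu) M"
  shows "\<exists>v\<in>tens (sum_list lam) (Suc M). forget lam nu (Suc M) (young_sym lam v) = t \<and>
    (\<forall>mu\<in>hstrips lam. mu \<noteq> nu \<longrightarrow> hrank lam mu \<le> hrank lam nu \<longrightarrow>
      forget lam mu (Suc M) (young_sym lam v) = (\<lambda>_. 0))"
proof -
  let ?k = "sum_list nu"
  define q where "q = (of_nat (card (shape_pair.fixers lam nu)) :: 'k)"
  have q: "q \<noteq> 0" using shape_pair.fixers_pos[OF hstrip_shape_pair[OF nu]] by (simp add: q_def)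
  obtain c where "t = young_sym nu (\<lambda>x. \<Sum>w\<in>words ?k M. c w * bt M w x)" using t by (auto simp: bspan_def)
  then have t: "t = (\<lambda>x. \<Sum>w\<in>words ?k M. c w * young_sym nu (bt M w) x)"
    by (simp add: lin_sum[OF lin_young_sym])
  define v where "v = (\<lambda>x. \<Sum>w\<in>words ?k M. (c w / q) * bt M (emb lam nu M w) x)"
  have e: "emb lam nu M w \<in> words (sum_list lam) (Suc M)" if "w \<in> words ?k M" for w
    using that words_mono[of M "Suc M"] by (intro shape_pair.emb_words[OF hstrip_shape_pair[OF nu]]) auto
  have fv: "forget lam mu (Suc M) (young_sym lam v)
      = (\<lambda>x. \<Sum>w\<in>words ?k M. (c w / q) * forget lam mu (Suc M) (young_sym lam (bt M (emb lam nu M w))) x)" for mu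
    unfolding v_def by (rule lin_sum[OF lin_comp[OF lin_forget lin_young_sym]]) simp
  show ?thesis
  proof (intro bexI[of _ v] conjI ballI impI)
    show "v \<in> tens (sum_list lam) (Suc M)"
      unfolding v_def by (rule tens_lincomb) (simp add: bt_tens e)
    show "forget lam nu (Suc M) (young_sym lam v) = t"
      unfolding fv t using q by (simp add: forget_emb_same[OF lam nu] q_def[symmetric])
    show "forget lam mu (Suc M) (young_sym lam v) = (\<lambda>_. 0)"
      if "mu \<in> hstrips lam" "mu \<noteq> nu" "hrank lam mu \<le> hrank lam nu" for mu
      unfolding fv using that nu by (simp add: forget_emb_other[OF lam])
  qed
qed

text \<open>Right translation by \<open>\<sigma>\<close> permutes the terms of the column
  antisymmetrizer and costs the sign of \<open>\<sigma>\<close>.\<close>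

lemma kern_permute_col:
  assumes "\<sigma> \<in> col_group lam" "length w = sum_list lam"
  shows "kern lam w (permute_list \<sigma> z) = (of_int (sign \<sigma>) * kern lam w z :: 'k::field)"
proof -
  note p\<sigma> = col_group_permutes[OF assms(1)]
  have bij: "bij_betw (\<lambda>\<tau>. \<tau> \<circ> \<sigma>) (col_group lam) (col_group lam)"
    by (rule bij_betw_byWitness[of _ "\<lambda>\<tau>. \<tau> \<circ> inv \<sigma>"])
      (use assms col_group_comp col_group_inv permutes_inv_o[OF p\<sigma>] in \<open>auto simp: comp_assoc\<close>)
  have "kern lam w (permute_list \<sigma> z) = (\<Sum>\<tau>\<in>col_group lam. \<Sum>\<rho>\<in>row_group lam.
      of_int (sign (\<tau> \<circ> \<sigma>)) * (of_bool (permute_list (\<tau> \<circ> \<sigma>) (permute_list \<rho> w) = permute_list \<sigma> z) :: 'k))"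
    unfolding kern_def by (rule sum.reindex_bij_betw[OF bij, symmetric])
  also have "\<dots> = (\<Sum>\<tau>\<in>col_group lam. \<Sum>\<rho>\<in>row_group lam.
      of_int (sign \<sigma>) * (of_int (sign \<tau>) * of_bool (permute_list \<tau> (permute_list \<rho> w) = z)))"
  proof (intro sum.cong refl)
    fix \<tau> \<rho> assume \<tau>: "\<tau> \<in> col_group lam"
    have "sign (\<tau> \<circ> \<sigma>) = sign \<tau> * sign \<sigma>"
      using permutes_imp_permutation[OF _ col_group_permutes[OF \<tau>]] permutes_imp_permutation[OF _ p\<sigma>]
      by (simp add: sign_compose)
    moreover have "permute_list (\<tau> \<circ> \<sigma>) (permute_list \<rho> w) = permute_list \<sigma> z \<longleftrightarrow> permute_list \<tau> (permute_list \<rho> w) = z"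
    proof (cases "length z = sum_list lam")
      case True
      then show ?thesis
        using permute_list_compose[of \<sigma> "permute_list \<rho> w" \<tau>] assms(2) p\<sigma>
          permute_list_inj_iff[OF p\<sigma>, of "permute_list \<tau> (permute_list \<rho> w)" z] by simp
    next
      case False
      then show ?thesis using assms(2) by (metis length_permute_list)
    qed
    ultimately show "of_int (sign (\<tau> \<circ> \<sigma>)) * (of_bool (permute_list (\<tau> \<circ> \<sigma>) (permute_list \<rho> w) = permute_list \<sigma> z) :: 'k)
        = of_int (sign \<sigma>) * (of_int (sign \<tau>) * of_bool (permute_list \<tau> (permute_list \<rho> w) = z))"
      by (simp add: mult_ac)
  qed
  finally show ?thesis by (simp only: kern_def sum_distrib_left)
qed

section \<open>Columns and hook shapes\<close>

definition column :: "nat \<Rightarrow> nat list" where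
  "column j = replicate j 1"

lemma sum_column [simp]: "sum_list (column j) = j"
  by (simp add: column_def sum_list_replicate)

lemma part_at_column: "part_at (column j) r = (if r < j then 1 else 0)"
  by (simp add: part_at_def column_def)

lemma column_rowof: "i < j \<Longrightarrow> rowof (column j) i = i"
  using rowof_box[of i "column j" 0] by (simp add: box_def psum_def column_def sum_list_replicate)

lemma column_colof: "i < j \<Longrightarrow> colof (column j) i = 0"
  using colof_box[of i "column j" 0] by (simp add: box_def psum_def column_def sum_list_replicate)

lemma column_row_group: "row_group (column j) = {id}"
proof -
  have "\<sigma> = id" if "\<sigma> \<in> row_group (column j)" for \<sigma>
  proof
    fix i
    note p = row_group_permutes[OF that]
    show "\<sigma> i = id i"
    proof (cases "i < j")
      case True
      then show ?thesis using row_groupD[OF that, of i] permutes_lt[OF p, of i]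
        by (simp add: column_rowof)
    qed (use permutes_not_in[OF p] in simp)
  qed
  then show ?thesis by auto
qed

lemma column_col_group: "col_group (column j) = {\<sigma>. \<sigma> permutes {..<j}}"
  by (auto simp: col_group_def column_colof permutes_lt)

locale hook =
  fixes s l :: nat
  assumes s: "1 \<le> s"
begin

definition lam :: "nat list" where "lam = s # column l"

abbreviation "mu \<equiv> column (Suc l)"

lemma sum_lam: "sum_list lam = s + l"
  by (simp add: lam_def sum_column)

lemma hook_partition: "is_partition lam (s + l)"
  using s by (auto simp: is_partition_def lam_def column_def sum_list_replicate sorted_wrt_iff_nth_less nth_Cons split: nat.splits)

lemma part_at_hook: "part_at lam r = (if r = 0 then s else if r \<le> l then 1 else 0)"
  by (auto simp: part_at_def lam_def column_def nth_Cons split: nat.splits)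

lemma column_partition: "is_partition (column j) j"
  by (auto simp: is_partition_def column_def sorted_wrt_iff_nth_less sum_list_replicate)

lemma column_hstrips: "j = l \<or> j = Suc l \<Longrightarrow> column j \<in> hstrips lam"
  using s by (auto simp: hstrips_iff[OF hook_partition] column_partition part_at_hook part_at_column)

text \<open>If the first row has at most one box, so has every row. Interlacing then fixes rows
  before \<open>l\<close> at 1 and rows after \<open>l\<close> at 0, and only row \<open>l\<close>
  is free.\<close>

lemma hstrips_hook_cases:
  assumes "nu \<in> hstrips lam"
  shows "nu = column l \<or> nu = mu \<or> 2 \<le> part_at nu 0"
proof (rule ccontr)
  assume n: "\<not> ?thesis"
  have p: "is_partition nu (sum_list nu)" and b: "part_at lam (Suc r) \<le> part_at nu r \<and> part_at nu r \<le> part_at lam r" for r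
    using assms by (auto simp: hstrips_iff[OF hook_partition])
  have le1: "part_at nu r \<le> 1" for r using partition_antimono[OF p, of 0 r] n by simp
  have "part_at nu r = (if r < l then 1 else if r = l then part_at nu l else 0)" for r
    using b[of r] le1[of r] by (auto simp: part_at_hook split: if_splits)
  moreover have "part_at nu l = 0 \<or> part_at nu l = 1" using le1[of l] by linarith
  ultimately have "(\<forall>r. part_at nu r = part_at (column l) r) \<or> (\<forall>r. part_at nu r = part_at mu r)"
    unfolding part_at_column by (metis less_Suc_eq)
  then show False using partition_eqI[OF p column_partition] n by blast
qed

sublocale col: shape_pair lam mu
  by unfold_locales (use s in \<open>auto simp: part_at_hook part_at_column\<close>)

lemma strip_row: "j \<in> col.strip \<Longrightarrow> rowof lam j = 0"
proof -
  assume j: "j \<in> col.strip"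
  then have "j < sum_list lam" "part_at mu (rowof lam j) \<le> colof lam j" by (auto simp: col.strip_def)
  moreover have "colof lam j < part_at lam (rowof lam j)" by (rule colof_less_part_at) fact
  ultimately show "rowof lam j = 0" by (auto simp: part_at_hook part_at_column split: if_splits)
qed

text \<open>Every column of a hook other than the first is a single box.\<close>

lemma col_group_hook: "\<tau> \<in> col_group lam \<Longrightarrow> \<tau> \<in> col.ext ` col_group mu"
proof (rule col.col_group_fixing_strip)
  fix j assume \<tau>: "\<tau> \<in> col_group lam" and j: "j \<in> col.strip"
  have jn: "j < sum_list lam" using j by (simp add: col.strip_def)
  have tn: "\<tau> j < sum_list lam" by (rule permutes_lt[OF col_group_permutes[OF \<tau>] jn])
  have "1 \<le> colof lam j" using j strip_row[OF j] by (simp add: col.strip_def part_at_column)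
  then have c: "1 \<le> colof lam (\<tau> j)" using col_groupD[OF \<tau> jn] by simp
  have "colof lam (\<tau> j) < part_at lam (rowof lam (\<tau> j))" by (rule colof_less_part_at[OF tn])
  then have "rowof lam (\<tau> j) = 0" using c by (auto simp: part_at_hook split: if_splits)
  then show "\<tau> j = j" using row_col_eq[OF tn jn] strip_row[OF j] col_groupD[OF \<tau> jn] by simp
qed

text \<open>Here \<open>M\<close> may occur in \<open>x\<close>, because the target is an exterior
  power of all of P. It is the hook shape, not a rank comparison, that confines the column
  permutations. The diagonal entry is the order of the row stabilizer and depends on whether the
  corner carries \<open>M\<close>.\<close>

lemma kern_hook_column:
  fixes x :: "nat list"
  assumes x: "length x = Suc l" and z: "length z = Suc l"
  shows "kern lam (col.emb M x) (col.emb M z)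
    = (of_nat (card {\<rho> \<in> row_group lam. permute_list \<rho> (col.emb M x) = col.emb M x}) * kern mu x z :: 'k::field)"
proof -
  have sm: "sum_list mu = Suc l" by simp
  have N: "card {\<rho> \<in> row_group lam. permute_list \<rho> (col.emb M x) = col.emb M (permute_list (inv \<tau>) z)}
    = (if permute_list \<tau> x = z then card {\<rho> \<in> row_group lam. permute_list \<rho> (col.emb M x) = col.emb M x} else 0)"
    if \<tau>: "\<tau> \<in> col_group mu" for \<tau>
  proof -
    have p\<tau>: "\<tau> permutes {..<Suc l}" using col_group_permutes[OF \<tau>] sm by simp
    let ?y = "permute_list (inv \<tau>) z"
    have iff: "permute_list \<tau> x = z \<longleftrightarrow> ?y = x"
      using permute_list_eq_iff[of \<tau> z x] p\<tau> x z by auto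
    \<comment> \<open>A row permutation keeps the tabloid, the strip part cancels, and tabloids of a
      column determine the word.\<close>
    have "permute_list \<rho> (col.emb M x) \<noteq> col.emb M ?y" if \<rho>: "\<rho> \<in> row_group lam" and ne: "?y \<noteq> x" for \<rho>
    proof
      assume eq: "permute_list \<rho> (col.emb M x) = col.emb M ?y"
      note p\<rho> = row_group_permutes[OF \<rho>]
      have "tab lam (permute_list \<rho> (col.emb M x)) = image_mset (\<lambda>j. (rowof lam j, col.emb M x ! j)) (image_mset \<rho> (mset_set {..<sum_list lam}))"
        unfolding tab_def image_mset.compositionality o_def
        using row_groupD[OF \<rho>] p\<rho> by (intro image_mset_cong) (auto simp: permute_list_nth)
      then have "tab lam (col.emb M ?y) = tab lam (col.emb M x)"
        using permutes_image_mset[OF p\<rho>] eq by (simp add: tab_def)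
      then have "tab mu ?y = tab mu x"
        using col.tab_emb[of ?y M] col.tab_emb[of x M] x z sm by simp
      then obtain \<rho>' where "\<rho>' \<in> row_group mu" "x = permute_list \<rho>' ?y"
        using x z sm by (elim tab_eq_imp_row_group) simp_all
      then show False using ne column_row_group[of "Suc l"] by auto
    qed
    then show ?thesis unfolding iff by (auto simp: card_eq_0_iff)
  qed
  have "kern lam (col.emb M x) (col.emb M z) = (\<Sum>\<tau>\<in>col_group mu. of_int (sign \<tau>) *
    (of_nat (card {\<rho> \<in> row_group lam. permute_list \<rho> (col.emb M x) = col.emb M (permute_list (inv \<tau>) z)}) :: 'k))"
    by (rule col.kern_emb_via_ext) (use col_group_hook z sm in auto)
  also have "\<dots> = of_nat (card {\<rho> \<in> row_group lam. permute_list \<rho> (col.emb M x) = col.emb M x}) * kern mu x z"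
    unfolding kern_def column_row_group sum_distrib_left
    by (rule sum.cong[OF refl]) (simp add: N)
  finally show ?thesis .
qed

text \<open>The fillings \<open>col.emb M w\<close> map to multiples of generators of the exterior
  power; the factor \<open>q w\<close> varies with \<open>w\<close> and is divided out word by
  word.\<close>

lemma forget_column_surjective:
  fixes t :: "'k::field_char_0 tensor"
  assumes t: "t \<in> young_sym mu ` tens (Suc l) (Suc M)"
  shows "\<exists>v\<in>tens (sum_list lam) (Suc M). forget lam mu (Suc M) (young_sym lam v) = t"
proof -
  have sm: "sum_list mu = Suc l" by simp
  have mu: "mu \<in> hstrips lam" using column_hstrips by blast
  obtain y where y: "y \<in> tens (Suc l) (Suc M)" "t = young_sym mu y" using t by blast
  obtain c where "y = (\<lambda>x. \<Sum>w\<in>words (Suc l) (Suc M). c w * bt M w x)" by (rule tens_span_bt[OF y(1)])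
  then have t: "t = (\<lambda>x. \<Sum>w\<in>words (Suc l) (Suc M). c w * young_sym mu (bt M w) x)"
    using y(2) by (simp add: lin_sum[OF lin_young_sym])
  define q where "q x = (of_nat (card {\<rho> \<in> row_group lam. permute_list \<rho> (col.emb M x) = col.emb M x}) :: 'k)" for x
  have q: "q x \<noteq> 0" for x
  proof -
    have "id \<in> {\<rho> \<in> row_group lam. permute_list \<rho> (col.emb M x) = col.emb M x}" by simp
    then show ?thesis unfolding q_def of_nat_eq_0_iff by (metis (no_types, lifting) card_0_eq empty_iff finite_row_group finite_Collect_conjI mem_Collect_eq finite_subset subsetI)
  qed
  define v where "v = (\<lambda>x. \<Sum>w\<in>words (Suc l) (Suc M). (c w / q w) * bt M (col.emb M w) x)"
  have e: "col.emb M w \<in> words (sum_list lam) (Suc M)" if "w \<in> words (Suc l) (Suc M)" for w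
    using col.emb_words[of w "Suc M" M] that sm by simp
  have fw: "forget lam mu (Suc M) (young_sym lam (bt M (col.emb M w))) = (\<lambda>x. q w * young_sym mu (bt M w) x)"
    if w: "w \<in> words (Suc l) (Suc M)" for w
  proof -
    have w': "w \<in> words (sum_list mu) (Suc M)" using w sm by simp
    show ?thesis
      unfolding forget_young_sym_bt[OF mu e[OF w]] young_sym_bt[OF w'] sum_distrib_left
      using kern_hook_column[of w _ M, where 'k = 'k] w
      by (intro ext sum.cong) (auto simp: wordsD sm q_def mult.assoc)
  qed
  show ?thesis
  proof (rule bexI[of _ v])
    have "forget lam mu (Suc M) (young_sym lam v)
      = (\<lambda>x. \<Sum>w\<in>words (Suc l) (Suc M). (c w / q w) * forget lam mu (Suc M) (young_sym lam (bt M (col.emb M w))) x)"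
      unfolding v_def by (rule lin_sum[OF lin_comp[OF lin_forget lin_young_sym]]) simp
    then show "forget lam mu (Suc M) (young_sym lam v) = t"
      unfolding t using q by (simp add: fw)
    show "v \<in> tens (sum_list lam) (Suc M)" unfolding v_def by (rule tens_lincomb) (simp add: bt_tens e)
  qed
qed

text \<open>The coefficients \<open>g\<close> alternate under permutations of the slots, a property
  inherited from \<open>kern\<close>. So the antisymmetrizer multiplies the tensor by
  \<open>card ?S\<close>, which can be divided out in characteristic 0.\<close>

lemma forget_column_image:
  fixes v :: "'k::field_char_0 tensor"
  assumes v: "v \<in> tens (sum_list lam) (Suc M)"
  shows "forget lam mu (Suc M) (young_sym lam v) \<in> young_sym mu ` tens (Suc l) (Suc M)"
proof -
  have sm: "sum_list mu = Suc l" by simp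
  have mu: "mu \<in> hstrips lam" using column_hstrips by blast
  let ?W = "words (Suc l) (Suc M)" and ?S = "{\<sigma>. \<sigma> permutes {..<Suc l}}"
  obtain c where vc: "v = (\<lambda>x. \<Sum>w\<in>words (sum_list lam) (Suc M). c w * bt M w x)" by (rule tens_span_bt[OF v])
  define g where "g z = (\<Sum>w\<in>words (sum_list lam) (Suc M). c w * kern lam w (col.emb M z))" for z
  have F: "forget lam mu (Suc M) (young_sym lam v) = (\<lambda>x. \<Sum>z\<in>?W. g z * bt M z x)"
  proof -
    have "forget lam mu (Suc M) (young_sym lam v)
        = (\<lambda>x. \<Sum>w\<in>words (sum_list lam) (Suc M). c w * forget lam mu (Suc M) (young_sym lam (bt M w)) x)"
      unfolding vc by (rule lin_sum[OF lin_comp[OF lin_forget lin_young_sym]]) simp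
    also have "\<dots> = (\<lambda>x. \<Sum>z\<in>?W. g z * bt M z x)"
    proof
      fix x
      have "(\<Sum>w\<in>words (sum_list lam) (Suc M). c w * forget lam mu (Suc M) (young_sym lam (bt M w)) x)
          = (\<Sum>w\<in>words (sum_list lam) (Suc M). \<Sum>z\<in>?W. c w * kern lam w (col.emb M z) * bt M z x)"
        by (rule sum.cong[OF refl]) (simp only: forget_young_sym_bt[OF mu] sum_distrib_left sm mult.assoc)
      also have "\<dots> = (\<Sum>z\<in>?W. g z * bt M z x)"
        unfolding g_def sum_distrib_right by (rule sum.swap)
      finally show "(\<Sum>w\<in>words (sum_list lam) (Suc M). c w * forget lam mu (Suc M) (young_sym lam (bt M w)) x)
          = (\<Sum>z\<in>?W. g z * bt M z x)" .
    qed
    finally show ?thesis .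
  qed
  have alt: "g (permute_list \<tau> z) = of_int (sign \<tau>) * g z" if \<tau>: "\<tau> \<in> ?S" and z: "z \<in> ?W" for \<tau> z
  proof -
    have \<tau>c: "\<tau> \<in> col_group mu" using \<tau> column_col_group[of "Suc l"] by simp
    have "col.emb M (permute_list \<tau> z) = permute_list (col.ext \<tau>) (col.emb M z)"
      using \<tau> z sm by (intro col.emb_permute) (simp_all add: wordsD)
    moreover have "sign (col.ext \<tau>) = sign \<tau>" using \<tau> sm by (intro col.sign_ext) simp
    ultimately have "kern lam w (col.emb M (permute_list \<tau> z)) = (of_int (sign \<tau>) * kern lam w (col.emb M z) :: 'k)"
      if "w \<in> words (sum_list lam) (Suc M)" for w
      using kern_permute_col[OF col.ext_col_group[OF \<tau>c], of w "col.emb M z", where 'k = 'k] that by (simp add: wordsD)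
    then show ?thesis by (simp add: g_def sum_distrib_left mult.left_commute)
  qed
  have "young_sym mu (\<lambda>x. \<Sum>z\<in>?W. g z * bt M z x) = (\<lambda>x. of_nat (card ?S) * (\<Sum>z\<in>?W. g z * bt M z x))"
  proof
    fix x
    have ysb: "young_sym mu (bt M z) x = (\<Sum>\<tau>\<in>?S. of_int (sign \<tau>) * (bt M (permute_list \<tau> z) x :: 'k))" if "z \<in> ?W" for z
    proof -
      have "rperm (bt M z) \<tau> = (bt M (permute_list \<tau> z) :: 'k tensor)" if "\<tau> \<in> ?S" for \<tau>
        using rperm_bt[of \<tau> "Suc l" z M] that \<open>z \<in> ?W\<close> by (simp add: wordsD)
      moreover have "rperm (bt M z) id = (bt M z :: 'k tensor)" by (simp add: rperm_def)
      ultimately show ?thesis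
        unfolding young_sym_eq column_col_group[of "Suc l"] column_row_group[of "Suc l"] by simp
    qed
    have "young_sym mu (\<lambda>x. \<Sum>z\<in>?W. g z * bt M z x) x = (\<Sum>z\<in>?W. \<Sum>\<tau>\<in>?S. g z * (of_int (sign \<tau>) * bt M (permute_list \<tau> z) x))"
      by (simp add: lin_sum[OF lin_young_sym] ysb sum_distrib_left)
    also have "\<dots> = (\<Sum>\<tau>\<in>?S. \<Sum>z\<in>?W. g z * (of_int (sign \<tau>) * bt M (permute_list \<tau> z) x))" by (rule sum.swap)
    also have "\<dots> = (\<Sum>\<tau>\<in>?S. \<Sum>z\<in>?W. g z * bt M z x)"
    proof (rule sum.cong[OF refl])
      fix \<tau> assume \<tau>: "\<tau> \<in> ?S"
      have inv: "inv \<tau> \<in> ?S" using \<tau> permutes_inv by blast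
      have bij: "bij_betw (permute_list \<tau>) ?W ?W"
      proof (rule bij_betw_byWitness[of _ "permute_list (inv \<tau>)"])
        have "permute_list (inv \<sigma>) (permute_list \<sigma> z) = z" if "\<sigma> \<in> ?S" "z \<in> ?W" for \<sigma> z
          using permute_list_compose[of "inv \<sigma>" z \<sigma>] that permutes_inv[of \<sigma> "{..<Suc l}"] permutes_inv_o(1)[of \<sigma> "{..<Suc l}"] by (simp add: wordsD)
        from this[OF \<tau>] this[OF inv]
        show "\<forall>a\<in>?W. permute_list (inv \<tau>) (permute_list \<tau> a) = a" "\<forall>a\<in>?W. permute_list \<tau> (permute_list (inv \<tau>) a) = a"
          using \<tau> by (simp_all add: permutes_inv_inv)
      qed (use \<tau> inv permute_words in auto)
      have "(\<Sum>z\<in>?W. g z * bt M z x) = (\<Sum>z\<in>?W. g (permute_list \<tau> z) * bt M (permute_list \<tau> z) x)"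
        by (rule sum.reindex_bij_betw[OF bij, symmetric])
      also have "\<dots> = (\<Sum>z\<in>?W. g z * (of_int (sign \<tau>) * bt M (permute_list \<tau> z) x))"
        using alt[OF \<tau>] by (intro sum.cong) (auto simp: mult_ac)
      finally show "(\<Sum>z\<in>?W. g z * (of_int (sign \<tau>) * bt M (permute_list \<tau> z) x)) = (\<Sum>z\<in>?W. g z * bt M z x)" ..
    qed
    also have "\<dots> = of_nat (card ?S) * (\<Sum>z\<in>?W. g z * bt M z x)" by simp
    finally show "young_sym mu (\<lambda>x. \<Sum>z\<in>?W. g z * bt M z x) x = of_nat (card ?S) * (\<Sum>z\<in>?W. g z * bt M z x)" .
  qed
  then have "young_sym mu (\<lambda>x. (1 / of_nat (card ?S)) * (\<Sum>z\<in>?W. g z * bt M z x))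
      = (\<lambda>x. (1 / of_nat (card ?S)) * (of_nat (card ?S) * (\<Sum>z\<in>?W. g z * bt M z x)))"
    using lin_young_sym[of mu, where 'k = 'k] by (simp only: lin_def)
  moreover have "of_nat (card ?S) \<noteq> (0 :: 'k)"
    by (simp add: card_permutations del: fact_Suc)
  ultimately have "young_sym mu (\<lambda>x. \<Sum>z\<in>?W. (g z / of_nat (card ?S)) * bt M z x) = forget lam mu (Suc M) (young_sym lam v)"
    unfolding F by (simp add: sum_distrib_left)
  moreover have "(\<lambda>x. \<Sum>z\<in>?W. (g z / of_nat (card ?S)) * bt M z x) \<in> tens (Suc l) (Suc M)"
    by (rule tens_lincomb) (simp add: bt_tens)
  ultimately show ?thesis by (rule image_eqI[OF sym])
qed

text \<open>Forgetting down to the shorter column is forgetting down to \<open>mu\<close> and then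
  dropping the last slot. So one map to an exterior power of P controls both column
  components.\<close>

lemma forget_short_column:
  assumes "forget lam mu m v = (\<lambda>_. 0)"
  shows "forget lam (column l) m v = (\<lambda>_. 0 :: 'k::field)"
proof -
  have sm: "sum_list mu = Suc l" "sum_list (column l) = l" by simp_all
  have sub: "sel col.inc (Suc l) ` words (sum_list lam) m \<subseteq> words (Suc l) m"
    using sel_words[of _ "sum_list lam" m col.inc "Suc l"] col.inc_range sm by auto
  have inc: "shape_pair.inc lam (column l) i = col.inc i" if "i < l" for i
  proof -
    interpret sh: shape_pair lam "column l" by (rule hstrip_shape_pair) (use column_hstrips in blast)
    show ?thesis using that column_rowof[of i l] column_colof[of i l] column_rowof[of i "Suc l"] column_colof[of i "Suc l"]
      by (simp add: sh.inc_def col.inc_def)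
  qed
  have "pf (sel id l) (words (Suc l) m) (forget lam mu m v) = pf (\<lambda>x. sel id l (sel col.inc (Suc l) x)) (words (sum_list lam) m) v"
    unfolding forget_def pull_def sm by (rule pf_comp) (use sub in auto)
  also have "\<dots> = forget lam (column l) m v"
    unfolding forget_def pull_def sm
    by (rule pf_cong, rule nth_equalityI) (auto simp: inc)
  finally show ?thesis using assms by (simp add: pf_def fun_eq_iff)
qed

end

section \<open>The isomorphisms\<close>

text \<open>Indices are added by increasing rank. The correction for a new index vanishes in all
  components of smaller or equal rank, so what has been achieved is kept.\<close>

lemma triangular_simultaneous_surj:
  fixes \<Phi> :: "'i \<Rightarrow> ('a \<Rightarrow> 'k::field) \<Rightarrow> 'b \<Rightarrow> 'k" and rank :: "'i \<Rightarrow> nat"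
  assumes "finite I"
    and lin: "\<And>i. i \<in> I \<Longrightarrow> lin (\<Phi> i)"
    and U0: "(\<lambda>_. 0) \<in> U" and Uadd: "\<And>x y. x \<in> U \<Longrightarrow> y \<in> U \<Longrightarrow> (\<lambda>z. x z + y z) \<in> U"
    and into: "\<And>i u. i \<in> I \<Longrightarrow> u \<in> U \<Longrightarrow> \<Phi> i u \<in> T i"
    and Tdiff: "\<And>i x y. i \<in> I \<Longrightarrow> x \<in> T i \<Longrightarrow> y \<in> T i \<Longrightarrow> (\<lambda>z. x z + (-1) * y z) \<in> T i"
    and surj: "\<And>i t. i \<in> I \<Longrightarrow> t \<in> T i \<Longrightarrow>
      \<exists>u\<in>U. \<Phi> i u = t \<and> (\<forall>j\<in>I. j \<noteq> i \<longrightarrow> rank j \<le> rank i \<longrightarrow> \<Phi> j u = (\<lambda>_. 0))"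
    and t: "\<And>i. i \<in> I \<Longrightarrow> t i \<in> T i"
  shows "\<exists>u\<in>U. \<forall>i\<in>I. \<Phi> i u = t i"
proof -
  have "J \<subseteq> I \<longrightarrow> (\<exists>u\<in>U. \<forall>i\<in>J. \<Phi> i u = t i)" if "finite J" for J
    using that
  proof (induction J rule: finite_ranking_induct[where f = rank])
    case empty
    then show ?case using U0 by blast
  next
    case (insert i J)
    show ?case
    proof (cases "i \<in> J")
      case True
      then show ?thesis using insert by (simp add: insert_absorb)
    next
      case False
      show ?thesis
      proof
        assume sub: "insert i J \<subseteq> I"
        then obtain u where u: "u \<in> U" "\<forall>j\<in>J. \<Phi> j u = t j" using insert by blast
        have i: "i \<in> I" using sub by blast
        have "(\<lambda>z. t i z + (-1) * \<Phi> i u z) \<in> T i" using t into Tdiff i u by blast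
        then obtain v where v: "v \<in> U" "\<Phi> i v = (\<lambda>z. t i z + (-1) * \<Phi> i u z)"
          "\<forall>j\<in>I. j \<noteq> i \<longrightarrow> rank j \<le> rank i \<longrightarrow> \<Phi> j v = (\<lambda>_. 0)" using surj[OF i] by blast
        have add: "\<Phi> j (\<lambda>z. u z + v z) = (\<lambda>z. \<Phi> j u z + \<Phi> j v z)" if "j \<in> I" for j
          using lin[OF that] by (simp add: lin_def)
        have "\<Phi> j (\<lambda>z. u z + v z) = t j" if j: "j \<in> insert i J" for j
        proof (cases "j = i")
          case True
          then show ?thesis using add[OF i] v(2) by simp
        next
          case False
          then have "j \<in> J" "j \<in> I" "rank j \<le> rank i" using j sub insert by auto
          then show ?thesis using add v(3) u(2) False by simp
        qed
        then show "\<exists>u\<in>U. \<forall>j\<in>insert i J. \<Phi> j u = t j" using Uadd[OF u(1) v(1)] by blast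
      qed
    qed
  qed
  then show ?thesis using assms(1) by blast
qed

lemma fa_iso_dsumI:
  fixes A :: "('a \<Rightarrow> 'k::field) famod" and B :: "'i \<Rightarrow> ('b \<Rightarrow> 'k) famod" and rank :: "'i \<Rightarrow> nat"
  assumes fin: "finite I"
    and lin: "\<And>i m. i \<in> I \<Longrightarrow> lin (\<Phi> i m)"
    and A0: "\<And>m. (\<lambda>_. 0) \<in> obj A m"
    and Alin: "\<And>m x y c. x \<in> obj A m \<Longrightarrow> y \<in> obj A m \<Longrightarrow> (\<lambda>z. x z + c * y z) \<in> obj A m"
    and Blin: "\<And>m i x y c. i \<in> I \<Longrightarrow> x \<in> obj (B i) m \<Longrightarrow> y \<in> obj (B i) m \<Longrightarrow> (\<lambda>z. x z + c * y z) \<in> obj (B i) m"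
    and into: "\<And>i m u. i \<in> I \<Longrightarrow> u \<in> obj A m \<Longrightarrow> \<Phi> i m u \<in> obj (B i) m"
    and nat: "\<And>i m m' f u. i \<in> I \<Longrightarrow> fa_map f m m' \<Longrightarrow> u \<in> obj A m \<Longrightarrow>
      \<Phi> i m' (act A f m m' u) = act (B i) f m m' (\<Phi> i m u)"
    and inj: "\<And>m u. u \<in> obj A m \<Longrightarrow> (\<And>i. i \<in> I \<Longrightarrow> \<Phi> i m u = (\<lambda>_. 0)) \<Longrightarrow> u = (\<lambda>_. 0)"
    and surj: "\<And>m i t. i \<in> I \<Longrightarrow> t \<in> obj (B i) m \<Longrightarrow>
      \<exists>u\<in>obj A m. \<Phi> i m u = t \<and> (\<forall>j\<in>I. j \<noteq> i \<longrightarrow> rank j \<le> rank i \<longrightarrow> \<Phi> j m u = (\<lambda>_. 0))"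
  shows "fa_iso A (fa_dsum I B)"
proof -
  define \<phi> where "\<phi> m u = (\<lambda>(i, a). if i \<in> I then \<Phi> i m u a else 0)" for m u
  have comp: "(\<lambda>a. \<phi> m u (i, a)) = \<Phi> i m u" if "i \<in> I" for i m u
    using that by (simp add: \<phi>_def)
  have obj: "u \<in> obj (fa_dsum I B) m \<longleftrightarrow> (\<forall>i\<in>I. (\<lambda>a. u (i, a)) \<in> obj (B i) m) \<and> (\<forall>i a. i \<notin> I \<longrightarrow> u (i, a) = 0)" for u m
    by (simp add: fa_dsum_def)
  have "bij_betw (\<phi> m) (obj A m) (obj (fa_dsum I B) m)" for m
    unfolding bij_betw_def
  proof (intro conjI inj_onI set_eqI iffI)
    fix x y assume xy: "x \<in> obj A m" "y \<in> obj A m" "\<phi> m x = \<phi> m y"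
    have "(\<lambda>z. x z + (-1) * y z) = (\<lambda>_. 0)"
    proof (rule inj[OF Alin[OF xy(1,2)]])
      fix i assume i: "i \<in> I"
      have "\<Phi> i m x = \<Phi> i m y" using comp[OF i, of m x] comp[OF i, of m y] xy(3) by simp
      moreover have "\<Phi> i m (\<lambda>z. x z + (-1) * y z) = (\<lambda>z. \<Phi> i m x z + \<Phi> i m (\<lambda>z. (-1) * y z) z)"
        by (rule lin_add[OF lin[OF i]])
      moreover have "\<Phi> i m (\<lambda>z. (-1) * y z) = (\<lambda>z. (-1) * \<Phi> i m y z)"
        by (rule lin_scale[OF lin[OF i]])
      ultimately show "\<Phi> i m (\<lambda>z. x z + (-1) * y z) = (\<lambda>_. 0)" by simp
    qed
    then show "x = y" by (auto simp: fun_eq_iff)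
  next
    fix u assume "u \<in> \<phi> m ` obj A m"
    then show "u \<in> obj (fa_dsum I B) m" using into comp by (auto simp: obj \<phi>_def)
  next
    fix u assume "u \<in> obj (fa_dsum I B) m"
    then have u: "\<And>i. i \<in> I \<Longrightarrow> (\<lambda>a. u (i, a)) \<in> obj (B i) m" "\<And>i a. i \<notin> I \<Longrightarrow> u (i, a) = 0" by (auto simp: obj)
    have "\<exists>x\<in>obj A m. \<forall>i\<in>I. \<Phi> i m x = (\<lambda>a. u (i, a))"
    proof (rule triangular_simultaneous_surj[OF fin, where rank = rank and T = "\<lambda>i. obj (B i) m"])
      show "(\<lambda>z. x z + y z) \<in> obj A m" if "x \<in> obj A m" "y \<in> obj A m" for x y
        using Alin[OF that, of 1] by simp
      show "(\<lambda>z. x z + (-1) * y z) \<in> obj (B i) m" if "i \<in> I" "x \<in> obj (B i) m" "y \<in> obj (B i) m" for i x y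
        by (rule Blin[OF that])
    qed (use lin A0 into surj u in auto)
    then obtain x where x: "x \<in> obj A m" "\<forall>i\<in>I. \<Phi> i m x = (\<lambda>a. u (i, a))" by blast
    have "\<phi> m x = u" using x(2) u(2) by (auto simp: \<phi>_def fun_eq_iff)
    then show "u \<in> \<phi> m ` obj A m" using x(1) by blast
  qed
  moreover have "\<phi> m (\<lambda>z. x z + y z) = (\<lambda>z. \<phi> m x z + \<phi> m y z)" for m x y
    using lin by (auto simp: \<phi>_def fun_eq_iff lin_def)
  moreover have "\<phi> m (\<lambda>z. c * x z) = (\<lambda>z. c * \<phi> m x z)" for m x c
    using lin by (auto simp: \<phi>_def fun_eq_iff lin_def)
  moreover have "\<phi> m' (act A f m m' x) = act (fa_dsum I B) f m m' (\<phi> m x)"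
    if "fa_map f m m'" "x \<in> obj A m" for m m' f x
    using nat[OF _ that] comp[of _ m x] by (auto simp: fun_eq_iff fa_dsum_def \<phi>_def)
  ultimately show ?thesis unfolding fa_iso_def by (intro exI[of _ \<phi>]) blast
qed

section \<open>The values of the functors as subspaces\<close>

lemma image_subspace:
  assumes "lin T" "x \<in> T ` V" "y \<in> T ` V" "\<And>x y. x \<in> V \<Longrightarrow> y \<in> V \<Longrightarrow> (\<lambda>z. x z + c * y z) \<in> V"
  shows "(\<lambda>z. x z + c * y z) \<in> T ` V"
proof -
  obtain a b where ab: "a \<in> V" "b \<in> V" "x = T a" "y = T b" using assms(2,3) by blast
  have "T (\<lambda>z. a z + c * b z) = (\<lambda>z. T a z + T (\<lambda>z. c * b z) z)" by (rule lin_add[OF assms(1)])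
  also have "T (\<lambda>z. c * b z) = (\<lambda>z. c * T b z)" by (rule lin_scale[OF assms(1)])
  finally have "(\<lambda>z. x z + c * y z) = T (\<lambda>z. a z + c * b z)" using ab by simp
  then show ?thesis using assms(4)[OF ab(1,2)] by blast
qed

lemma tens_subspace: "x \<in> tens n m \<Longrightarrow> y \<in> tens n m \<Longrightarrow> (\<lambda>z. x z + c * y z) \<in> tens n m"
  by (auto simp: tens_iff)

lemma tens_0: "0 < n \<Longrightarrow> v \<in> tens n 0 \<Longrightarrow> v = (\<lambda>_. 0)"
  by (force simp: tens_iff words_def fun_eq_iff)

lemma tpow_Pbar_subspace:
  assumes "0 < k" "x \<in> tpow Pbar k m" "y \<in> tpow Pbar k m"
  shows "(\<lambda>z. x z + c * y z) \<in> tpow Pbar k m"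
\<comment> \<open>The empty set has no letter to serve as \<open>M\<close>, but tensors of positive
  rank vanish there.\<close>
proof (cases m)
  case 0
  have "v = (\<lambda>_. 0)" if "v \<in> tpow Pbar k 0" for v :: "'a tensor"
    using that tpow_Pbar_tens[of k 0] tens_0[OF assms(1)] by blast
  then have "x = (\<lambda>_. 0)" "y = (\<lambda>_. 0)" using assms(2,3) 0 by auto
  then show ?thesis using assms(2) by simp
next
  case (Suc M)
  have "(\<lambda>z. \<Sum>b\<in>{True, False}. (if b then 1 else c) * (if b then x else y) z) \<in> bspan k M"
    by (rule bspan_lincomb) (use assms Suc in \<open>auto simp: tpow_Pbar_eq_bspan\<close>)
  then show ?thesis using Suc by (simp add: tpow_Pbar_eq_bspan)
qed

lemma obj_S_P: "obj (S_P lam) m = young_sym lam ` tens (sum_list lam) m"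
  by (simp add: S_P_def schur_def tmod_def tpow_PFA)

lemma act_S_P: "act (S_P lam) = push"
  by (simp add: S_P_def schur_def tmod_def)

lemma act_S_Pbar: "act (S_Pbar nu) = push"
  by (simp add: S_Pbar_def schur_def tmod_def)

lemma obj_S_Pbar: "0 < sum_list nu \<Longrightarrow> obj (S_Pbar nu) m = young_sym nu ` tpow Pbar (sum_list nu) m"
  by (simp add: S_Pbar_def schur_def tmod_def Pbar_pow_def del: sum_list_eq_0_iff)

lemma obj_Lambda_P: "obj (Lambda_P k) m = young_sym (column k) ` tens k m"
  unfolding Lambda_P_def schur_def tmod_def tpow_PFA column_def[symmetric] by simp

lemma act_Lambda_P: "act (Lambda_P k) = push"
  by (simp add: Lambda_P_def schur_def tmod_def)

lemma row_two_size: "2 \<le> part_at nu 0 \<Longrightarrow> 2 \<le> sum_list nu"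
  using box_less[of 0 nu 1] by (auto simp: part_at_def box_def psum_def split: if_splits)

lemma young_sym_tens: "v \<in> tens (sum_list lam) m \<Longrightarrow> young_sym lam v \<in> tens (sum_list lam) m"
  using natural_young_sym[of lam] unfolding natural_def by blast

definition is_retraction :: "nat list \<Rightarrow> (nat \<Rightarrow> 'k::field tensor \<Rightarrow> 'k tensor) \<Rightarrow> bool" where
  "is_retraction nu T \<longleftrightarrow> natural (sum_list nu) (sum_list nu) T \<and>
    (\<forall>m. \<forall>v\<in>tens (sum_list nu) m. T m v \<in> young_sym nu ` tpow Pbar (sum_list nu) m) \<and>
    (\<forall>M. \<forall>w\<in>words (sum_list nu) M. T (Suc M) (young_sym nu (bt M w)) = young_sym nu (bt M w))"

lemma is_retraction_exists:
  "2 \<le> part_at nu 0 \<Longrightarrow> \<exists>T :: nat \<Rightarrow> 'k::field_char_0 tensor \<Rightarrow> 'k tensor. is_retraction nu T"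
  unfolding is_retraction_def by (rule retraction_exists[where 'k = 'k]) blast+

lemma retraction_bspan:
  assumes T: "is_retraction nu T" and t: "t \<in> young_sym nu ` bspan (sum_list nu) M"
  shows "T (Suc M) t = t"
proof -
  obtain c where "t = young_sym nu (\<lambda>x. \<Sum>w\<in>words (sum_list nu) M. c w * bt M w x)" using t by (auto simp: bspan_def)
  then have t: "t = (\<lambda>x. \<Sum>w\<in>words (sum_list nu) M. c w * young_sym nu (bt M w) x)"
    by (simp add: lin_sum[OF lin_young_sym])
  have "lin (T (Suc M))" using T by (simp add: is_retraction_def natural_def)
  then have "T (Suc M) t = (\<lambda>x. \<Sum>w\<in>words (sum_list nu) M. c w * T (Suc M) (young_sym nu (bt M w)) x)"
    unfolding t by (rule lin_sum) simp
  then show ?thesis using T by (simp add: t is_retraction_def)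
qed

lemma component_natural:
  assumes T: "natural (sum_list nu) (sum_list nu) T" and nu: "nu \<in> hstrips lam"
    and f: "fa_map f m m'" and u: "u \<in> obj (S_P lam) m"
  shows "T m' (forget lam nu m' (push f m m' u)) = push f m m' (T m (forget lam nu m u))"
proof -
  have "u \<in> tens (sum_list lam) m" using u young_sym_tens by (auto simp: obj_S_P)
  then show ?thesis
    using natural_comp[OF natural_forget[OF nu] T] f unfolding natural_def by simp
qed

lemma component_into:
  assumes T: "is_retraction nu T" and nu: "nu \<in> hstrips lam" and nu2: "2 \<le> part_at nu 0"
    and u: "u \<in> obj (S_P lam) m"
  shows "T m (forget lam nu m u) \<in> obj (S_Pbar nu) m"
proof -
  have "u \<in> tens (sum_list lam) m" using u young_sym_tens by (auto simp: obj_S_P)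
  then have "forget lam nu m u \<in> tens (sum_list nu) m"
    using natural_forget[OF nu] unfolding natural_def by blast
  then show ?thesis using T row_two_size[OF nu2] by (simp add: obj_S_Pbar is_retraction_def)
qed

lemma component_surjective:
  fixes t :: "'k::field_char_0 tensor"
  assumes lam: "is_partition lam n" and nu: "nu \<in> hstrips lam" and nu2: "2 \<le> part_at nu 0"
    and T: "is_retraction nu T" and t: "t \<in> obj (S_Pbar nu) (Suc M)"
  shows "\<exists>u\<in>obj (S_P lam) (Suc M). T (Suc M) (forget lam nu (Suc M) u) = t \<and>
    (\<forall>mu\<in>hstrips lam. mu \<noteq> nu \<longrightarrow> hrank lam mu \<le> hrank lam nu \<longrightarrow> forget lam mu (Suc M) u = (\<lambda>_. 0))"
proof -
  have t': "t \<in> young_sym nu ` bspan (sum_list nu) M"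
    using t row_two_size[OF nu2] by (simp add: obj_S_Pbar tpow_Pbar_eq_bspan)
  show ?thesis
    using schur_surjective[OF lam nu t'] retraction_bspan[OF T t'] unfolding obj_S_P by blast
qed

lemma obj_S_P_zero: "(\<lambda>_. 0) \<in> obj (S_P lam) m"
proof -
  have "(\<lambda>_. 0) \<in> tens (sum_list lam) m" by (simp add: tens_iff)
  moreover have "(\<lambda>_. 0) = young_sym lam (\<lambda>_. 0)" by (rule lin_zero[OF lin_young_sym, symmetric])
  ultimately show ?thesis unfolding obj_S_P by (intro image_eqI[of _ "young_sym lam" "\<lambda>_. 0"])
qed

lemma obj_S_P_subspace:
  "x \<in> obj (S_P lam) m \<Longrightarrow> y \<in> obj (S_P lam) m \<Longrightarrow> (\<lambda>z. x z + c * y z) \<in> obj (S_P lam) m"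
  unfolding obj_S_P by (rule image_subspace[OF lin_young_sym]) (auto intro: tens_subspace)

lemma obj_S_Pbar_subspace:
  assumes "2 \<le> part_at nu 0"
  shows "x \<in> obj (S_Pbar nu) m \<Longrightarrow> y \<in> obj (S_Pbar nu) m \<Longrightarrow> (\<lambda>z. x z + c * y z) \<in> obj (S_Pbar nu) m"
proof -
  have k: "0 < sum_list nu" using row_two_size[OF assms] by simp
  show "x \<in> obj (S_Pbar nu) m \<Longrightarrow> y \<in> obj (S_Pbar nu) m \<Longrightarrow> (\<lambda>z. x z + c * y z) \<in> obj (S_Pbar nu) m"
    unfolding obj_S_Pbar[OF k] by (rule image_subspace[OF lin_young_sym]) (auto intro: tpow_Pbar_subspace[OF k])
qed

lemma obj_S_P_0: "0 < sum_list lam \<Longrightarrow> u \<in> obj (S_P lam) 0 \<Longrightarrow> u = (\<lambda>_. 0)"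
  using tens_0[of "sum_list lam" u] young_sym_tens[of _ lam 0] unfolding obj_S_P by blast

lemma obj_S_Pbar_0: "2 \<le> part_at nu 0 \<Longrightarrow> u \<in> obj (S_Pbar nu) 0 \<Longrightarrow> u = (\<lambda>_. 0)"
  using row_two_size[of nu] tens_0[of "sum_list nu"] young_sym_tens[of _ nu 0] tpow_Pbar_tens[of "sum_list nu" 0]
  by (auto simp: obj_S_Pbar)

lemma nonhook_iso:
  assumes n: "1 \<le> n" and lam: "is_partition lam n" and nh: "\<not> is_hook lam n"
  shows "fa_iso (S_P lam :: 'k::field_char_0 tensor famod) (fa_dsum (hstrips lam) S_Pbar)"
proof -
  have nsum: "sum_list lam = n" using lam by (simp add: is_partition_def)
  \<comment> \<open>If the first row of \<open>nu\<close> had at most one box, interlacing would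
    leave at most one in the second row of \<open>lam\<close>, making it a hook. So every component
    of a non-hook has a retraction.\<close>
  have two: "2 \<le> part_at nu 0" if nu: "nu \<in> hstrips lam" for nu
  proof (rule ccontr)
    assume "\<not> 2 \<le> part_at nu 0"
    then have le: "part_at lam (Suc 0) \<le> 1" using nu by (auto simp: hstrips_iff[OF lam] intro: order_trans)
    obtain s xs where lx: "lam = s # xs" using n nsum by (cases lam) auto
    have "x = 1" if "x \<in> set xs" for x
    proof -
      obtain i where i: "i < length xs" "xs ! i = x" using \<open>x \<in> set xs\<close> by (auto simp: in_set_conv_nth)
      have "part_at lam (Suc i) \<le> 1" using partition_antimono[OF lam, of "Suc 0" "Suc i"] le by simp
      moreover have "0 < x" using lam lx \<open>x \<in> set xs\<close> by (auto simp: is_partition_def)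
      ultimately show ?thesis using i lx by (simp add: part_at_def)
    qed
    then have xs: "xs = replicate (length xs) 1" by (simp add: replicate_eqI)
    have "sum_list xs = length xs" using arg_cong[OF xs, of sum_list] by (simp add: sum_list_replicate)
    then have "n = s + length xs" using nsum lx by simp
    moreover have "1 \<le> s" using lam lx by (auto simp: is_partition_def)
    ultimately have "is_hook lam n" unfolding is_hook_def using lx xs by (intro exI[of _ s]) auto
    then show False using nh by simp
  qed
  obtain T :: "nat list \<Rightarrow> nat \<Rightarrow> 'k tensor \<Rightarrow> 'k tensor" where T: "\<And>nu. nu \<in> hstrips lam \<Longrightarrow> is_retraction nu (T nu)"
    using is_retraction_exists[OF two, where 'k = 'k] by metis
  have natT: "natural (sum_list nu) (sum_list nu) (T nu)" if "nu \<in> hstrips lam" for nu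
    using T[OF that] by (simp add: is_retraction_def)
  have linT: "lin (T nu m)" if "nu \<in> hstrips lam" for nu m
    using natT[OF that] by (simp add: natural_def)
  have lin\<Phi>: "lin (\<lambda>u. T nu m (forget lam nu m u))" if "nu \<in> hstrips lam" for nu m
    by (rule lin_comp[OF linT[OF that] lin_forget])
  show ?thesis
  proof (rule fa_iso_dsumI[where \<Phi> = "\<lambda>nu m u. T nu m (forget lam nu m u)" and rank = "hrank lam", OF finite_hstrips[OF lam] lin\<Phi>])
    fix m u assume u: "u \<in> obj (S_P lam :: 'k tensor famod) m" and zero: "\<And>nu. nu \<in> hstrips lam \<Longrightarrow> T nu m (forget lam nu m u) = (\<lambda>_. 0)"
    show "u = (\<lambda>_. 0)"
    proof (cases m)
      case 0
      then show ?thesis using obj_S_P_0[of lam u] u n nsum by simp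
    next
      case (Suc M)
      obtain v where v: "v \<in> tens (sum_list lam) (Suc M)" "u = young_sym lam v" using u Suc by (auto simp: obj_S_P)
      show ?thesis unfolding v(2)
      proof (rule schur_injective[OF lam, where post = "\<lambda>nu. T nu (Suc M)"])
        show "T nu (Suc M) (young_sym nu (bt M w)) = young_sym nu (bt M w)"
          if "nu \<in> hstrips lam" "w \<in> words (sum_list nu) M" for nu w
          using T that by (simp add: is_retraction_def)
      qed (use v linT zero Suc in auto)
    qed
  next
    fix m nu t assume nu: "nu \<in> hstrips lam" and t: "t \<in> obj (S_Pbar nu :: 'k tensor famod) m"
    show "\<exists>u\<in>obj (S_P lam) m. T nu m (forget lam nu m u) = t \<and>
      (\<forall>mu\<in>hstrips lam. mu \<noteq> nu \<longrightarrow> hrank lam mu \<le> hrank lam nu \<longrightarrow> T mu m (forget lam mu m u) = (\<lambda>_. 0))"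
    proof (cases m)
      case 0
      then have "t = (\<lambda>_. 0)" using obj_S_Pbar_0[OF two[OF nu]] t by blast
      then show ?thesis using lin_zero[OF lin\<Phi>] nu by (intro bexI[OF _ obj_S_P_zero]) auto
    next
      case (Suc M)
      obtain u where u: "u \<in> obj (S_P lam) (Suc M)" "T nu (Suc M) (forget lam nu (Suc M) u) = t"
        "\<forall>mu\<in>hstrips lam. mu \<noteq> nu \<longrightarrow> hrank lam mu \<le> hrank lam nu \<longrightarrow> forget lam mu (Suc M) u = (\<lambda>_. 0)"
        using component_surjective[OF lam nu two[OF nu] T[OF nu] t[unfolded Suc]] by blast
      have "T mu (Suc M) (forget lam mu (Suc M) u) = (\<lambda>_. 0)"
        if "mu \<in> hstrips lam" "mu \<noteq> nu" "hrank lam mu \<le> hrank lam nu" for mu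
        using u(3) that lin_zero[OF linT[OF that(1)]] by simp
      then show ?thesis using u(1,2) Suc by blast
    qed
  next
    show "(\<lambda>z. x z + c * y z) \<in> obj (S_Pbar nu) m"
      if "nu \<in> hstrips lam" "x \<in> obj (S_Pbar nu) m" "y \<in> obj (S_Pbar nu) m" for m nu c and x y :: "'k tensor"
      by (rule obj_S_Pbar_subspace[OF two[OF that(1)] that(2,3)])
    show "T nu m (forget lam nu m u) \<in> obj (S_Pbar nu) m"
      if "nu \<in> hstrips lam" "u \<in> obj (S_P lam) m" for m nu u
      by (rule component_into[OF T[OF that(1)] that(1) two[OF that(1)] that(2)])
    show "T nu m' (forget lam nu m' (act (S_P lam) f m m' u)) = act (S_Pbar nu) f m m' (T nu m (forget lam nu m u))"
      if "nu \<in> hstrips lam" "fa_map f m m'" "u \<in> obj (S_P lam) m" for m m' f nu u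
      unfolding act_S_P act_S_Pbar by (rule component_natural[OF natT[OF that(1)] that])
  qed (assumption, rule obj_S_P_zero, rule obj_S_P_subspace)
qed

section \<open>The hook case\<close>

context hook begin

text \<open>The column components come first in the order, so the exterior power can be split off in one block.\<close>

lemma hrank_column_le:
  assumes nu: "nu \<in> hstrips lam" and two: "2 \<le> part_at nu 0"
  shows "hrank lam mu \<le> hrank lam nu"
proof -
  have H: "is_partition nu (sum_list nu)" "\<And>r. part_at lam (Suc r) \<le> part_at nu r" "\<forall>r. part_at nu r \<le> part_at lam r"
    using nu by (auto simp: hstrips_iff[OF hook_partition])
  have "length lam = Suc l" by (simp add: lam_def column_def)
  then have "sum_list nu = (\<Sum>r<Suc l. part_at nu r)"
    using part_le_length[OF H(1,3)] by (intro sum_list_part_at) simp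
  \<comment> \<open>Row 0 has a spare box while row \<open>l\<close> may be empty; the two
    indicators shift one box so that the comparison holds row by row.\<close>
  moreover have "(\<Sum>r<Suc l. 1 + of_bool (r = 0)) \<le> (\<Sum>r<Suc l. part_at nu r + of_bool (r = l))"
  proof (rule sum_mono)
    fix r assume "r \<in> {..<Suc l}"
    then show "1 + of_bool (r = 0) \<le> part_at nu r + of_bool (r = l)"
      using two H(2)[of r] by (cases "r = l") (auto simp: part_at_hook)
  qed
  moreover have "(\<Sum>r<Suc l. of_bool (r = 0)) = (1 :: nat)" "(\<Sum>r<Suc l. of_bool (r = l)) = (1 :: nat)"
    by (simp_all add: of_bool_def)
  moreover have "(\<Sum>r<Suc l. 1 + of_bool (r = 0)) = Suc l + (\<Sum>r<Suc l. of_bool (r = 0))"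
    unfolding sum.distrib by simp
  ultimately have "Suc l \<le> sum_list nu" unfolding sum.distrib by linarith
  moreover have "strip_weight lam mu = 0" using strip_row by (simp add: col.strip_weight_def)
  moreover have "sum_list mu * Suc (sum_list lam * length lam) \<le> sum_list nu * Suc (sum_list lam * length lam)"
    using \<open>Suc l \<le> sum_list nu\<close> by (intro mult_le_mono1) simp
  ultimately show ?thesis unfolding hrank_def by linarith
qed

text \<open>Joint injectivity runs over all strips, both columns being recovered from the
  \<open>None\<close> component; surjectivity is shown for the other shapes and the exterior
  power.\<close>

lemma hook_iso:
  defines "H \<equiv> {nu \<in> hstrips lam. 2 \<le> part_at nu 0}"
  shows "fa_iso (S_P lam :: 'k::field_char_0 tensor famod)
    (fa_dsum (Some ` H \<union> {None}) (\<lambda>i. case i of Some nu \<Rightarrow> S_Pbar nu | None \<Rightarrow> Lambda_P (Suc l)))"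
proof -
  have mu: "mu \<in> hstrips lam" using column_hstrips by blast
  have pos: "0 < sum_list lam" using s by (simp add: sum_lam)
  have finH: "finite H" using finite_hstrips[OF hook_partition] by (simp add: H_def)
  have HD: "nu \<in> hstrips lam" "2 \<le> part_at nu 0" if "nu \<in> H" for nu using that by (simp_all add: H_def)
  have mu_notin: "mu \<notin> H" "column l \<notin> H" by (auto simp: H_def part_at_column)
  obtain T :: "nat list \<Rightarrow> nat \<Rightarrow> 'k tensor \<Rightarrow> 'k tensor" where T: "\<And>nu. nu \<in> H \<Longrightarrow> is_retraction nu (T nu)"
    using is_retraction_exists[OF HD(2), where 'k = 'k] by metis
  have natT: "natural (sum_list nu) (sum_list nu) (T nu)" if "nu \<in> H" for nu
    using T[OF that] by (simp add: is_retraction_def)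
  have linT: "lin (T nu m)" if "nu \<in> H" for nu m
    using natT[OF that] by (simp add: natural_def)
  define \<Phi> where "\<Phi> i m u = (case i of Some nu \<Rightarrow> T nu m (forget lam nu m u) | None \<Rightarrow> forget lam mu m u)" for i m u
  \<comment> \<open>With the lowest rank, preimages for the exterior power need not vanish in the
    other components, while preimages for the other shapes vanish in it by
    \<open>hrank_column_le\<close>.\<close>
  define rank where "rank i = (case i of Some nu \<Rightarrow> Suc (hrank lam nu) | None \<Rightarrow> 0)" for i
  define B :: "nat list option \<Rightarrow> 'k tensor famod" where
    "B i = (case i of Some nu \<Rightarrow> S_Pbar nu | None \<Rightarrow> Lambda_P (Suc l))" for i
  let ?I = "Some ` H \<union> {None}"
  have lin: "lin (\<Phi> i m)" if "i \<in> ?I" for i m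
  proof (cases i)
    case None
    then show ?thesis by (simp add: \<Phi>_def[abs_def] lin_forget)
  next
    case (Some nu)
    then have "nu \<in> H" using that by auto
    from lin_comp[OF linT[OF this] lin_forget] show ?thesis using Some by (simp add: \<Phi>_def[abs_def])
  qed
  have into: "\<Phi> i m u \<in> obj (B i) m" if i: "i \<in> ?I" and u: "u \<in> obj (S_P lam) m" for i m u
  proof (cases i)
    case None
    obtain v where v: "v \<in> tens (sum_list lam) m" "u = young_sym lam v" using u by (auto simp: obj_S_P)
    show ?thesis
    proof (cases m)
      case 0
      have z: "(\<lambda>_. 0) \<in> tens (Suc l) 0" by (simp add: tens_iff)
      have "u = (\<lambda>_. 0)" using obj_S_P_0[OF pos] u 0 by blast
      then have "\<Phi> i m u = young_sym mu (\<lambda>_. 0)"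
        using None by (simp add: \<Phi>_def lin_zero[OF lin_forget] lin_zero[OF lin_young_sym])
      then show ?thesis using imageI[OF z, of "young_sym mu"] None 0 by (simp add: B_def obj_Lambda_P)
    next
      case (Suc M)
      then show ?thesis using forget_column_image[of v M] v None by (simp add: \<Phi>_def B_def obj_Lambda_P)
    qed
  next
    case (Some nu)
    then show ?thesis using i component_into[OF T HD u] by (auto simp: \<Phi>_def B_def)
  qed
  have nat: "\<Phi> i m' (act (S_P lam) f m m' u) = act (B i) f m m' (\<Phi> i m u)"
    if i: "i \<in> ?I" and f: "fa_map f m m'" and u: "u \<in> obj (S_P lam) m" for i m m' f u
  proof (cases i)
    case None
    have "u \<in> tens (sum_list lam) m" using u young_sym_tens by (auto simp: obj_S_P)
    then show ?thesis using natural_forget[OF mu, where 'a = 'k] f None unfolding natural_def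
      by (simp add: \<Phi>_def B_def act_S_P act_Lambda_P)
  next
    case (Some nu)
    then show ?thesis using i component_natural[OF natT HD(1) f u] by (auto simp: \<Phi>_def B_def act_S_P act_S_Pbar)
  qed
  have inj: "u = (\<lambda>_. 0)" if u: "u \<in> obj (S_P lam) m" and zero: "\<And>i. i \<in> ?I \<Longrightarrow> \<Phi> i m u = (\<lambda>_. 0)" for m u
  proof (cases m)
    case 0
    then show ?thesis using obj_S_P_0[OF pos] u by blast
  next
    case (Suc M)
    obtain v where v: "v \<in> tens (sum_list lam) (Suc M)" "u = young_sym lam v" using u Suc by (auto simp: obj_S_P)
    \<comment> \<open>For the two columns the forgotten tensor itself is used; it vanishes for
      \<open>mu\<close> by assumption and for the shorter column by
      \<open>forget_short_column\<close>.\<close>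
    define post where "post nu = (if nu \<in> H then T nu (Suc M) else id)" for nu
    show ?thesis unfolding v(2)
    proof (rule schur_injective[OF hook_partition, where post = post])
      show "lin (post nu)" for nu using linT by (auto simp: post_def lin_def)
      show "post nu (young_sym nu (bt M w)) = young_sym nu (bt M w)" if "w \<in> words (sum_list nu) M" for nu w
        using T[of nu] that by (auto simp: post_def is_retraction_def)
      show "v \<in> tens (sum_list lam) (Suc M)" by (rule v(1))
      have fmu: "forget lam mu (Suc M) u = (\<lambda>_. 0)" using zero[of None] Suc by (simp add: \<Phi>_def)
      fix nu assume nu: "nu \<in> hstrips lam"
      then consider "nu \<in> H" | "nu = mu" | "nu = column l" using hstrips_hook_cases[OF nu] by (auto simp: H_def)
      then show "post nu (forget lam nu (Suc M) (young_sym lam v)) = (\<lambda>_. 0)"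
      proof cases
        case 1
        then show ?thesis using zero[of "Some nu"] Suc by (simp add: \<Phi>_def post_def v(2))
      qed (use fmu forget_short_column[OF fmu] mu_notin in \<open>simp_all add: post_def v(2)\<close>)
    qed
  qed
  have surj: "\<exists>u\<in>obj (S_P lam) m. \<Phi> i m u = t \<and> (\<forall>j\<in>?I. j \<noteq> i \<longrightarrow> rank j \<le> rank i \<longrightarrow> \<Phi> j m u = (\<lambda>_. 0))"
    if i: "i \<in> ?I" and t: "t \<in> obj (B i) m" for m i t
  proof (cases m)
    case 0
    have "t = (\<lambda>_. 0)"
    proof (cases i)
      case None
      then show ?thesis using t 0 young_sym_tens[of _ mu 0] tens_0[of "Suc l"]
        by (auto simp: B_def obj_Lambda_P)
    next
      case (Some nu)
      then show ?thesis using t 0 i obj_S_Pbar_0[OF HD(2)] by (auto simp: B_def)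
    qed
    then show ?thesis using lin_zero[OF lin] i by (intro bexI[OF _ obj_S_P_zero]) auto
  next
    case (Suc M)
    show ?thesis
    proof (cases i)
      case None
      then have "t \<in> young_sym mu ` tens (Suc l) (Suc M)" using t Suc by (simp add: B_def obj_Lambda_P)
      then obtain v where "v \<in> tens (sum_list lam) (Suc M)" "forget lam mu (Suc M) (young_sym lam v) = t"
        using forget_column_surjective by blast
      moreover have "\<not> rank j \<le> rank i" if "j \<noteq> i" for j
        using that None by (auto simp: rank_def split: option.splits)
      ultimately show ?thesis using None Suc
        by (intro bexI[of _ "young_sym lam v"]) (auto simp: \<Phi>_def obj_S_P)
    next
      case (Some nu)
      then have nu: "nu \<in> H" using i by auto
      have "t \<in> obj (S_Pbar nu) (Suc M)" using t Some Suc by (simp add: B_def)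
      then obtain u where u: "u \<in> obj (S_P lam) (Suc M)" "T nu (Suc M) (forget lam nu (Suc M) u) = t"
        "\<forall>mu\<in>hstrips lam. mu \<noteq> nu \<longrightarrow> hrank lam mu \<le> hrank lam nu \<longrightarrow> forget lam mu (Suc M) u = (\<lambda>_. 0)"
        using component_surjective[OF hook_partition HD[OF nu] T[OF nu]] by blast
      have "\<Phi> j (Suc M) u = (\<lambda>_. 0)" if j: "j \<in> ?I" "j \<noteq> i" "rank j \<le> rank i" for j
      proof (cases j)
        case None
        have "mu \<noteq> nu" using mu_notin nu by auto
        then show ?thesis using u(3) mu hrank_column_le[OF HD[OF nu]] None by (simp add: \<Phi>_def)
      next
        case (Some nu')
        then have "nu' \<in> H" "nu' \<noteq> nu" "hrank lam nu' \<le> hrank lam nu"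
          using j \<open>i = Some nu\<close> by (auto simp: rank_def)
        then show ?thesis using u(3) HD lin_zero[OF linT] Some by (simp add: \<Phi>_def)
      qed
      then show ?thesis using u(1,2) Some Suc by (intro bexI[of _ u]) (auto simp: \<Phi>_def)
    qed
  qed
  have Blin: "(\<lambda>z. x z + c * y z) \<in> obj (B i) m"
    if i: "i \<in> ?I" and xy: "x \<in> obj (B i) m" "y \<in> obj (B i) m" for i m x y c
  proof (cases i)
    case None
    have "(\<lambda>z. x z + c * y z) \<in> young_sym mu ` tens (Suc l) m"
      by (rule image_subspace[OF lin_young_sym])
        (use xy None in \<open>simp_all add: B_def obj_Lambda_P tens_subspace\<close>)
    then show ?thesis using None by (simp add: B_def obj_Lambda_P)
  next
    case (Some nu)
    then show ?thesis using xy i obj_S_Pbar_subspace[OF HD(2)] by (auto simp: B_def)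
  qed
  have "fa_iso (S_P lam :: 'k tensor famod) (fa_dsum ?I B)"
    by (rule fa_iso_dsumI[where \<Phi> = \<Phi> and rank = rank, OF _ lin obj_S_P_zero obj_S_P_subspace Blin into nat inj surj])
      (use finH in auto)
  then show ?thesis unfolding B_def[abs_def] .
qed

end

theorem mainTheorem17:
  fixes lam :: "nat list" and n :: nat
  assumes "1 \<le> n" and "is_partition lam n"
  shows "(\<not> is_hook lam n \<longrightarrow>
            fa_iso (S_P lam :: 'k::field_char_0 tensor famod)
                   (fa_dsum {nu. is_partition nu (sum_list nu) \<and> part_le nu lam \<and> horizontal_strip lam nu}
                            S_Pbar))
       \<and> (\<forall>s. 1 \<le> s \<and> s \<le> n \<and> lam = s # replicate (n - s) 1 \<longrightarrow>
            fa_iso (S_P lam :: 'k::field_char_0 tensor famod)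
                   (fa_dsum ({Some nu | nu. is_partition nu (sum_list nu) \<and> part_le nu lam
                                   \<and> horizontal_strip lam nu
                                   \<and> nu \<notin> {replicate (n - s + 1) 1, replicate (n - s) 1}} \<union> {None})
                            (\<lambda>i. case i of Some nu \<Rightarrow> S_Pbar nu | None \<Rightarrow> Lambda_P (n - s + 1))))"
proof (intro conjI allI impI)
  assume "\<not> is_hook lam n"
  then show "fa_iso (S_P lam :: 'k tensor famod)
      (fa_dsum {nu. is_partition nu (sum_list nu) \<and> part_le nu lam \<and> horizontal_strip lam nu} S_Pbar)"
    using nonhook_iso[OF assms] by (simp add: hstrips_def)
next
  fix s assume s: "1 \<le> s \<and> s \<le> n \<and> lam = s # replicate (n - s) 1"
  have hook: "hook s" using s by unfold_locales simp
  have lam: "lam = hook.lam s (n - s)" using s by (simp add: hook.lam_def[OF hook] column_def)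
  have I: "{Some nu | nu. is_partition nu (sum_list nu) \<and> part_le nu lam \<and> horizontal_strip lam nu
      \<and> nu \<notin> {replicate (n - s + 1) 1, replicate (n - s) 1}}
    = Some ` {nu \<in> hstrips lam. 2 \<le> part_at nu 0}"
  proof -
    have r: "replicate (n - s + 1) 1 = column (Suc (n - s))" "replicate (n - s) 1 = column (n - s)"
      by (simp_all add: column_def)
    \<comment> \<open>Among the strips of a hook, the two excluded columns are exactly those with at
      most one box in the first row.\<close>
    have "nu \<notin> {replicate (n - s + 1) 1, replicate (n - s) 1} \<longleftrightarrow> 2 \<le> part_at nu 0" if "nu \<in> hstrips lam" for nu
      using hook.hstrips_hook_cases[OF hook, of nu "n - s"] that unfolding lam r
      by (auto simp: part_at_column split: if_splits)
    then show ?thesis by (auto simp: hstrips_def)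
  qed
  show "fa_iso (S_P lam :: 'k tensor famod)
     (fa_dsum ({Some nu | nu. is_partition nu (sum_list nu) \<and> part_le nu lam \<and> horizontal_strip lam nu
        \<and> nu \<notin> {replicate (n - s + 1) 1, replicate (n - s) 1}} \<union> {None})
        (\<lambda>i. case i of Some nu \<Rightarrow> S_Pbar nu | None \<Rightarrow> Lambda_P (n - s + 1)))"
    unfolding I unfolding Suc_eq_plus1[symmetric] lam by (rule hook.hook_iso[OF hook])
qed

end
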